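(* Let $\mathcal A$ be a UHF algebra (uniformly hyperfinite C$^*$-algebra), and let $x_1,\ldots,x_n$ be a family of self-adjoint operators that generates $\mathcal A$. Then $$\delta_{top}(x_1,\ldots,x_n)=1.$$
   Context: A UHF algebra is an infinite dimensional unital C$^*$-algebra that is the norm closure of an increasing union of unital C$^*$-subalgebras (all containing the unit of $\mathcal A$), each isomorphic to a full matrix algebra $\mathcal M_{k}(\mathbb C)$. $\mathcal M_k^{s.a}(\mathbb C)$ is the set of self-adjoint $k\times k$ complex matrices; for a tuple, $\|(A_1,\ldots,A_n)\|=\max_i\|A_i\|$ (operator norms). Let $\{P_r\}_{r=1}^\infty$ be a fixed enumeration of all noncommutative polynomials in $\mathbb C\langle X_1,\ldots,X_n\rangle$ (constant terms allowed, evaluated as multiples of the identity) whose coefficients have rational real and imaginary parts. For $R,\epsilon>0$ and integers $r,k\ge1$, $\Gamma^{(top)}_R(x_1,\ldots,x_n;k,\epsilon,P_1,\ldots,P_r)$ is the set of $(A_1,\ldots,A_n)\in(\mathcal M_k^{s.a}(\mathbb C))^n$ with $\|A_i\|\le R$ for all $i$ and $|\|P_j(A_1,\ldots,A_n)\|-\|P_j(x_1,\ldots,x_n)\||\le\epsilon$ for $1\le j\le r$. $\nu_\infty(\Sigma,\omega)$ is the minimal number of open $\|\cdot\|$-balls of radius $\omega$ with centers in $\Sigma$ covering $\Sigma$. Then (with $\log 0=-\infty$, $0<\omega<1$) $$\delta_{top}(x_1,\ldots,x_n)=\limsup_{\omega\to0^+}\ \sup_{R>0}\ \inf_{\epsilon>0,\,r\in\mathbb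 N}\ \limsup_{k\to\infty}\frac{\log\nu_\infty(\Gamma^{(top)}_R(x_1,\ldots,x_n;k,\epsilon,P_1,\ldots,P_r),\omega)}{-k^2\log\omega}.$$ *)

theory Defs
  imports
    "HOL-Analysis.Elementary_Normed_Spaces"
    "HOL-Library.Poly_Mapping"
    "HOL-Library.Extended_Real"
    "HOL-Library.Extended_Nat"
    "Jordan_Normal_Form.Schur_Decomposition"
begin

section \<open>Unital C*-algebras\<close>

text \<open>The algebra is the whole type; it is nonzero because \<^class>\<open>real_normed_algebra_1\<close>
  requires the unit to have norm one.\<close>

class cstar_algebra = real_normed_algebra_1 + banach +
  fixes scaleC :: "complex \<Rightarrow> 'a \<Rightarrow> 'a"  (infixr "*\<^sub>C" 75)
    and star :: "'a \<Rightarrow> 'a"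
  assumes scaleC_add_right: "c *\<^sub>C (x + y) = c *\<^sub>C x + c *\<^sub>C y"
    and scaleC_add_left: "(c + d) *\<^sub>C x = c *\<^sub>C x + d *\<^sub>C x"
    and scaleC_scaleC: "c *\<^sub>C (d *\<^sub>C x) = (c * d) *\<^sub>C x"
    and scaleR_scaleC: "scaleR r x = complex_of_real r *\<^sub>C x"
    and scaleC_mult_left: "(c *\<^sub>C x) * y = c *\<^sub>C (x * y)"
    and scaleC_mult_right: "x * (c *\<^sub>C y) = c *\<^sub>C (x * y)"
    and norm_scaleC: "norm (c *\<^sub>C x) = cmod c * norm x"
    and star_star: "star (star x) = x"
    and star_add: "star (x + y) = star x + star y"
    and star_scaleC: "star (c *\<^sub>C x) = cnj c *\<^sub>C star x"
    and star_mult: "star (x * y) = star y * star x"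
    and cstar_identity: "norm (star x * x) = (norm x)\<^sup>2"

global_interpretation complex_vs: vector_space "scaleC :: complex \<Rightarrow> 'a::cstar_algebra \<Rightarrow> 'a"
proof
  fix x :: 'a
  show "1 *\<^sub>C x = x"
    using scaleR_scaleC[of 1 x] by simp
qed (simp_all add: scaleC_add_right scaleC_add_left scaleC_scaleC)

definition unital_cstar_subalgebra :: "'a::cstar_algebra set \<Rightarrow> bool" where
  "unital_cstar_subalgebra B \<longleftrightarrow>
     closed B \<and> 1 \<in> B \<and>
     (\<forall>x\<in>B. \<forall>y\<in>B. x + y \<in> B) \<and>
     (\<forall>x\<in>B. \<forall>y\<in>B. x * y \<in> B) \<and>
     (\<forall>c. \<forall>x\<in>B. c *\<^sub>C x \<in> B) \<and>
     (\<forall>x\<in>B. star x \<in> B)"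

text \<open>The (unital) C*-subalgebra generated by \<^term>\<open>S\<close> is the smallest one containing it,
  that is \<^term>\<open>unital_cstar_subalgebra hull S\<close>.\<close>

definition generates_cstar :: "'a::cstar_algebra set \<Rightarrow> bool" where
  "generates_cstar S \<longleftrightarrow> unital_cstar_subalgebra hull S = UNIV"

definition star_isomorphic_mat :: "'a::cstar_algebra set \<Rightarrow> nat \<Rightarrow> bool" where
  "star_isomorphic_mat B k \<longleftrightarrow>
     (\<exists>\<phi> :: 'a \<Rightarrow> complex mat.
        bij_betw \<phi> B (carrier_mat k k) \<and>
        (\<forall>x\<in>B. \<forall>y\<in>B. \<phi> (x + y) = \<phi> x + \<phi> y) \<and>
        (\<forall>x\<in>B. \<forall>y\<in>B. \<phi> (x * y) = \<phi> x * \<phi> y) \<and>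
        (\<forall>c. \<forall>x\<in>B. \<phi> (c *\<^sub>C x) = c \<cdot>\<^sub>m \<phi> x) \<and>
        (\<forall>x\<in>B. \<phi> (star x) = mat_adjoint (\<phi> x)))"

definition uhf_algebra :: "'a::cstar_algebra itself \<Rightarrow> bool" where
  "uhf_algebra (_ :: 'a itself) \<longleftrightarrow>
     \<not> (\<exists>S :: 'a set. finite S \<and> complex_vs.span S = UNIV) \<and>
     (\<exists>B :: nat \<Rightarrow> 'a set.
        incseq B \<and>
        (\<forall>m. unital_cstar_subalgebra (B m) \<and> (\<exists>k\<ge>1. star_isomorphic_mat (B m) k)) \<and>
        closure (\<Union>m. B m) = UNIV)"


section \<open>Matrices\<close>

definition euclid_norm :: "complex vec \<Rightarrow> real" where
  "euclid_norm v = sqrt (\<Sum>i<dim_vec v. (cmod (vec_index v i))\<^sup>2)"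

definition op_norm :: "complex mat \<Rightarrow> real" where
  "op_norm A = (SUP v\<in>{v \<in> carrier_vec (dim_col A). euclid_norm v \<le> 1}. euclid_norm (A *\<^sub>v v))"

definition sa_mats :: "nat \<Rightarrow> complex mat set" where
  "sa_mats k = {A \<in> carrier_mat k k. mat_adjoint A = A}"

definition tuple_norm :: "('n::finite \<Rightarrow> complex mat) \<Rightarrow> real" where
  "tuple_norm A = Max (range (\<lambda>i. op_norm (A i)))"


section \<open>Noncommutative polynomials\<close>

text \<open>The variables are indexed by a finite type, so \<open>n\<close> is its cardinality. A polynomial is the
  finitely supported family of its coefficients, indexed by the words in the variables; the
  empty word carries the constant term.\<close>

type_synonym 'n ncpoly = "'n list \<Rightarrow>\<^sub>0 complex"

definition rational_ncpolys :: "'n ncpoly set" where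
  "rational_ncpolys =
     {p. \<forall>w. Re (Poly_Mapping.lookup p w) \<in> \<rat> \<and> Im (Poly_Mapping.lookup p w) \<in> \<rat>}"

definition eval_ncpoly :: "'n ncpoly \<Rightarrow> ('n \<Rightarrow> 'a::cstar_algebra) \<Rightarrow> 'a" where
  "eval_ncpoly p x =
     (\<Sum>w\<in>Poly_Mapping.keys p. Poly_Mapping.lookup p w *\<^sub>C prod_list (map x w))"

definition word_mat :: "nat \<Rightarrow> ('n \<Rightarrow> complex mat) \<Rightarrow> 'n list \<Rightarrow> complex mat" where
  "word_mat k A w = foldr (\<lambda>i M. A i * M) w (1\<^sub>m k)"

text \<open>Matrices of all sizes share one type, which is therefore not a
  \<^class>\<open>comm_monoid_add\<close>; the sum over the monomials is taken entrywise.\<close>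

definition eval_ncpoly_mat :: "nat \<Rightarrow> 'n ncpoly \<Rightarrow> ('n \<Rightarrow> complex mat) \<Rightarrow> complex mat" where
  "eval_ncpoly_mat k p A =
     mat k k (\<lambda>(a, b). \<Sum>w\<in>Poly_Mapping.keys p. Poly_Mapping.lookup p w * word_mat k A w $$ (a, b))"


section \<open>Topological free entropy dimension\<close>

definition Gamma_top ::
  "(nat \<Rightarrow> 'n ncpoly) \<Rightarrow> ('n::finite \<Rightarrow> 'a::cstar_algebra) \<Rightarrow> real \<Rightarrow> nat \<Rightarrow> real \<Rightarrow> nat
     \<Rightarrow> ('n \<Rightarrow> complex mat) set" where
  "Gamma_top P x R k \<epsilon> r =
     {A. (\<forall>i. A i \<in> sa_mats k \<and> op_norm (A i) \<le> R) \<and>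
         (\<forall>j\<in>{1..r}. \<bar>op_norm (eval_ncpoly_mat k (P j) A) - norm (eval_ncpoly (P j) x)\<bar> \<le> \<epsilon>)}"

definition covering_number :: "('n::finite \<Rightarrow> complex mat) set \<Rightarrow> real \<Rightarrow> enat" where
  "covering_number \<Sigma> \<omega> =
     (INF C\<in>{C. finite C \<and> C \<subseteq> \<Sigma> \<and> (\<forall>A\<in>\<Sigma>. \<exists>B\<in>C. tuple_norm (\<lambda>i. A i - B i) < \<omega>)}.
        enat (card C))"

definition log_enat :: "enat \<Rightarrow> ereal" where
  "log_enat m = (case m of enat j \<Rightarrow> if j = 0 then -\<infinity> else ereal (ln (real j)) | \<infinity> \<Rightarrow> \<infinity>)"

text \<open>\<^term>\<open>P\<close> is the enumeration of \<^const>\<open>rational_ncpolys\<close>, indexed from 1.\<close>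

definition delta_top :: "(nat \<Rightarrow> 'n ncpoly) \<Rightarrow> ('n::finite \<Rightarrow> 'a::cstar_algebra) \<Rightarrow> ereal" where
  "delta_top P x =
     Limsup (at_right 0) (\<lambda>\<omega>::real.
       SUP R\<in>{0<..}. INF (\<epsilon>, r)\<in>{0<..} \<times> {1..}.
         limsup (\<lambda>k. log_enat (covering_number (Gamma_top P x R k \<epsilon> r) \<omega>) /
                     ereal (- ((real k)\<^sup>2 * ln \<omega>))))"

end

theory Submission
  imports Defs "HOL-Analysis.L2_Norm" "Jordan_Normal_Form.Spectral_Radius"
begin

text \<open>
  Why the dimension is one. Fix generators \<open>x\<close> of the UHF algebra and a scale \<open>\<omega>\<close>. Inside the
  algebra the \<open>x i\<close> are within \<open>\<delta>\<close> of combinations of matrix units \<open>e a b\<close> of some matrix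
  subalgebra of size \<open>m\<close>, and the \<open>e a b\<close> are in turn approximated by polynomials in \<open>x\<close>. A tuple
  \<open>A\<close> of matrices in \<^const>\<open>Gamma_top\<close> reproduces the norms of finitely many polynomials, so the
  same polynomials in \<open>A\<close> almost satisfy the relations of matrix units. Such approximate matrix units
  are close to exact ones (\<open>approximate_matrix_units\<close>): the size is a multiple \<open>m t\<close> and \<open>A\<close> is, up to \<open>\<delta>\<close>, the conjugate
  \<open>W Z W\<^sup>*\<close> of a fixed tuple \<open>Z\<close> by an almost unitary \<open>W\<close>. Hence \<^const>\<open>Gamma_top\<close> is at most as
  large as the unitary group, a manifold of real dimension \<open>k\<^sup>2\<close>, which gives the upper bound
  \<open>(C / \<omega>) ^ k\<^sup>2\<close> for the covering number, with \<open>C\<close> depending on the norms of the \<open>x i\<close> only.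

  For the lower bound, elements \<open>y i\<close> close to \<open>x i\<close> are chosen in a large matrix subalgebra. Its
  isomorphism onto the \<open>k \<times> k\<close> matrices is isometric, so the whole unitary orbit of the image \<open>Z\<close> of
  \<open>y\<close> lies in \<^const>\<open>Gamma_top\<close>. If two unitaries move \<open>Z\<close> to almost the same tuple, their quotient
  almost commutes with \<open>Z\<close>, hence with polynomials in \<open>Z\<close>, hence with the image of a fixed matrix
  algebra of size \<open>K\<close>; this leaves \<open>2 (k / K)\<^sup>2\<close> real parameters at most. Therefore the orbit has
  covering number at least \<open>(c / \<omega>) ^ (k\<^sup>2 - 2 k\<^sup>2 / K\<^sup>2)\<close>. Since the algebra is infinite dimensional,
  \<open>K\<close> can be taken arbitrarily large, after \<open>\<omega>\<close> has tended to zero.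

  Covering and packing numbers of balls in an \<open>N\<close>-dimensional normed space must be controlled by
  \<open>(C / \<omega>) ^ N\<close> with \<open>C\<close> independent of \<open>N\<close>. Instead of comparing volumes, the sums
  \<open>t\<^sub>1 + \<lambda> t\<^sub>2 + \<lambda>\<^sup>2 t\<^sub>3 + \<dots>\<close> over a separated set are counted: a crude estimate, with a
  constant that is bad in \<open>N\<close>, is applied to sums of \<open>j\<close> terms, and the constant disappears in the
  \<open>j\<close>-th root as \<open>j\<close> grows (\<open>separated_card_le\<close> and \<open>separated_set_exists\<close>).

  All matrices, of whatever format, are handled as elements of one normed ring of finitely supported
  infinite matrices. The self-adjoint matrices enter through their diagonalisation
  (\<open>hermitian_diagonalisation\<close>), which yields spectral projections and the Cayley transform.
\<close>

section \<open>The normed star-algebra of finitely supported matrices\<close>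

text \<open>Matrices of all formats are embedded into one ring, so that their algebra and their norm
  estimates become calculations in a type of class \<^class>\<open>real_normed_algebra\<close> without
  dimension side conditions. Rectangular matrices and column vectors are elements as well. The
  ring has no unit; the unit of the \<open>k \<times> k\<close> corner is a projection.\<close>

typedef fmat = "{f :: nat \<Rightarrow> nat \<Rightarrow> complex. \<exists>n. \<forall>i j. n \<le> i \<or> n \<le> j \<longrightarrow> f i j = 0}"
  morphisms ent Fmat
  by (rule exI[of _ "\<lambda>_ _. 0"]) auto

setup_lifting type_definition_fmat

definition rect :: "nat \<Rightarrow> nat \<Rightarrow> fmat set" where
  "rect k l = {A. \<forall>i j. k \<le> i \<or> l \<le> j \<longrightarrow> ent A i j = 0}"

lemma fmat_eqI: "(\<And>i j. ent A i j = ent B i j) \<Longrightarrow> A = B"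
  by (metis ent_inject ext)

lemma rectI: "(\<And>i j. k \<le> i \<or> l \<le> j \<Longrightarrow> ent A i j = 0) \<Longrightarrow> A \<in> rect k l"
  by (auto simp: rect_def)

lemma rectD: "A \<in> rect k l \<Longrightarrow> k \<le> i \<or> l \<le> j \<Longrightarrow> ent A i j = 0"
  by (auto simp: rect_def)

lemma rect_mono: "A \<in> rect k l \<Longrightarrow> k \<le> k' \<Longrightarrow> l \<le> l' \<Longrightarrow> A \<in> rect k' l'"
  unfolding rect_def mem_Collect_eq by (meson le_trans)

lemma ex_rect: "\<exists>k. A \<in> rect k k"
  using ent[of A] by (auto simp: rect_def)

lemma ex_rect2: "\<exists>k. A \<in> rect k k \<and> B \<in> rect k k"
  by (meson ex_rect max.cobounded1 max.cobounded2 rect_mono)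

instantiation fmat :: ab_group_add
begin
lift_definition zero_fmat :: fmat is "\<lambda>_ _. 0" by auto
lift_definition plus_fmat :: "fmat \<Rightarrow> fmat \<Rightarrow> fmat" is "\<lambda>f g i j. f i j + g i j"
proof -
  fix f g :: "nat \<Rightarrow> nat \<Rightarrow> complex"
  assume "\<exists>n. \<forall>i j. n \<le> i \<or> n \<le> j \<longrightarrow> f i j = 0" "\<exists>n. \<forall>i j. n \<le> i \<or> n \<le> j \<longrightarrow> g i j = 0"
  then obtain n m where "\<forall>i j. n \<le> i \<or> n \<le> j \<longrightarrow> f i j = 0" "\<forall>i j. m \<le> i \<or> m \<le> j \<longrightarrow> g i j = 0"
    by auto
  then have "\<forall>i j. max n m \<le> i \<or> max n m \<le> j \<longrightarrow> f i j + g i j = 0"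
    by auto
  then show "\<exists>n. \<forall>i j. n \<le> i \<or> n \<le> j \<longrightarrow> f i j + g i j = 0" ..
qed
lift_definition uminus_fmat :: "fmat \<Rightarrow> fmat" is "\<lambda>f i j. - f i j" by auto
definition minus_fmat :: "fmat \<Rightarrow> fmat \<Rightarrow> fmat" where "minus_fmat A B = A + uminus B"
instance
proof
  fix A B C :: fmat
  show "A - B = A + - B" by (rule minus_fmat_def)
  show "A + B + C = A + (B + C)" "A + B = B + A" "0 + A = A" "- A + A = 0"
    by (rule fmat_eqI; simp add: plus_fmat.rep_eq zero_fmat.rep_eq uminus_fmat.rep_eq)+
qed
end

lemma ent_zero [simp]: "ent 0 i j = 0" by (simp add: zero_fmat.rep_eq)
lemma ent_plus [simp]: "ent (A + B) i j = ent A i j + ent B i j" by (simp add: plus_fmat.rep_eq)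
lemma ent_uminus [simp]: "ent (- A) i j = - ent A i j" by (simp add: uminus_fmat.rep_eq)
lemma ent_minus [simp]: "ent (A - B) i j = ent A i j - ent B i j"
  unfolding minus_fmat_def plus_fmat.rep_eq uminus_fmat.rep_eq by simp
lemma ent_sum [simp]: "ent (sum f S) i j = (\<Sum>x\<in>S. ent (f x) i j)"
  by (induction S rule: infinite_finite_induct) auto

lift_definition cs :: "complex \<Rightarrow> fmat \<Rightarrow> fmat" is "\<lambda>c f i j. c * f i j" by auto
lift_definition adj :: "fmat \<Rightarrow> fmat" is "\<lambda>f i j. cnj (f j i)" by auto

lemma ent_cs [simp]: "ent (cs c A) i j = c * ent A i j" by (simp add: cs.rep_eq)
lemma ent_adj [simp]: "ent (adj A) i j = cnj (ent A j i)" by (simp add: adj.rep_eq)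

lift_definition times_fmat' :: "fmat \<Rightarrow> fmat \<Rightarrow> fmat"
  is "\<lambda>f g i j. \<Sum>l | f i l \<noteq> 0. f i l * g l j"
proof -
  fix f g :: "nat \<Rightarrow> nat \<Rightarrow> complex"
  assume "\<exists>n. \<forall>i j. n \<le> i \<or> n \<le> j \<longrightarrow> f i j = 0" "\<exists>n. \<forall>i j. n \<le> i \<or> n \<le> j \<longrightarrow> g i j = 0"
  then obtain n m where "\<forall>i j. n \<le> i \<or> n \<le> j \<longrightarrow> f i j = 0" "\<forall>i j. m \<le> i \<or> m \<le> j \<longrightarrow> g i j = 0"
    by auto
  then have "\<forall>i j. max n m \<le> i \<or> max n m \<le> j \<longrightarrow> (\<Sum>l | f i l \<noteq> 0. f i l * g l j) = 0"
    by (auto intro!: sum.neutral)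
  then show "\<exists>n. \<forall>i j. n \<le> i \<or> n \<le> j \<longrightarrow> (\<Sum>l | f i l \<noteq> 0. f i l * g l j) = 0" ..
qed

instantiation fmat :: times
begin
definition times_fmat :: "fmat \<Rightarrow> fmat \<Rightarrow> fmat" where "times_fmat = times_fmat'"
instance ..
end

lemma ent_times:
  assumes "A \<in> rect k l"
  shows "ent (A * B) i j = (\<Sum>m<l. ent A i m * ent B m j)"
  unfolding times_fmat_def times_fmat'.rep_eq
  by (rule sum.mono_neutral_left) (use assms in \<open>auto simp: rect_def not_le[symmetric]\<close>)

lemma ent_times':
  assumes "B \<in> rect l k"
  shows "ent (A * B) i j = (\<Sum>m<l. ent A i m * ent B m j)"
proof -
  obtain n where n: "A \<in> rect n n" using ex_rect by blast
  then have "A \<in> rect (max n l) (max n l)" by (rule rect_mono) auto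
  from ent_times[OF this] have "ent (A * B) i j = (\<Sum>m<max n l. ent A i m * ent B m j)" .
  also have "\<dots> = (\<Sum>m<l. ent A i m * ent B m j)"
    by (rule sum.mono_neutral_right) (use assms in \<open>auto simp: rect_def not_less[symmetric]\<close>)
  finally show ?thesis .
qed

instance fmat :: ring
proof
  fix A B C :: fmat
  obtain k where A: "A \<in> rect k k" using ex_rect by blast
  obtain l where B: "B \<in> rect l l" using ex_rect by blast
  obtain m where C: "C \<in> rect m m" using ex_rect by blast
  show "A * B * C = A * (B * C)"
  proof (rule fmat_eqI)
    fix i j
    have "ent (A * B * C) i j = (\<Sum>q<m. \<Sum>p<k. ent A i p * ent B p q * ent C q j)"
      by (simp add: ent_times'[OF C] ent_times[OF A] sum_distrib_right)
    also have "\<dots> = (\<Sum>p<k. \<Sum>q<m. ent A i p * ent B p q * ent C q j)"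
      by (rule sum.swap)
    also have "\<dots> = ent (A * (B * C)) i j"
      by (simp add: ent_times'[OF C] ent_times[OF A] sum_distrib_left mult.assoc)
    finally show "ent (A * B * C) i j = ent (A * (B * C)) i j" .
  qed
  show "(A + B) * C = A * C + B * C"
    by (rule fmat_eqI) (simp add: ent_times'[OF C] algebra_simps sum.distrib)
  show "A * (B + C) = A * B + A * C"
    by (rule fmat_eqI) (simp add: ent_times[OF A] algebra_simps sum.distrib)
qed

instantiation fmat :: scaleR
begin
definition scaleR_fmat :: "real \<Rightarrow> fmat \<Rightarrow> fmat" where "scaleR_fmat r A = cs (of_real r) A"
instance ..
end

lemma ent_scaleR [simp]: "ent (r *\<^sub>R A) i j = of_real r * ent A i j"
  by (simp add: scaleR_fmat_def)

lemma cs_diff_right: "cs c (A - B) = cs c A - cs c B" by (rule fmat_eqI) (simp add: algebra_simps)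
lemma cs_add_left: "cs (c + d) A = cs c A + cs d A" by (rule fmat_eqI) (simp add: algebra_simps)
lemma cs_cs [simp]: "cs c (cs d A) = cs (c * d) A" by (rule fmat_eqI) simp
lemma cs_one [simp]: "cs 1 A = A" by (rule fmat_eqI) simp
lemma cs_zero_left [simp]: "cs 0 A = 0" by (rule fmat_eqI) simp
lemma cs_zero_right [simp]: "cs c 0 = 0" by (rule fmat_eqI) simp
lemma cs_mult_left: "cs c A * B = cs c (A * B)"
proof (rule fmat_eqI)
  fix i j
  obtain l where B: "B \<in> rect l l" using ex_rect by blast
  show "ent (cs c A * B) i j = ent (cs c (A * B)) i j"
    by (simp add: ent_times'[OF B] sum_distrib_left mult.assoc)
qed
lemma cs_mult_right: "A * cs c B = cs c (A * B)"
proof (rule fmat_eqI)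
  fix i j
  obtain l where A: "A \<in> rect l l" using ex_rect by blast
  show "ent (A * cs c B) i j = ent (cs c (A * B)) i j"
    by (simp add: ent_times[OF A] sum_distrib_left algebra_simps)
qed

instance fmat :: real_algebra
proof
  fix a b :: real and A B :: fmat
  show "a *\<^sub>R (A + B) = a *\<^sub>R A + a *\<^sub>R B" by (rule fmat_eqI) (simp add: algebra_simps)
  show "(a + b) *\<^sub>R A = a *\<^sub>R A + b *\<^sub>R A" by (rule fmat_eqI) (simp add: algebra_simps)
  show "a *\<^sub>R b *\<^sub>R A = (a * b) *\<^sub>R A" by (rule fmat_eqI) simp
  show "1 *\<^sub>R A = A" by (rule fmat_eqI) simp
  show "a *\<^sub>R A * B = a *\<^sub>R (A * B)" by (simp add: scaleR_fmat_def cs_mult_left)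
  show "A * a *\<^sub>R B = a *\<^sub>R (A * B)" by (simp add: scaleR_fmat_def cs_mult_right)
qed

lemma adj_adj [simp]: "adj (adj A) = A" by (rule fmat_eqI) simp
lemma adj_zero [simp]: "adj 0 = 0" by (rule fmat_eqI) simp
lemma adj_add: "adj (A + B) = adj A + adj B" by (rule fmat_eqI) simp
lemma adj_diff: "adj (A - B) = adj A - adj B" by (rule fmat_eqI) simp
lemma adj_scaleR: "adj (r *\<^sub>R A) = r *\<^sub>R adj A" by (rule fmat_eqI) simp
lemma adj_cs: "adj (cs c A) = cs (cnj c) (adj A)" by (rule fmat_eqI) simp
lemma adj_sum: "adj (sum f S) = (\<Sum>x\<in>S. adj (f x))" by (rule fmat_eqI) (simp add: cnj_sum)
lemma adj_mult: "adj (A * B) = adj B * adj A"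
proof (rule fmat_eqI)
  fix i j
  obtain k where A: "A \<in> rect k k" using ex_rect by blast
  then have A': "adj A \<in> rect k k" by (auto simp: rect_def)
  show "ent (adj (A * B)) i j = ent (adj B * adj A) i j"
    by (simp add: ent_times[OF A] ent_times'[OF A'] cnj_sum mult.commute)
qed

definition vn :: "nat \<Rightarrow> (nat \<Rightarrow> complex) \<Rightarrow> real" where
  "vn n v = L2_set (\<lambda>i. cmod (v i)) {..<n}"

definition act :: "fmat \<Rightarrow> (nat \<Rightarrow> complex) \<Rightarrow> nat \<Rightarrow> complex" where
  "act A v i = (\<Sum>l | ent A i l \<noteq> 0. ent A i l * v l)"

text \<open>The supremum runs over all sequences whose truncations lie in the unit balls, so that the
  format of the matrix does not enter.\<close>

definition fnorm :: "fmat \<Rightarrow> real" where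
  "fnorm A = Sup {vn n (act A v) | n v. \<forall>m. vn m v \<le> 1}"

lemma act_eq: "A \<in> rect k l \<Longrightarrow> act A v i = (\<Sum>m<l. ent A i m * v m)"
  unfolding act_def
  by (rule sum.mono_neutral_left) (auto simp: rect_def not_le[symmetric])

lemma act_zero_above: "A \<in> rect k l \<Longrightarrow> k \<le> i \<Longrightarrow> act A v i = 0"
  by (simp add: act_eq rect_def)

lemma act_times: "act (A * B) v = act A (act B v)"
proof
  fix i
  obtain k where A: "A \<in> rect k k" and B: "B \<in> rect k k" using ex_rect2 by blast
  have AB: "A * B \<in> rect k k"
    using A B by (intro rectI) (auto simp: ent_times[OF A] intro!: sum.neutral dest: rectD)
  have "act (A * B) v i = (\<Sum>q<k. \<Sum>p<k. ent A i p * ent B p q * v q)"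
    by (simp add: act_eq[OF AB] ent_times[OF A] sum_distrib_right)
  also have "\<dots> = (\<Sum>p<k. \<Sum>q<k. ent A i p * ent B p q * v q)" by (rule sum.swap)
  also have "\<dots> = act A (act B v) i"
    by (simp add: act_eq[OF A] act_eq[OF B] sum_distrib_left mult.assoc)
  finally show "act (A * B) v i = act A (act B v) i" .
qed

lemma vn_nonneg [simp]: "0 \<le> vn n v" by (simp add: vn_def)
lemma vn_mono: "n \<le> m \<Longrightarrow> vn n v \<le> vn m v"
  unfolding vn_def L2_set_def by (intro real_sqrt_le_mono sum_mono2) auto
lemma vn_eq_above: "(\<And>i. k \<le> i \<Longrightarrow> v i = 0) \<Longrightarrow> k \<le> n \<Longrightarrow> vn n v = vn k v"
  unfolding vn_def L2_set_def by (intro arg_cong[of _ _ sqrt] sum.mono_neutral_right) auto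
lemma vn_le_above: "(\<And>i. k \<le> i \<Longrightarrow> v i = 0) \<Longrightarrow> vn n v \<le> vn k v"
  by (metis linorder_le_cases order_refl vn_eq_above vn_mono)
lemma cmod_le_vn: "i < n \<Longrightarrow> cmod (v i) \<le> vn n v"
  unfolding vn_def by (rule member_le_L2_set) auto
lemma vn_scale: "vn n (\<lambda>i. c * v i) = cmod c * vn n v"
  unfolding vn_def by (simp add: norm_mult L2_set_right_distrib)
lemma vn_triangle: "vn n (\<lambda>i. u i + v i) \<le> vn n u + vn n v"
proof -
  have "vn n (\<lambda>i. u i + v i) \<le> L2_set (\<lambda>i. cmod (u i) + cmod (v i)) {..<n}"
    unfolding vn_def by (rule L2_set_mono) (auto simp: norm_triangle_ineq)
  also have "\<dots> \<le> vn n u + vn n v" unfolding vn_def by (rule L2_set_triangle_ineq)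
  finally show ?thesis .
qed
lemma vn_square: "(vn n v)\<^sup>2 = (\<Sum>i<n. (cmod (v i))\<^sup>2)"
  unfolding vn_def L2_set_def by (simp add: sum_nonneg)

lemma vn_act_le_sum:
  assumes A: "A \<in> rect k l" and v: "\<And>m. vn m v \<le> 1"
  shows "vn n (act A v) \<le> (\<Sum>i<k. \<Sum>j<l. cmod (ent A i j))"
proof -
  have v1: "cmod (v i) \<le> 1" for i using cmod_le_vn[of i "Suc i" v] v[of "Suc i"] by simp
  have "vn n (act A v) \<le> vn k (act A v)"
    by (rule vn_le_above) (rule act_zero_above[OF A])
  also have "\<dots> \<le> (\<Sum>i<k. cmod (act A v i))"
    unfolding vn_def by (rule L2_set_le_sum) auto
  also have "\<dots> \<le> (\<Sum>i<k. \<Sum>j<l. cmod (ent A i j))"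
    unfolding act_eq[OF A]
    by (intro sum_mono order.trans[OF norm_sum]) (auto simp: norm_mult intro!: mult_left_le v1)
  finally show ?thesis .
qed

lemma fnorm_bdd: "bdd_above {vn n (act A v) | n v. \<forall>m. vn m v \<le> 1}"
proof -
  obtain k where "A \<in> rect k k" using ex_rect by blast
  then show ?thesis using vn_act_le_sum[of A k k] by (intro bdd_aboveI) blast
qed

lemma fnorm_leI:
  assumes "\<And>n v. (\<And>m. vn m v \<le> 1) \<Longrightarrow> vn n (act A v) \<le> c"
  shows "fnorm A \<le> c"
  unfolding fnorm_def
proof (rule cSup_least)
  have "vn 0 (act A (\<lambda>_. 0)) \<in> {vn n (act A v) | n v. \<forall>m. vn m v \<le> 1}"
    by (auto simp: vn_def L2_set_def intro!: exI[of _ 0] exI[of _ "\<lambda>_. 0"])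
  then show "{vn n (act A v) | n v. \<forall>m. vn m v \<le> 1} \<noteq> {}" by blast
qed (use assms in blast)

lemma vn_act_le_fnorm1: "(\<And>m. vn m v \<le> 1) \<Longrightarrow> vn n (act A v) \<le> fnorm A"
  unfolding fnorm_def by (rule cSup_upper[OF _ fnorm_bdd]) blast

lemma fnorm_nonneg: "0 \<le> fnorm A"
  using vn_act_le_fnorm1[of "\<lambda>_. 0" 0 A] by (force simp: vn_def L2_set_def)

lemma act_scale: "act A (\<lambda>i. c * v i) i = c * act A v i"
  by (simp add: act_def sum_distrib_left algebra_simps)

lemma vn_act_le_fnorm:
  assumes "\<And>m. vn m v \<le> c"
  shows "vn n (act A v) \<le> fnorm A * c"
proof (cases "c = 0")
  case True
  then have "v i = 0" for i
    using order.trans[OF cmod_le_vn[of i "Suc i" v] assms[of "Suc i"]] by simp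
  then show ?thesis using True by (simp add: act_def vn_def L2_set_def)
next
  case False
  then have c: "c > 0" using assms[of 0] vn_nonneg[of 0 v] by linarith
  have "vn m (\<lambda>i. of_real (1/c) * v i) \<le> 1" for m
    unfolding vn_scale using assms[of m] c by (simp add: norm_divide field_simps)
  then have "vn n (act A (\<lambda>i. of_real (1/c) * v i)) \<le> fnorm A" by (rule vn_act_le_fnorm1)
  moreover have "vn n (act A (\<lambda>i. of_real (1/c) * v i)) = (1/c) * vn n (act A v)"
    unfolding act_scale[abs_def] vn_scale using c by (simp add: norm_divide)
  ultimately have "1 / c * vn n (act A v) \<le> fnorm A" by simp
  then show ?thesis using c by (simp add: pos_divide_le_eq)
qed

lemma fnorm_le_sum: "A \<in> rect k l \<Longrightarrow> fnorm A \<le> (\<Sum>i<k. \<Sum>j<l. cmod (ent A i j))"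
  by (rule fnorm_leI) (rule vn_act_le_sum)

lemma cmod_ent_le_fnorm: "cmod (ent A i j) \<le> fnorm A"
proof -
  obtain k where A: "A \<in> rect k k" using ex_rect by blast
  have "vn m (\<lambda>l. if l = j then 1 else 0) \<le> 1" for m
  proof (cases "j < m")
    case True
    have "(\<Sum>i<m. (cmod (if i = j then 1 else 0))\<^sup>2) = (\<Sum>i<m. if i = j then 1 else 0)"
      by (rule sum.cong) auto
    then show ?thesis using True by (simp add: vn_def L2_set_def)
  next
    case False
    then have "vn m (\<lambda>l. if l = j then 1 else 0) = 0"
      unfolding vn_def by (intro L2_set_0') auto
    then show ?thesis by simp
  qed
  then have *: "vn (Suc i) (act A (\<lambda>l. if l = j then 1 else 0)) \<le> fnorm A" by (rule vn_act_le_fnorm1)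
  have "act A (\<lambda>l. if l = j then 1 else 0) i = ent A i j"
    using rectD[OF A, of i j] by (auto simp: act_eq[OF A] if_distrib cong: if_cong)
  with cmod_le_vn[of i "Suc i" "act A (\<lambda>l. if l = j then 1 else 0)"] * show ?thesis by simp
qed

instantiation fmat :: real_normed_algebra
begin
definition norm_fmat :: "fmat \<Rightarrow> real" where "norm_fmat = fnorm"
definition dist_fmat :: "fmat \<Rightarrow> fmat \<Rightarrow> real" where "dist_fmat A B = fnorm (A - B)"
definition sgn_fmat :: "fmat \<Rightarrow> fmat" where "sgn_fmat A = inverse (fnorm A) *\<^sub>R A"
definition uniformity_fmat :: "(fmat \<times> fmat) filter" where
  "uniformity_fmat = (INF e\<in>{0 <..}. principal {(x, y). dist x y < e})"
definition open_fmat :: "fmat set \<Rightarrow> bool" where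
  "open_fmat U = (\<forall>x\<in>U. eventually (\<lambda>(x', y). x' = x \<longrightarrow> y \<in> U) uniformity)"
instance
proof
  fix A B :: fmat and a :: real
  show "dist A B = norm (A - B)" by (simp add: dist_fmat_def norm_fmat_def)
  show "sgn A = inverse (norm A) *\<^sub>R A" by (simp add: sgn_fmat_def norm_fmat_def)
  show "uniformity = (INF e\<in>{0 <..}. principal {(x, y::fmat). dist x y < e})"
    by (simp add: uniformity_fmat_def)
  show "open U = (\<forall>x\<in>U. eventually (\<lambda>(x', y). x' = x \<longrightarrow> y \<in> U) uniformity)" for U :: "fmat set"
    by (simp add: open_fmat_def)
  show "(norm A = 0) = (A = 0)" unfolding norm_fmat_def
  proof
    assume "fnorm A = 0"
    then show "A = 0" using cmod_ent_le_fnorm[of A] by (intro fmat_eqI) simp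
  next
    assume "A = 0"
    moreover have "fnorm (0::fmat) \<le> 0"
      by (rule fnorm_leI) (simp add: act_def vn_def L2_set_def)
    ultimately show "fnorm A = 0" using fnorm_nonneg[of A] by simp
  qed
  show "norm (A + B) \<le> norm A + norm B" unfolding norm_fmat_def
  proof (rule fnorm_leI)
    fix n v assume v: "\<And>m. vn m v \<le> 1"
    obtain k where AB: "A \<in> rect k k" "B \<in> rect k k" using ex_rect2 by blast
    then have "A + B \<in> rect k k" by (auto simp: rect_def)
    with AB have "act (A + B) v = (\<lambda>i. act A v i + act B v i)"
      by (auto simp: act_eq algebra_simps sum.distrib)
    then have "vn n (act (A + B) v) \<le> vn n (act A v) + vn n (act B v)" by (simp add: vn_triangle)
    also have "\<dots> \<le> fnorm A + fnorm B" by (intro add_mono vn_act_le_fnorm1 v)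
    finally show "vn n (act (A + B) v) \<le> fnorm A + fnorm B" .
  qed
  have le: "fnorm (a *\<^sub>R A) \<le> \<bar>a\<bar> * fnorm A" for a and A :: fmat
  proof (rule fnorm_leI)
    fix n v assume v: "\<And>m. vn m v \<le> 1"
    obtain k where A: "A \<in> rect k k" using ex_rect by blast
    then have "a *\<^sub>R A \<in> rect k k" by (auto simp: rect_def)
    with A have "act (a *\<^sub>R A) v = (\<lambda>i. of_real a * act A v i)"
      by (auto simp: act_eq sum_distrib_left mult.assoc)
    then show "vn n (act (a *\<^sub>R A) v) \<le> \<bar>a\<bar> * fnorm A"
      using vn_act_le_fnorm1[OF v, of n A] by (simp add: vn_scale mult_left_mono)
  qed
  have "fnorm (a *\<^sub>R A) = \<bar>a\<bar> * fnorm A"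
  proof (cases "a = 0")
    case True
    with le[of 0 A] fnorm_nonneg[of "a *\<^sub>R A"] show ?thesis by simp
  next
    case False
    have "fnorm ((1/a) *\<^sub>R (a *\<^sub>R A)) \<le> \<bar>1/a\<bar> * fnorm (a *\<^sub>R A)" by (rule le)
    then have "\<bar>a\<bar> * fnorm A \<le> fnorm (a *\<^sub>R A)" using False by (simp add: field_simps)
    with le[of a A] show ?thesis by linarith
  qed
  then show "norm (a *\<^sub>R A) = \<bar>a\<bar> * norm A" by (simp add: norm_fmat_def)
  show "norm (A * B) \<le> norm A * norm B" unfolding norm_fmat_def
    by (rule fnorm_leI) (simp add: act_times vn_act_le_fnorm vn_act_le_fnorm1)
qed
end

lemmas norm_fmat_leI = fnorm_leI[folded norm_fmat_def]
  and vn_act_le1 = vn_act_le_fnorm1[folded norm_fmat_def]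
  and norm_le_sum = fnorm_le_sum[folded norm_fmat_def]
  and cmod_ent_le = cmod_ent_le_fnorm[folded norm_fmat_def]

definition ip :: "nat \<Rightarrow> (nat \<Rightarrow> complex) \<Rightarrow> (nat \<Rightarrow> complex) \<Rightarrow> complex" where
  "ip n u v = (\<Sum>i<n. cnj (u i) * v i)"

lemma cmod_ip_le: "cmod (ip n u v) \<le> vn n u * vn n v"
proof -
  have "cmod (ip n u v) \<le> (\<Sum>i<n. \<bar>cmod (u i)\<bar> * \<bar>cmod (v i)\<bar>)"
    unfolding ip_def by (rule order.trans[OF norm_sum]) (simp add: norm_mult)
  also have "\<dots> \<le> vn n u * vn n v" unfolding vn_def by (rule L2_set_mult_ineq)
  finally show ?thesis .
qed

lemma cmod_ip_same: "cmod (ip n v v) = (vn n v)\<^sup>2"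
proof -
  have "ip n v v = of_real (\<Sum>i<n. (cmod (v i))\<^sup>2)"
    unfolding ip_def of_real_sum
    by (rule sum.cong) (simp_all add: complex_norm_square mult.commute del: of_real_power)
  then show ?thesis by (simp add: vn_square sum_nonneg flip: of_real_sum)
qed

lemma ip_act:
  assumes A: "A \<in> rect k k"
  shows "ip k u (act A v) = ip k (act (adj A) u) v"
proof -
  have A': "adj A \<in> rect k k" using A by (auto simp: rect_def)
  have "ip k u (act A v) = (\<Sum>i<k. \<Sum>j<k. cnj (u i) * (ent A i j * v j))"
    by (simp add: ip_def act_eq[OF A] sum_distrib_left)
  also have "\<dots> = (\<Sum>j<k. \<Sum>i<k. cnj (u i) * (ent A i j * v j))" by (rule sum.swap)
  also have "\<dots> = ip k (act (adj A) u) v"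
    by (simp add: ip_def act_eq[OF A'] sum_distrib_right sum_distrib_left cnj_sum algebra_simps)
  finally show ?thesis .
qed

text \<open>This half of the C*-identity is \<open>\<langle>A v, A v\<rangle> = \<langle>v, A\<^sup>* A v\<rangle>\<close> with the Cauchy-Schwarz inequality; the
  other half, and the invariance of the norm under \<^const>\<open>adj\<close>, follow from it.\<close>

lemma norm_square_le: "(norm A)\<^sup>2 \<le> norm (adj A * A)"
proof -
  obtain k where A: "A \<in> rect k k" using ex_rect by blast
  have "norm A \<le> sqrt (norm (adj A * A))"
  proof (rule norm_fmat_leI)
    fix n v assume v: "\<And>m. vn m v \<le> 1"
    have "vn n (act A v) \<le> vn k (act A v)"
      by (rule vn_le_above) (rule act_zero_above[OF A])
    moreover have "(vn k (act A v))\<^sup>2 = cmod (ip k v (act (adj A * A) v))"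
      using ip_act[of "adj A" k v "act A v"] A by (simp add: cmod_ip_same act_times rect_def)
    moreover have "\<dots> \<le> 1 * norm (adj A * A)"
      by (rule order.trans[OF cmod_ip_le]) (intro mult_mono v vn_act_le1, auto)
    ultimately show "vn n (act A v) \<le> sqrt (norm (adj A * A))"
      by (smt (verit) real_le_rsqrt)
  qed
  then show ?thesis by (metis norm_ge_zero power_mono real_sqrt_pow2)
qed

lemma norm_adj [simp]: "norm (adj A) = norm A"
proof -
  have "norm A \<le> norm (adj A)" for A
  proof (cases "norm A = 0")
    case False
    have "norm A * norm A \<le> norm (adj A) * norm A"
      using norm_square_le[of A] norm_mult_ineq[of "adj A" A] by (simp add: power2_eq_square)
    then show ?thesis using False by simp
  qed simp
  from this[of A] this[of "adj A"] show ?thesis by simp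
qed

lemma norm_adj_mult_self: "norm (adj A * A) = (norm A)\<^sup>2"
  using norm_square_le[of A] norm_mult_ineq[of "adj A" A] by (simp add: power2_eq_square)

lemma norm_mult_adj_self: "norm (A * adj A) = (norm A)\<^sup>2"
  using norm_adj_mult_self[of "adj A"] by simp

lemma rect_zero [simp]: "0 \<in> rect k l" by (simp add: rect_def)
lemma rect_add: "A \<in> rect k l \<Longrightarrow> B \<in> rect k l \<Longrightarrow> A + B \<in> rect k l" by (simp add: rect_def)
lemma rect_diff: "A \<in> rect k l \<Longrightarrow> B \<in> rect k l \<Longrightarrow> A - B \<in> rect k l" by (simp add: rect_def)
lemma rect_cs: "A \<in> rect k l \<Longrightarrow> cs c A \<in> rect k l" by (simp add: rect_def)
lemma rect_scaleR: "A \<in> rect k l \<Longrightarrow> r *\<^sub>R A \<in> rect k l" by (simp add: rect_def)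
lemma rect_sum: "(\<And>x. x \<in> S \<Longrightarrow> f x \<in> rect k l) \<Longrightarrow> sum f S \<in> rect k l" by (simp add: rect_def)
lemma rect_adj: "A \<in> rect k l \<Longrightarrow> adj A \<in> rect l k" by (auto simp: rect_def)
lemma rect_times: "A \<in> rect k l \<Longrightarrow> B \<in> rect l' m \<Longrightarrow> A * B \<in> rect k m"
  by (rule rectI) (auto simp: ent_times dest: rectD intro!: sum.neutral)

lift_definition diagm :: "nat \<Rightarrow> (nat \<Rightarrow> complex) \<Rightarrow> fmat"
  is "\<lambda>k d i j. if i = j \<and> i < k then d i else 0"
proof -
  fix k and d :: "nat \<Rightarrow> complex"
  have "\<forall>i j. k \<le> i \<or> k \<le> j \<longrightarrow> (if i = j \<and> i < k then d i else 0) = 0" by auto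
  then show "\<exists>n. \<forall>i j. n \<le> i \<or> n \<le> j \<longrightarrow> (if i = j \<and> i < k then d i else 0) = 0" ..
qed

lemma ent_diagm [simp]: "ent (diagm k d) i j = (if i = j \<and> i < k then d i else 0)"
  by (simp add: diagm.rep_eq)

definition idm :: "nat \<Rightarrow> fmat" where "idm k = diagm k (\<lambda>_. 1)"

lemma ent_idm [simp]: "ent (idm k) i j = (if i = j \<and> i < k then 1 else 0)" by (simp add: idm_def)

lemma rect_diagm [simp, intro]: "diagm k d \<in> rect k k" by (auto simp: rect_def)
lemma rect_idm [simp, intro]: "idm k \<in> rect k k" by (auto simp: rect_def)

lemma ent_diagm_times: "ent (diagm k d * B) i j = (if i < k then d i * ent B i j else 0)"
proof -
  have "(\<Sum>m<k. ent (diagm k d) i m * ent B m j) = (\<Sum>m<k. if m = i then d i * ent B i j else 0)"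
    by (rule sum.cong) auto
  then show ?thesis by (simp add: ent_times[of _ k k])
qed

lemma ent_times_diagm: "ent (B * diagm k d) i j = (if j < k then ent B i j * d j else 0)"
proof -
  have "(\<Sum>m<k. ent B i m * ent (diagm k d) m j) = (\<Sum>m<k. if m = j then ent B i j * d j else 0)"
    by (rule sum.cong) auto
  then show ?thesis by (simp add: ent_times'[of _ k k])
qed

lemma idm_mult: "A \<in> rect k l \<Longrightarrow> idm k * A = A"
  by (rule fmat_eqI) (auto simp: idm_def ent_diagm_times rect_def)
lemma mult_idm: "A \<in> rect k l \<Longrightarrow> A * idm l = A"
  by (rule fmat_eqI) (auto simp: idm_def ent_times_diagm rect_def)
lemma idm_idm [simp]: "idm k * idm k = idm k" by (rule idm_mult[OF rect_idm])
lemma adj_diagm: "adj (diagm k d) = diagm k (\<lambda>i. cnj (d i))" by (rule fmat_eqI) auto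
lemma adj_idm [simp]: "adj (idm k) = idm k" by (rule fmat_eqI) auto
lemma diagm_mult: "diagm k d * diagm k e = diagm k (\<lambda>i. d i * e i)"
  by (rule fmat_eqI) (simp add: ent_diagm_times)
lemma diagm_diff: "diagm k d - diagm k e = diagm k (\<lambda>i. d i - e i)"
  by (rule fmat_eqI) simp

lemma norm_diagm_le:
  assumes c: "0 \<le> c" and d: "\<And>i. i < k \<Longrightarrow> cmod (d i) \<le> c"
  shows "norm (diagm k d) \<le> c"
proof (rule norm_fmat_leI)
  fix n v assume v: "\<And>m. vn m v \<le> 1"
  have a: "act (diagm k d) v i = (if i < k then d i * v i else 0)" for i
  proof -
    have "(\<Sum>m<k. ent (diagm k d) i m * v m) = (\<Sum>m<k. if m = i then d i * v i else 0)"
      by (rule sum.cong) auto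
    then show ?thesis by (simp add: act_eq[of _ k k])
  qed
  have "vn n (act (diagm k d) v) \<le> L2_set (\<lambda>i. c * cmod (v i)) {..<n}"
    unfolding vn_def
    by (rule L2_set_mono) (use c d in \<open>auto simp: a norm_mult mult_right_mono\<close>)
  also have "\<dots> = c * vn n v" unfolding vn_def using c by (simp add: L2_set_right_distrib)
  also have "\<dots> \<le> c" using v[of n] c by (simp add: mult_left_le)
  finally show "vn n (act (diagm k d) v) \<le> c" .
qed

lemma norm_idm_le: "norm (idm k) \<le> 1"
  unfolding idm_def by (rule norm_diagm_le) auto

text \<open>Multiplication by \<open>c\<close> is multiplication by a diagonal matrix, which settles one inequality; the
  other one is the same for \<open>1 / c\<close>.\<close>

lemma norm_cs: "norm (cs c A) = cmod c * norm A"
proof (rule antisym)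
  have le: "norm (cs c A) \<le> cmod c * norm A" for c A
  proof -
    obtain k where A: "A \<in> rect k k" using ex_rect by blast
    have "cs c A = diagm k (\<lambda>_. c) * A"
      using A by (intro fmat_eqI) (auto simp: ent_diagm_times rect_def)
    then show ?thesis
      using norm_mult_ineq[of "diagm k (\<lambda>_. c)" A] norm_diagm_le[of "cmod c" k "\<lambda>_. c"]
      by (smt (verit, best) mult_right_mono norm_ge_zero)
  qed
  then show "norm (cs c A) \<le> cmod c * norm A" .
  show "cmod c * norm A \<le> norm (cs c A)"
  proof (cases "c = 0")
    case False
    then show ?thesis using le[of "inverse c" "cs c A"] by (simp add: norm_inverse norm_divide field_simps)
  qed simp
qed

section \<open>Passing between matrices and the ring\<close>

lift_definition emb :: "complex mat \<Rightarrow> fmat"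
  is "\<lambda>M i j. if i < dim_row M \<and> j < dim_col M then M $$ (i, j) else 0"
proof -
  fix M :: "complex mat"
  let ?n = "max (dim_row M) (dim_col M)"
  have "\<forall>i j. ?n \<le> i \<or> ?n \<le> j \<longrightarrow> (if i < dim_row M \<and> j < dim_col M then M $$ (i, j) else 0) = 0"
    by auto
  then show "\<exists>n. \<forall>i j. n \<le> i \<or> n \<le> j \<longrightarrow> (if i < dim_row M \<and> j < dim_col M then M $$ (i, j) else 0) = 0" ..
qed

definition tomat :: "nat \<Rightarrow> fmat \<Rightarrow> complex mat" where
  "tomat k A = mat k k (\<lambda>(i, j). ent A i j)"

lemma ent_emb [simp]: "ent (emb M) i j = (if i < dim_row M \<and> j < dim_col M then M $$ (i, j) else 0)"
  by (simp add: emb.rep_eq)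

lemma tomat_carrier [simp, intro]: "tomat k A \<in> carrier_mat k k" by (simp add: tomat_def)
lemma emb_rect: "M \<in> carrier_mat k l \<Longrightarrow> emb M \<in> rect k l" by (auto simp: rect_def)
lemma emb_tomat [simp]: "A \<in> rect k k \<Longrightarrow> emb (tomat k A) = A"
  by (rule fmat_eqI) (auto simp: tomat_def rect_def)
lemma tomat_emb [simp]: "M \<in> carrier_mat k k \<Longrightarrow> tomat k (emb M) = M"
  by (rule eq_matI) (auto simp: tomat_def)
lemma emb_inj: "M \<in> carrier_mat k k \<Longrightarrow> N \<in> carrier_mat k k \<Longrightarrow> emb M = emb N \<Longrightarrow> M = N"
  by (metis tomat_emb)

lemma emb_add: "M \<in> carrier_mat k l \<Longrightarrow> N \<in> carrier_mat k l \<Longrightarrow> emb (M + N) = emb M + emb N"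
  by (rule fmat_eqI) auto
lemma emb_diff: "M \<in> carrier_mat k l \<Longrightarrow> N \<in> carrier_mat k l \<Longrightarrow> emb (M - N) = emb M - emb N"
  by (rule fmat_eqI) auto
lemma emb_smult: "emb (c \<cdot>\<^sub>m M) = cs c (emb M)" by (rule fmat_eqI) auto
lemma emb_one [simp]: "emb (1\<^sub>m k) = idm k" by (rule fmat_eqI) auto
lemma dim_mat_adjoint [simp]: "dim_row (mat_adjoint M) = dim_col M" "dim_col (mat_adjoint M) = dim_row M"
  by (auto simp: mat_adjoint_def)
lemma emb_adjoint: "emb (mat_adjoint M) = adj (emb M)"
  by (rule fmat_eqI) (auto simp: mat_adjoint_def mat_of_rows_def conjugate_complex_def)
lemma emb_mult:
  assumes "M \<in> carrier_mat k l" "N \<in> carrier_mat l m"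
  shows "emb (M * N) = emb M * emb N"
proof (rule fmat_eqI)
  fix i j
  show "ent (emb (M * N)) i j = ent (emb M * emb N) i j"
    using assms unfolding ent_times[OF emb_rect[OF assms(1)]]
    by (auto simp: scalar_prod_def atLeast0LessThan intro!: sum.cong)
qed

text \<open>A vector of the finite space is extended by zero, a square summable sequence is truncated; both
  operations do not increase the length and do not change the image.\<close>

lemma norm_emb: "norm (emb M) = op_norm M"
proof -
  define k l where "k = dim_row M" and "l = dim_col M"
  have M: "emb M \<in> rect k l" by (auto simp: k_def l_def rect_def)
  let ?S = "{v \<in> carrier_vec l. euclid_norm v \<le> 1}"
  have eq: "euclid_norm (M *\<^sub>v w) = vn k (act (emb M) v)"
    if "w \<in> carrier_vec l" "\<And>i. i < l \<Longrightarrow> v i = w $ i" for v w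
  proof -
    have "(M *\<^sub>v w) $ i = act (emb M) v i" if "i < k" for i
      using that \<open>w \<in> carrier_vec l\<close> \<open>\<And>i. i < l \<Longrightarrow> v i = w $ i\<close>
      by (auto simp: act_eq[OF M] scalar_prod_def k_def l_def atLeast0LessThan intro!: sum.cong)
    then show ?thesis unfolding euclid_norm_def vn_def L2_set_def k_def by simp
  qed
  have le: "euclid_norm (M *\<^sub>v w) \<le> norm (emb M)" if w: "w \<in> ?S" for w
  proof -
    define v where "v i = (if i < l then w $ i else 0)" for i
    have "vn m v \<le> 1" for m
    proof -
      have "vn m v \<le> vn l v" by (rule vn_le_above) (simp add: v_def)
      also have "\<dots> = euclid_norm w" using w by (auto simp: euclid_norm_def vn_def L2_set_def v_def)
      finally show ?thesis using w by auto
    qed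
    then have "vn k (act (emb M) v) \<le> norm (emb M)" by (rule vn_act_le1)
    then show ?thesis using eq[of w v] w by (auto simp: v_def)
  qed
  have bdd: "bdd_above ((\<lambda>w. euclid_norm (M *\<^sub>v w)) ` ?S)"
    using le by (intro bdd_aboveI) auto
  have "op_norm M \<le> norm (emb M)"
    unfolding op_norm_def l_def[symmetric]
  proof (rule cSUP_least)
    have "0\<^sub>v l \<in> ?S" by (simp add: euclid_norm_def)
    then show "?S \<noteq> {}" by blast
  qed (rule le)
  moreover have "norm (emb M) \<le> op_norm M"
  proof (rule norm_fmat_leI)
    fix n v assume v: "\<And>m. vn m v \<le> 1"
    have w: "vec l v \<in> ?S" using v[of l] by (simp add: euclid_norm_def vn_def L2_set_def)
    have "vn n (act (emb M) v) \<le> vn k (act (emb M) v)"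
      by (rule vn_le_above) (rule act_zero_above[OF M])
    also have "\<dots> = euclid_norm (M *\<^sub>v vec l v)" by (rule eq[symmetric]) auto
    also have "\<dots> \<le> op_norm M"
      unfolding op_norm_def l_def[symmetric] by (rule cSUP_upper[OF w bdd])
    finally show "vn n (act (emb M) v) \<le> op_norm M" .
  qed
  ultimately show ?thesis by simp
qed

section \<open>Diagonalisation of Hermitian matrices\<close>

definition unitary_in :: "nat \<Rightarrow> fmat \<Rightarrow> bool" where
  "unitary_in k U \<longleftrightarrow> U \<in> rect k k \<and> adj U * U = idm k \<and> U * adj U = idm k"

lift_definition eu :: "nat \<Rightarrow> nat \<Rightarrow> fmat" is "\<lambda>a b i j. if i = a \<and> j = b then 1 else 0"
proof -
  fix a b
  have "\<forall>i j. Suc (max a b) \<le> i \<or> Suc (max a b) \<le> j \<longrightarrow> (if i = a \<and> j = b then 1 else 0) = (0::complex)" by auto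
  then show "\<exists>n. \<forall>i j. n \<le> i \<or> n \<le> j \<longrightarrow> (if i = a \<and> j = b then 1 else 0) = (0::complex)" ..
qed

lemma ent_eu [simp]: "ent (eu a b) i j = (if i = a \<and> j = b then 1 else 0)" by (simp add: eu.rep_eq)

lemma ent_eu_times: "ent (eu a b * A) i j = (if i = a then ent A b j else 0)"
proof -
  have r: "eu a b \<in> rect (Suc a) (Suc b)" by (auto simp: rect_def)
  have "(\<Sum>m<Suc b. ent (eu a b) i m * ent A m j) = (\<Sum>m<Suc b. if m = b then (if i = a then ent A b j else 0) else 0)"
    by (rule sum.cong) auto
  then show ?thesis by (simp add: ent_times[OF r])
qed

lemma ent_times_eu: "ent (A * eu a b) i j = (if j = b then ent A i a else 0)"
proof -
  have r: "eu a b \<in> rect (Suc a) (Suc b)" by (auto simp: rect_def)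
  have "(\<Sum>m<Suc a. ent A i m * ent (eu a b) m j) = (\<Sum>m<Suc a. if m = a then (if j = b then ent A i a else 0) else 0)"
    by (rule sum.cong) auto
  then show ?thesis by (simp add: ent_times'[OF r])
qed

lemma adj_eu [simp]: "adj (eu a b) = eu b a" by (rule fmat_eqI) auto
lemma eu_mult: "eu a b * eu c d = (if b = c then eu a d else 0)"
  by (rule fmat_eqI) (auto simp: ent_eu_times)
lemma rect_eu: "a < k \<Longrightarrow> b < l \<Longrightarrow> eu a b \<in> rect k l" by (auto simp: rect_def)

text \<open>The Householder reflection that exchanges \<open>v\<close> and the basis vector \<open>e\<close>. A complex reflection does
  this only if the inner product of the two vectors is real, which is the role of \<open>\<alpha>\<close>. Column
  vectors are matrices with a single nonzero column.\<close>

lemma unit_vector_rotation: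
  assumes v: "v \<in> rect k k" "adj v * v = e" "v * e = v" "e * v = \<alpha> *\<^sub>R e"
    and e: "e = eu a a" "a < k"
  shows "\<exists>U. unitary_in k U \<and> U * e = v"
proof -
  have ek: "e \<in> rect k k" and ee: "e * e = e" and ae: "adj e = e"
    unfolding e by (auto simp: rect_eu e eu_mult)
  have ve: "adj v * e = \<alpha> *\<^sub>R e"
    using arg_cong[OF v(4), of adj] by (simp add: adj_mult adj_scaleR ae)
  define w where "w = v - e"
  have we: "w * e = w" by (simp add: w_def left_diff_distrib v ee)
  have ww: "adj w * w = (2 * (1 - \<alpha>)) *\<^sub>R e"
    by (simp add: w_def adj_diff algebra_simps ae v ee ve scaleR_2[symmetric])
  have wk: "w \<in> rect k k" unfolding w_def by (intro rect_diff v ek)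
  show ?thesis
  proof (cases "\<alpha> = 1")
    case True
    then have "(norm w)\<^sup>2 = 0" using norm_adj_mult_self[of w] ww by simp
    then have "v = e" by (simp add: w_def)
    then show ?thesis
      by (intro exI[of _ "idm k"]) (simp add: unitary_in_def idm_mult[OF ek])
  next
    case False
    define b where "b = 1 / (1 - \<alpha>)"
    have b: "(1 - \<alpha>) * b = 1" using False by (simp add: b_def)
    define U where "U = idm k - b *\<^sub>R (w * adj w)"
    have aU: "adj U = U" by (simp add: U_def adj_diff adj_scaleR adj_mult)
    have wakl: "w * adj w \<in> rect k k" by (rule rect_times[OF wk rect_adj[OF wk]])
    have Uk: "U \<in> rect k k" unfolding U_def by (intro rect_diff rect_scaleR wakl rect_idm)
    have www: "w * adj w * (w * adj w) = (2 * (1 - \<alpha>)) *\<^sub>R (w * adj w)"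
    proof -
      have "w * adj w * (w * adj w) = w * (adj w * w) * adj w" by (simp add: mult.assoc)
      also have "\<dots> = (2 * (1 - \<alpha>)) *\<^sub>R (w * adj w)" by (simp add: ww we)
      finally show ?thesis .
    qed
    define q where "q = w * adj w"
    have q: "idm k * q = q" "q * idm k = q" "q * q = (2 * (1 - \<alpha>)) *\<^sub>R q" and Uq: "U = idm k - b *\<^sub>R q"
      using idm_mult[OF wakl] mult_idm[OF wakl] www by (simp_all add: q_def U_def)
    have "U * U = idm k - (2 * b) *\<^sub>R q + (b * b) *\<^sub>R (q * q)"
      by (simp add: Uq algebra_simps q(1,2) flip: scaleR_2)
    also have "\<dots> = idm k"
    proof -
      have "b * b * (2 * (1 - \<alpha>)) = 2 * b" using b by (metis mult.commute mult.left_commute mult.right_neutral)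
      then show ?thesis unfolding q(3) by simp
    qed
    finally have "unitary_in k U" using aU Uk by (simp add: unitary_in_def)
    moreover have "U * e = v"
    proof -
      have "adj w * e = - (1 - \<alpha>) *\<^sub>R e"
        by (simp add: w_def adj_diff left_diff_distrib ve ae ee algebra_simps)
      then have "w * adj w * e = - (1 - \<alpha>) *\<^sub>R w" by (simp add: mult.assoc we)
      moreover have "U * e = e - b *\<^sub>R (w * adj w * e)"
        by (simp only: U_def left_diff_distrib idm_mult[OF ek] mult_scaleR_left)
      ultimately have "U * e = e - b *\<^sub>R (- (1 - \<alpha>) *\<^sub>R w)"
        by simp
      then have "U * e = e + (b * (1 - \<alpha>)) *\<^sub>R w"
        by (simp add: algebra_simps)
      also have "\<dots> = v" using b by (simp add: mult.commute w_def)
      finally show ?thesis .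
    qed
    ultimately show ?thesis by blast
  qed
qed

lemma unitary_in_mult:
  assumes "unitary_in k U" "unitary_in k V"
  shows "unitary_in k (U * V)"
proof -
  have "adj V * (adj U * U) * V = idm k" "U * (V * adj V) * adj U = idm k"
    using assms idm_mult[of V k k] mult_idm[of U k k] by (auto simp: unitary_in_def mult.assoc)
  then show ?thesis
    using assms by (auto simp: unitary_in_def adj_mult mult.assoc intro: rect_times)
qed

text \<open>A normalised eigenvector, multiplied by a phase that makes its \<open>a\<close>-th coordinate real.\<close>

lemma eigen_column:
  assumes H: "H \<in> rect k k" and a: "a < k"
  shows "\<exists>v \<mu> \<alpha>. v \<in> rect k k \<and> adj v * v = eu a a \<and> v * eu a a = v
    \<and> eu a a * v = \<alpha> *\<^sub>R eu a a \<and> H * v = cs \<mu> v"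
proof -
  have M: "tomat k H \<in> carrier_mat k k" by simp
  then have "spectrum (tomat k H) \<noteq> {}" using spectrum_non_empty a by blast
  then obtain \<mu> u where ev: "eigenvector (tomat k H) u \<mu>"
    by (auto simp: spectrum_def eigenvalue_def)
  then have uk: "u \<in> carrier_vec k" and u0: "u \<noteq> 0\<^sub>v k" and eq: "tomat k H *\<^sub>v u = \<mu> \<cdot>\<^sub>v u"
    by (auto simp: eigenvector_def tomat_def)
  define N where "N = (\<Sum>i<k. (cmod (u $ i))\<^sup>2)"
  have "\<exists>i<k. u $ i \<noteq> 0" using u0 uk by (metis eq_vecI carrier_vecD index_zero_vec)
  then have N: "N > 0" unfolding N_def by (auto intro!: sum_pos2)
  define ph where "ph = (if u $ a = 0 then 1 else cnj (u $ a) / cmod (u $ a))"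
  have ph1: "cmod ph = 1" by (simp add: ph_def norm_divide)
  define c where "c = ph / sqrt N"
  have cn: "(cmod c)\<^sup>2 = 1 / N" using N by (simp add: c_def norm_divide ph1 power_divide)
  define \<alpha> where "\<alpha> = cmod (u $ a) / sqrt N"
  have ca: "c * u $ a = of_real \<alpha>"
    by (auto simp: c_def ph_def \<alpha>_def complex_norm_square[symmetric] power2_eq_square mult.commute)
  define v where "v = emb (mat k k (\<lambda>(i, j). if j = a then c * u $ i else 0))"
  have vk: "v \<in> rect k k" unfolding v_def by (rule emb_rect) simp
  have ve: "ent v i j = (if i < k \<and> j = a then c * u $ i else 0)" for i j using a by (auto simp: v_def)
  have 1: "adj v * v = eu a a"
  proof (rule fmat_eqI)
    fix i j
    have "ent (adj v * v) i j = (\<Sum>m<k. cnj (ent v m i) * ent v m j)"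
      using ent_times'[OF vk, of "adj v"] by simp
    also have "\<dots> = (if i = a \<and> j = a then (\<Sum>m<k. of_real ((cmod c)\<^sup>2 * (cmod (u $ m))\<^sup>2)) else 0)"
      by (auto simp: ve complex_norm_square mult_ac intro!: sum.cong simp del: of_real_power)
    also have "\<dots> = ent (eu a a) i j"
      using N by (simp add: cn flip: of_real_sum sum_distrib_left sum_divide_distrib) (simp add: N_def)
    finally show "ent (adj v * v) i j = ent (eu a a) i j" .
  qed
  have 2: "v * eu a a = v" by (rule fmat_eqI) (simp add: ent_times_eu ve)
  have 3: "eu a a * v = \<alpha> *\<^sub>R eu a a"
    using a by (intro fmat_eqI) (simp add: ent_eu_times ve ca)
  have 4: "H * v = cs \<mu> v"
  proof (rule fmat_eqI)
    fix i j
    have "ent (H * v) i j = (if j = a then c * (\<Sum>m<k. ent H i m * u $ m) else 0)"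
      by (auto simp: ent_times[OF H] ve sum_distrib_left intro!: sum.cong)
    also have "\<dots> = ent (cs \<mu> v) i j"
    proof (cases "i < k")
      case True
      then have "(\<Sum>m<k. ent H i m * u $ m) = (tomat k H *\<^sub>v u) $ i"
        using uk by (auto simp: tomat_def scalar_prod_def atLeast0LessThan intro!: sum.cong)
      also have "\<dots> = \<mu> * u $ i" using True uk by (simp add: eq)
      finally show ?thesis using True by (simp add: ve)
    next
      case False
      then show ?thesis using rectD[OF H] by (simp add: ve)
    qed
    finally show "ent (H * v) i j = ent (cs \<mu> v) i j" .
  qed
  show ?thesis using vk 1 2 3 4 by blast
qed

text \<open>An eigenvector is rotated to the last basis vector. What remains of the Hermitian matrix then
  lies in the corner of size one less, and induction applies to it.\<close>

theorem hermitian_diagonalisation: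
  assumes "H \<in> rect k k" "adj H = H"
  shows "\<exists>U d. unitary_in k U \<and> H = U * diagm k (\<lambda>i. of_real (d i)) * adj U"
  using assms
proof (induction k arbitrary: H)
  case 0
  then have "H = 0" by (intro fmat_eqI) (auto simp: rect_def)
  moreover have "unitary_in 0 0" by (auto simp: unitary_in_def intro!: fmat_eqI)
  ultimately show ?case by (intro exI[of _ 0]) auto
next
  case (Suc a)
  define e where "e = eu a a"
  obtain v \<mu> \<alpha> where v: "v \<in> rect (Suc a) (Suc a)" "adj v * v = e" "v * e = v"
      "e * v = \<alpha> *\<^sub>R e" "H * v = cs \<mu> v"
    using eigen_column[OF Suc.prems(1), of a] unfolding e_def by blast
  obtain U0 where U0: "unitary_in (Suc a) U0" and U0e: "U0 * e = v"
    using unit_vector_rotation[OF v(1-4) e_def] by auto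
  have U0k: "U0 \<in> rect (Suc a) (Suc a)" and U0': "adj U0 * U0 = idm (Suc a)" "U0 * adj U0 = idm (Suc a)"
    using U0 by (auto simp: unitary_in_def)
  have ek: "e \<in> rect (Suc a) (Suc a)" by (simp add: e_def rect_eu)
  define M where "M = adj U0 * H * U0"
  have Mk: "M \<in> rect (Suc a) (Suc a)"
    unfolding M_def by (rule rect_times[OF rect_times[OF rect_adj[OF U0k] Suc.prems(1)] U0k])
  have aM: "adj M = M" by (simp add: M_def adj_mult Suc.prems mult.assoc)
  have "M * e = adj U0 * (H * v)" by (simp add: M_def mult.assoc U0e)
  also have "\<dots> = cs \<mu> (adj U0 * U0 * e)" by (simp add: v(5) cs_mult_right mult.assoc U0e)
  also have "\<dots> = cs \<mu> e" by (simp add: U0' idm_mult[OF ek])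
  finally have Me: "M * e = cs \<mu> e" .
  have M1: "ent M i a = (if i = a then \<mu> else 0)" for i
    using arg_cong[OF Me, of "\<lambda>X. ent X i a"] by (simp add: e_def ent_times_eu)
  have M2: "ent M a i = cnj (ent M i a)" for i using arg_cong[OF aM, of "\<lambda>X. ent X a i"] by simp
  have \<mu>: "cnj \<mu> = \<mu>" using M2[of a] by (simp add: M1)
  define H' where "H' = M - cs \<mu> e"
  have H'k: "H' \<in> rect a a"
  proof (rule rectI)
    fix i j assume "a \<le> i \<or> a \<le> j"
    then consider "i = a" | "j = a" | "Suc a \<le> i \<or> Suc a \<le> j" by linarith
    then show "ent H' i j = 0"
      by cases (use rectD[OF Mk] in \<open>auto simp: H'_def e_def M1 M2 \<mu>\<close>)
  qed
  have "adj H' = H'" by (simp add: H'_def adj_diff aM adj_cs \<mu> e_def)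
  with Suc.IH[OF H'k] obtain U' d' where U': "unitary_in a U'"
    and H': "H' = U' * diagm a (\<lambda>i. of_real (d' i)) * adj U'" by blast
  then have U'k: "U' \<in> rect a a" and U'': "adj U' * U' = idm a" "U' * adj U' = idm a"
    by (auto simp: unitary_in_def)
  have z: "A * e = 0" "e * A = 0" if "A \<in> rect a a" for A
    using rectD[OF that] by (auto intro!: fmat_eqI simp: e_def ent_times_eu ent_eu_times)
  have ee: "e * e = e" "adj e = e" by (simp_all add: e_def eu_mult)
  have ie: "e + idm a = idm (Suc a)" by (rule fmat_eqI) (auto simp: e_def)
  define V where "V = U' + e"
  have V: "unitary_in (Suc a) V"
    using z[OF U'k] z[OF rect_adj[OF U'k]] rect_mono[OF U'k, of "Suc a" "Suc a"] ek
    by (auto simp: unitary_in_def V_def adj_add algebra_simps U'' ee ie intro!: rect_add)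
  define D where "D = diagm a (\<lambda>i. of_real (d' i))"
  have Dk: "D \<in> rect a a" by (simp add: D_def)
  have "V * (D + cs \<mu> e) * adj V = U' * D * adj U' + cs \<mu> e"
    using z[OF U'k] z[OF rect_adj[OF U'k]] z[OF Dk]
    by (simp add: V_def adj_add algebra_simps ee cs_mult_left cs_mult_right)
  also have "\<dots> = M" by (simp add: H'[symmetric, folded D_def] H'_def)
  finally have MV: "V * (D + cs \<mu> e) * adj V = M" .
  have DD: "D + cs \<mu> e = diagm (Suc a) (\<lambda>i. of_real ((d'(a := Re \<mu>)) i))"
    using \<mu> by (intro fmat_eqI) (auto simp: D_def e_def complex_eq_iff)
  have "U0 * M * adj U0 = (U0 * adj U0) * H * (U0 * adj U0)" by (simp add: M_def mult.assoc)
  also have "\<dots> = H" by (simp add: U0' idm_mult[OF Suc.prems(1)] mult_idm[OF Suc.prems(1)])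
  finally have "H = U0 * (V * diagm (Suc a) (\<lambda>i. of_real ((d'(a := Re \<mu>)) i)) * adj V) * adj U0"
    by (simp only: MV[unfolded DD])
  then have "H = (U0 * V) * diagm (Suc a) (\<lambda>i. of_real ((d'(a := Re \<mu>)) i)) * adj (U0 * V)"
    by (simp only: adj_mult mult.assoc)
  with unitary_in_mult[OF U0 V] show ?case by blast
qed

section \<open>Separated sets in finite-dimensional normed spaces\<close>

definition separated :: "('a \<Rightarrow> 'a \<Rightarrow> real) \<Rightarrow> real \<Rightarrow> 'a set \<Rightarrow> bool" where
  "separated d s T \<longleftrightarrow> (\<forall>a\<in>T. \<forall>b\<in>T. a \<noteq> b \<longrightarrow> s \<le> d a b)"

abbreviation nsep :: "real \<Rightarrow> 'v::real_normed_vector set \<Rightarrow> bool" where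
  "nsep \<equiv> separated (\<lambda>a b. norm (a - b))"

lemma separatedD: "separated d s T \<Longrightarrow> a \<in> T \<Longrightarrow> b \<in> T \<Longrightarrow> a \<noteq> b \<Longrightarrow> s \<le> d a b"
  by (auto simp: separated_def)

text \<open>A separated set of maximal cardinality is a net: a point far from it could be added.\<close>

lemma maximal_separated_set:
  assumes bound: "\<And>T. finite T \<Longrightarrow> T \<subseteq> X \<Longrightarrow> separated d s T \<Longrightarrow> card T \<le> n"
    and sym: "\<And>x y. x \<in> X \<Longrightarrow> y \<in> X \<Longrightarrow> d x y = d y x"
    and refl: "\<And>x. x \<in> X \<Longrightarrow> d x x < s"
  shows "\<exists>T. finite T \<and> T \<subseteq> X \<and> separated d s T \<and> (\<forall>x\<in>X. \<exists>t\<in>T. d x t < s)"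
proof -
  let ?P = "\<lambda>T. finite T \<and> T \<subseteq> X \<and> separated d s T"
  have P0: "?P {}" by (simp add: separated_def)
  moreover have "\<forall>T. ?P T \<longrightarrow> card T < Suc n" using bound by (simp add: less_Suc_eq_le)
  ultimately obtain T where T: "?P T" and max: "\<And>S. ?P S \<Longrightarrow> card S \<le> card T"
    using ex_has_greatest_nat[of ?P "{}" card "Suc n"] by blast
  have "\<exists>t\<in>T. d x t < s" if x: "x \<in> X" for x
  proof (rule ccontr)
    assume n: "\<not> (\<exists>t\<in>T. d x t < s)"
    then have xT: "x \<notin> T" using refl[OF x] by blast
    have "separated d s (insert x T)"
      unfolding separated_def
    proof (intro ballI impI)
      fix a b assume ab: "a \<in> insert x T" "b \<in> insert x T" "a \<noteq> b"
      have far: "s \<le> d x t" "s \<le> d t x" if "t \<in> T" for t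
        using n that T sym[OF x, of t] by (auto simp: not_less subset_iff)
      show "s \<le> d a b" using ab far separatedD[of d s T a b] T by blast
    qed
    with T x have "?P (insert x T)" by blast
    from max[OF this] T xT show False by simp
  qed
  with T show ?thesis by blast
qed

text \<open>A constant factor \<open>D\<close> disappears in roots of high order; the exponents may be sparse, such as \<open>2 ^ n\<close>.\<close>

lemma le_if_powers_le:
  fixes a b :: real
  assumes le: "\<And>n. a ^ f n \<le> D * b ^ f n" and f: "\<And>n::nat. n \<le> f n" and b: "0 < b"
  shows "a \<le> b"
proof (rule ccontr)
  assume "\<not> a \<le> b"
  then have q: "1 < a / b" using b by simp
  obtain n where n: "D < (a / b) ^ n" using real_arch_pow[OF q] by blast
  also have "\<dots> \<le> (a / b) ^ f n" by (rule power_increasing[OF f]) (use q in simp)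
  also have "\<dots> \<le> D" using le[of n] b by (simp add: power_divide pos_divide_le_eq)
  finally show False by simp
qed

text \<open>A space of dimension \<open>card I\<close>, presented by linear coordinates that are comparable with the norm.
  The constants \<open>L\<close> and \<open>B\<close> may be arbitrarily large: they cancel in the two theorems below.\<close>

locale real_coordinates =
  fixes I :: "'i set" and \<Phi> :: "('i \<Rightarrow> real) \<Rightarrow> 'v::real_normed_vector" and L B :: real
  assumes fin: "finite I"
    and \<Phi>_diff: "\<Phi> (\<lambda>i. c i - d i) = \<Phi> c - \<Phi> d"
    and \<Phi>_scale: "\<Phi> (\<lambda>i. r * c i) = r *\<^sub>R \<Phi> c"
    and coord_le: "i \<in> I \<Longrightarrow> \<bar>c i\<bar> \<le> L * norm (\<Phi> c)"
    and norm_\<Phi>_le: "(\<And>i. i \<in> I \<Longrightarrow> \<bar>c i\<bar> \<le> h) \<Longrightarrow> 0 \<le> h \<Longrightarrow> norm (\<Phi> c) \<le> B * h"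
    and L_pos: "0 < L" and B_pos: "0 < B"
begin

lemma range_scale: "x \<in> range \<Phi> \<Longrightarrow> r *\<^sub>R x \<in> range \<Phi>"
  by (auto simp flip: \<Phi>_scale)
lemma range_diff: "x \<in> range \<Phi> \<Longrightarrow> y \<in> range \<Phi> \<Longrightarrow> x - y \<in> range \<Phi>"
  by (auto simp flip: \<Phi>_diff)
lemma range_add: "x \<in> range \<Phi> \<Longrightarrow> y \<in> range \<Phi> \<Longrightarrow> x + y \<in> range \<Phi>"
  using range_diff[of x "(-1) *\<^sub>R y"] range_scale[of y "-1"] by simp
lemma range_zero: "0 \<in> range \<Phi>"
  using range_scale[of "\<Phi> (\<lambda>_. 0)" 0] by simp

text \<open>The coordinates of points that are \<open>\<sigma>\<close> apart lie in different cells of a grid of mesh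
  proportional to \<open>\<sigma>\<close>. The constant is not good enough for large dimensions.\<close>

lemma separated_card_crude:
  assumes T: "finite T" "T \<subseteq> range \<Phi>" "\<And>x. x \<in> T \<Longrightarrow> norm x \<le> \<rho>" "nsep \<sigma> T"
    and \<sigma>: "0 < \<sigma>" "\<sigma> \<le> \<rho>"
  shows "real (card T) \<le> ((4 * L * B + 3) * \<rho> / \<sigma>) ^ card I"
proof -
  define h where "h = \<sigma> / (2 * B)"
  have h: "0 < h" using \<sigma> B_pos by (simp add: h_def)
  define M where "M = \<lceil>L * \<rho> / h\<rceil>"
  have M: "0 \<le> M" unfolding M_def using \<sigma> L_pos h by (simp add: le_ceiling_iff)
      (smt (verit) divide_nonneg_pos mult_nonneg_nonneg)
  define c where "c x = (SOME c. \<Phi> c = x)" for x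
  have c: "\<Phi> (c x) = x" if "x \<in> T" for x
  proof -
    have "\<exists>c. \<Phi> c = x" using that T(2) by auto
    then show ?thesis unfolding c_def by (rule someI_ex)
  qed
  define g where "g x = restrict (\<lambda>i. \<lfloor>c x i / h\<rfloor>) I" for x
  have "inj_on g T"
  proof (rule inj_onI, rule ccontr)
    fix x y assume x: "x \<in> T" and y: "y \<in> T" and g: "g x = g y" and ne: "x \<noteq> y"
    have "\<bar>c x i - c y i\<bar> \<le> h" if "i \<in> I" for i
    proof -
      have "\<lfloor>c x i / h\<rfloor> = \<lfloor>c y i / h\<rfloor>" using g that by (metis g_def restrict_apply')
      then have "\<bar>c x i / h - c y i / h\<bar> < 1" by linarith
      then show ?thesis using h by (simp add: abs_less_iff field_simps) linarith
    qed
    then have "norm (\<Phi> (\<lambda>i. c x i - c y i)) \<le> B * h" by (rule norm_\<Phi>_le) (use h in auto)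
    also have "\<dots> < \<sigma>" using \<sigma> B_pos by (simp add: h_def)
    finally show False using separatedD[OF T(4) x y ne] by (simp add: \<Phi>_diff c x y)
  qed
  moreover have "g ` T \<subseteq> PiE I (\<lambda>_. {-M..M})"
  proof (rule image_subsetI)
    fix x assume x: "x \<in> T"
    have "\<lfloor>c x i / h\<rfloor> \<in> {-M..M}" if "i \<in> I" for i
    proof -
      have "\<bar>c x i\<bar> \<le> L * norm x" using coord_le[OF that, of "c x"] by (simp add: c x)
      also have "\<dots> \<le> L * \<rho>" using T(3)[OF x] L_pos by simp
      finally have "\<bar>c x i\<bar> / h \<le> L * \<rho> / h" using h by (simp add: divide_right_mono)
      moreover have "\<bar>c x i / h\<bar> = \<bar>c x i\<bar> / h" using h by simp
      ultimately show ?thesis unfolding M_def atLeastAtMost_iff by linarith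
    qed
    then show "g x \<in> PiE I (\<lambda>_. {-M..M})" by (auto simp: g_def)
  qed
  ultimately have "card T \<le> card (PiE I (\<lambda>_. {-M..M}))"
    using fin by (intro card_inj_on_le[of g]) (auto intro!: finite_PiE)
  also have "\<dots> = nat (2 * M + 1) ^ card I"
    using fin by (simp add: card_PiE)
  finally have "real (card T) \<le> real (nat (2 * M + 1)) ^ card I"
    by (metis of_nat_le_iff of_nat_power)
  also have "\<dots> \<le> ((4 * L * B + 3) * \<rho> / \<sigma>) ^ card I"
  proof (rule power_mono)
    have "real (nat (2 * M + 1)) = 2 * of_int M + 1" using M by simp
    also have "\<dots> \<le> 2 * (L * \<rho> / h) + 3" unfolding M_def by linarith
    also have "\<dots> \<le> (4 * L * B + 3) * \<rho> / \<sigma>"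
      using \<sigma> B_pos by (simp add: h_def field_simps)
    finally show "real (nat (2 * M + 1)) \<le> (4 * L * B + 3) * \<rho> / \<sigma>" .
  qed simp
  finally show ?thesis .
qed

text \<open>With \<open>l = s / (8 \<rho>)\<close>, the sums of \<open>j\<close> terms of \<open>T\<close> with weights \<open>1, l, l\<^sup>2, \<dots>\<close> are pairwise distinct,
  stay in the ball of radius \<open>2 \<rho>\<close> and are separated by a multiple of \<open>l ^ j\<close>: the first terms that
  differ dominate all later ones. The crude bound for these \<open>card T ^ j\<close> points gives the claim when
  \<open>j\<close> tends to infinity.\<close>

theorem separated_card_le:
  assumes T: "finite T" "T \<subseteq> range \<Phi>" "\<And>x. x \<in> T \<Longrightarrow> norm x \<le> \<rho>" "nsep s T"
    and s: "0 < s" "s \<le> \<rho>"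
  shows "real (card T) \<le> (8 * \<rho> / s) ^ card I"
proof -
  define l where "l = s / (8 * \<rho>)"
  have l: "0 < l" "l \<le> 1" "4 * \<rho> * l = s / 2" "l \<le> 1 / 2" using s by (auto simp: l_def field_simps)
  have S: "\<exists>S. finite S \<and> card S = card T ^ j \<and> S \<subseteq> range \<Phi> \<and> (\<forall>x\<in>S. norm x \<le> 2 * \<rho>) \<and> nsep (l ^ j * s / 2) S" for j
  proof (induction j)
    case 0
    show ?case using s range_zero by (intro exI[of _ "{0}"]) (simp add: separated_def)
  next
    case (Suc j)
    then obtain S where S: "finite S" "card S = card T ^ j" "S \<subseteq> range \<Phi>" "\<And>x. x \<in> S \<Longrightarrow> norm x \<le> 2 * \<rho>"
        "nsep (l ^ j * s / 2) S" by blast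
    define g where "g = (\<lambda>(t::'v, u). t + l *\<^sub>R u)"
    have gap: "l ^ Suc j * s / 2 \<le> norm (g p - g p')" if p: "p \<in> T \<times> S" "p' \<in> T \<times> S" and ne: "p \<noteq> p'" for p p'
    proof -
      obtain t u t' u' where eq: "p = (t, u)" "p' = (t', u')" by fastforce
      have d: "g p - g p' = (t - t') + l *\<^sub>R (u - u')" by (simp add: g_def eq algebra_simps)
      show ?thesis
      proof (cases "t = t'")
        case True
        then have "l ^ j * s / 2 \<le> norm (u - u')" using separatedD[OF S(5)] p ne eq by auto
        then have "l * (l ^ j * s / 2) \<le> l * norm (u - u')" using l by (intro mult_left_mono) auto
        then show ?thesis using l True by (simp add: d)
      next
        case False
        then have "s \<le> norm (t - t')" using separatedD[OF T(4)] p eq by auto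
        moreover have "norm (u - u') \<le> 4 * \<rho>"
          using norm_triangle_ineq4[of u u'] S(4)[of u] S(4)[of u'] p eq by auto
        then have "l * norm (u - u') \<le> s / 2" using l by (metis mult.commute mult_left_mono less_imp_le)
        moreover have "norm (t - t') - l * norm (u - u') \<le> norm (g p - g p')"
          unfolding d using norm_diff_ineq[of "t - t'" "l *\<^sub>R (u - u')"] l by simp
        moreover have "l ^ Suc j * s / 2 \<le> s / 2"
          using l s power_le_one[of l "Suc j"] by (simp add: mult_left_le_one_le)
        ultimately show ?thesis by linarith
      qed
    qed
    have pos: "0 < l ^ Suc j * s / 2" using l s by simp
    have inj: "inj_on g (T \<times> S)"
      by (rule inj_onI) (use gap pos in fastforce)
    have "card (g ` (T \<times> S)) = card T ^ Suc j"
      by (simp add: card_image[OF inj] card_cartesian_product S)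
    moreover have "g ` (T \<times> S) \<subseteq> range \<Phi>"
      using T(2) S(3) by (auto simp: g_def intro!: range_add range_scale)
    moreover have "norm x \<le> 2 * \<rho>" if "x \<in> g ` (T \<times> S)" for x
    proof -
      from that obtain t u where tu: "t \<in> T" "u \<in> S" "x = t + l *\<^sub>R u" by (auto simp: g_def)
      have "norm x \<le> norm t + l * norm u" using norm_triangle_ineq[of t "l *\<^sub>R u"] l by (simp add: tu)
      also have "\<dots> \<le> \<rho> + (1 / 2) * (2 * \<rho>)"
        using T(3)[OF tu(1)] S(4)[OF tu(2)] l by (intro add_mono mult_mono) auto
      finally show ?thesis by simp
    qed
    moreover have "nsep (l ^ Suc j * s / 2) (g ` (T \<times> S))"
      using gap by (force simp: separated_def)
    ultimately show ?case using T(1) S(1) by (intro exI[of _ "g ` (T \<times> S)"]) auto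
  qed
  define C where "C = (4 * L * B + 3) * (2 * \<rho>)"
  have C: "0 \<le> C" unfolding C_def using L_pos B_pos s by simp
  have "real (card T) ^ j \<le> (2 * C / s) ^ card I * ((8 * \<rho> / s) ^ card I) ^ j" for j
  proof -
    obtain S where S: "finite S" "card S = card T ^ j" "S \<subseteq> range \<Phi>" "\<And>x. x \<in> S \<Longrightarrow> norm x \<le> 2 * \<rho>"
        "nsep (l ^ j * s / 2) S" using S[of j] by blast
    have "l ^ j * s / 2 \<le> s / 2" using l s power_le_one[of l j] by (simp add: mult_left_le_one_le)
    then have "real (card S) \<le> (C / (l ^ j * s / 2)) ^ card I"
      unfolding C_def using l s by (intro separated_card_crude S) (assumption, simp, linarith)
    also have "C / (l ^ j * s / 2) = (2 * C / s) * (8 * \<rho> / s) ^ j"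
      using l s by (simp add: l_def power_divide field_simps)
    also have "((2 * C / s) * (8 * \<rho> / s) ^ j) ^ card I = (2 * C / s) ^ card I * ((8 * \<rho> / s) ^ card I) ^ j"
      by (simp only: power_mult_distrib power_mult[symmetric] mult.commute[of j])
    finally show ?thesis by (simp only: S of_nat_power)
  qed
  then show ?thesis by (rule le_if_powers_le[where f = "\<lambda>n. n"]) (use s in auto)
qed

text \<open>Dually, a maximal separated set \<open>T\<close> is an \<open>s\<close>-net, and approximating a point, then the rescaled
  error, then the next error, shows that \<open>card T ^ j\<close> balls of radius \<open>(s / \<rho>) ^ j * \<rho>\<close> cover the ball
  of radius \<open>\<rho>\<close>. A grid of sufficiently separated points in this ball bounds their number from
  below, up to a constant that disappears when \<open>j\<close> tends to infinity.\<close>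

theorem separated_set_exists:
  assumes s: "0 < s" "s \<le> \<rho>"
  shows "\<exists>T. finite T \<and> T \<subseteq> range \<Phi> \<and> (\<forall>x\<in>T. norm x \<le> \<rho>) \<and> nsep s T \<and> (\<rho> / s) ^ card I \<le> real (card T)"
proof -
  define X where "X = {x \<in> range \<Phi>. norm x \<le> \<rho>}"
  have "\<exists>T. finite T \<and> T \<subseteq> X \<and> nsep s T \<and> (\<forall>x\<in>X. \<exists>t\<in>T. norm (x - t) < s)"
  proof (rule maximal_separated_set)
    fix T assume "finite T" "T \<subseteq> X" "nsep s T"
    then have "real (card T) \<le> (8 * \<rho> / s) ^ card I"
      by (intro separated_card_le s) (auto simp: X_def)
    then show "card T \<le> nat \<lfloor>(8 * \<rho> / s) ^ card I\<rfloor>" by (simp add: le_nat_floor)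
  qed (use s in \<open>auto simp: norm_minus_commute\<close>)
  then obtain T where T: "finite T" "T \<subseteq> X" "nsep s T" and cov: "\<And>x. x \<in> X \<Longrightarrow> \<exists>t\<in>T. norm (x - t) < s"
    by blast
  define q where "q = s / \<rho>"
  have q: "0 < q" "q * \<rho> = s" using s by (auto simp: q_def)
  have S: "\<exists>S. finite S \<and> card S \<le> card T ^ j \<and> (\<forall>x\<in>X. \<exists>u\<in>S. norm (x - u) \<le> q ^ j * \<rho>)" for j
  proof (induction j)
    case 0
    show ?case by (intro exI[of _ "{0}"]) (auto simp: X_def)
  next
    case (Suc j)
    then obtain S where S: "finite S" "card S \<le> card T ^ j" "\<And>x. x \<in> X \<Longrightarrow> \<exists>u\<in>S. norm (x - u) \<le> q ^ j * \<rho>"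
      by blast
    define g where "g = (\<lambda>(t::'v, u). t + q *\<^sub>R u)"
    have "card (g ` (T \<times> S)) \<le> card (T \<times> S)" using T S by (intro card_image_le) auto
    also have "\<dots> \<le> card T ^ Suc j" using S(2) by (simp add: card_cartesian_product)
    finally have card: "card (g ` (T \<times> S)) \<le> card T ^ Suc j" .
    have "\<exists>u\<in>g ` (T \<times> S). norm (x - u) \<le> q ^ Suc j * \<rho>" if x: "x \<in> X" for x
    proof -
      obtain t where t: "t \<in> T" "norm (x - t) < s" using cov[OF x] by blast
      define x' where "x' = (1 / q) *\<^sub>R (x - t)"
      have "norm x' = norm (x - t) / q" using q by (simp add: x'_def)
      then have "norm x' \<le> \<rho>" using t q by (simp add: pos_divide_le_eq mult.commute)
      moreover have "x' \<in> range \<Phi>"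
        unfolding x'_def using x t T by (intro range_scale range_diff) (auto simp: X_def)
      ultimately have "x' \<in> X" by (simp add: X_def)
      then obtain u where u: "u \<in> S" "norm (x' - u) \<le> q ^ j * \<rho>" using S(3) by blast
      have "x - (t + q *\<^sub>R u) = q *\<^sub>R (x' - u)" using q by (simp add: x'_def algebra_simps)
      then have "norm (x - (t + q *\<^sub>R u)) \<le> q ^ Suc j * \<rho>" using u q by simp
      then show ?thesis using t u by (force simp: g_def)
    qed
    with card T S show ?case by (intro exI[of _ "g ` (T \<times> S)"]) auto
  qed
  have T0: "0 < card T"
  proof -
    have "0 \<in> X" using s range_zero by (simp add: X_def)
    then show ?thesis using cov[of 0] T by (auto simp: card_gt_0_iff)
  qed
  have "((\<rho> / s) ^ card I) ^ j \<le> (3 * L * B) ^ card I * real (card T) ^ j" for j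
  proof -
    obtain S where S: "finite S" "card S \<le> card T ^ j" "\<And>x. x \<in> X \<Longrightarrow> \<exists>u\<in>S. norm (x - u) \<le> q ^ j * \<rho>"
      using S[of j] by blast
    define h where "h = 3 * L * q ^ j * \<rho>"
    have h: "0 < h" using L_pos q s by (simp add: h_def)
    define M where "M = nat \<lfloor>\<rho> / (h * B)\<rfloor>"
    have "0 \<le> \<rho> / (h * B)" using h B_pos s by simp
    then have M: "real M \<le> \<rho> / (h * B)" "\<rho> / (h * B) \<le> real M + 1" unfolding M_def by linarith+
    define G where "G = PiE I (\<lambda>_. {0..M})"
    define p where "p n = \<Phi> (\<lambda>i. h * real (n i))" for n
    have pX: "p n \<in> X" if "n \<in> G" for n
    proof -
      have "norm (p n) \<le> B * (h * real M)"
        unfolding p_def by (rule norm_\<Phi>_le) (use that h in \<open>auto simp: G_def PiE_iff\<close>)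
      also have "\<dots> \<le> \<rho>" using M h B_pos by (simp add: field_simps)
      finally show ?thesis by (simp add: X_def p_def)
    qed
    define f where "f n = (SOME u. u \<in> S \<and> norm (p n - u) \<le> q ^ j * \<rho>)" for n
    have f: "f n \<in> S" "norm (p n - f n) \<le> q ^ j * \<rho>" if "n \<in> G" for n
    proof -
      have "\<exists>u. u \<in> S \<and> norm (p n - u) \<le> q ^ j * \<rho>" using S(3)[OF pX[OF that]] by blast
      from someI_ex[OF this] show "f n \<in> S" "norm (p n - f n) \<le> q ^ j * \<rho>" by (auto simp: f_def)
    qed
    have "inj_on f G"
    proof (rule inj_onI, rule ccontr)
      fix n n' assume n: "n \<in> G" "n' \<in> G" "f n = f n'" "n \<noteq> n'"
      then obtain i where i: "i \<in> I" "n i \<noteq> n' i" unfolding G_def by (meson PiE_ext)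
      have "h \<le> h * \<bar>real (n i) - real (n' i)\<bar>" using h i by simp
      also have "\<dots> = \<bar>h * real (n i) - h * real (n' i)\<bar>" using h by (simp add: abs_mult flip: right_diff_distrib)
      also have "\<dots> \<le> L * norm (p n - p n')"
        unfolding p_def \<Phi>_diff[symmetric] by (rule coord_le[OF i(1)])
      also have "\<dots> \<le> L * (2 * (q ^ j * \<rho>))"
      proof -
        have "norm (p n - p n') \<le> norm (p n - f n) + norm (p n' - f n')"
          using norm_triangle_ineq4[of "p n - f n" "p n' - f n'"] n by simp
        then show ?thesis using f[OF n(1)] f[OF n(2)] L_pos by (intro mult_left_mono) auto
      qed
      finally show False using L_pos q s by (simp add: h_def)
    qed
    then have "card G \<le> card S" using S f by (intro card_inj_on_le[of f]) auto
    then have "card G \<le> card T ^ j" using S by linarith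
    moreover have "card G = (M + 1) ^ card I" unfolding G_def using fin by (simp add: card_PiE)
    ultimately have "real ((M + 1) ^ card I) \<le> real (card T ^ j)" by linarith
    then have "(real M + 1) ^ card I \<le> real (card T) ^ j"
      by (simp only: of_nat_power of_nat_add of_nat_1)
    moreover have "(\<rho> / (h * B)) ^ card I \<le> (real M + 1) ^ card I"
      using M h B_pos s by (intro power_mono) auto
    moreover have "(\<rho> / s) ^ j = (3 * L * B) * (\<rho> / (h * B))"
    proof -
      have "(3 * L * B) * (\<rho> / (h * B)) = 1 / q ^ j"
        using L_pos B_pos s q by (simp add: h_def)
      then show ?thesis by (simp add: q_def power_divide)
    qed
    then have "((\<rho> / s) ^ card I) ^ j = (3 * L * B) ^ card I * (\<rho> / (h * B)) ^ card I"
      by (metis mult.commute power_mult power_mult_distrib)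
    ultimately show ?thesis using L_pos B_pos by (simp add: mult_left_mono)
  qed
  then have "(\<rho> / s) ^ card I \<le> real (card T)"
    by (rule le_if_powers_le[where f = "\<lambda>n. n"]) (use T0 in auto)
  then show ?thesis using T by (auto simp: X_def)
qed

end

section \<open>Separated families of near-isometries and of unitaries\<close>

text \<open>The upper triangle and the diagonal of \<open>c\<close> are the real parts, the strict lower triangle contains
  the imaginary parts. It is essential that there are \<open>k\<^sup>2\<close> real coordinates, and not \<open>2 k\<^sup>2\<close> as for
  arbitrary matrices.\<close>

definition herm_of_coords :: "nat \<Rightarrow> (nat \<times> nat \<Rightarrow> real) \<Rightarrow> fmat" where
  "herm_of_coords k c = emb (mat k k (\<lambda>(i, j).
     if i = j then of_real (c (i, i))
     else if i < j then Complex (c (i, j)) (c (j, i)) else Complex (c (j, i)) (- c (i, j))))"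

definition mat_of_coords :: "nat \<Rightarrow> (nat \<times> nat \<times> bool \<Rightarrow> real) \<Rightarrow> fmat" where
  "mat_of_coords k c = emb (mat k k (\<lambda>(i, j). Complex (c (i, j, True)) (c (i, j, False))))"

lemma ent_herm_of_coords: "ent (herm_of_coords k c) i j = (if i < k \<and> j < k then
     (if i = j then of_real (c (i, i))
      else if i < j then Complex (c (i, j)) (c (j, i)) else Complex (c (j, i)) (- c (i, j))) else 0)"
  by (simp add: herm_of_coords_def)

lemma ent_mat_of_coords: "ent (mat_of_coords k c) i j =
    (if i < k \<and> j < k then Complex (c (i, j, True)) (c (i, j, False)) else 0)"
  by (simp add: mat_of_coords_def)

lemma cmod_Complex_le: "\<bar>a\<bar> \<le> h \<Longrightarrow> \<bar>b\<bar> \<le> h \<Longrightarrow> cmod (Complex a b) \<le> 2 * h"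
  using cmod_le[of "Complex a b"] by simp

lemma norm_le_of_entries:
  assumes "A \<in> rect k k" "\<And>i j. i < k \<Longrightarrow> j < k \<Longrightarrow> cmod (ent A i j) \<le> 2 * h" "0 \<le> h"
  shows "norm A \<le> (2 * (real k)\<^sup>2 + 1) * h"
proof -
  have "norm A \<le> (\<Sum>i<k. \<Sum>j<k. cmod (ent A i j))" by (rule norm_le_sum[OF assms(1)])
  also have "\<dots> \<le> (\<Sum>i<k. \<Sum>j<k. 2 * h)" by (intro sum_mono assms(2)) auto
  also have "\<dots> \<le> (2 * (real k)\<^sup>2 + 1) * h" using assms(3) by (simp add: power2_eq_square algebra_simps)
  finally show ?thesis .
qed

lemma herm_coordinates:
  "real_coordinates ({..<k} \<times> {..<k}) (herm_of_coords k) 1 (2 * (real k)\<^sup>2 + 1)"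
proof
  fix c :: "nat \<times> nat \<Rightarrow> real" and p assume p: "p \<in> {..<k} \<times> {..<k}"
  then obtain i j where ij: "p = (i, j)" "i < k" "j < k" by auto
  consider "i = j" | "i < j" | "j < i" by linarith
  then have "\<bar>c (i, j)\<bar> \<le> cmod (ent (herm_of_coords k c) i j)"
    by cases (use ij abs_Re_le_cmod[of "Complex (c (i, j)) (c (j, i))"]
        abs_Im_le_cmod[of "Complex (c (j, i)) (- c (i, j))"] in \<open>auto simp: ent_herm_of_coords\<close>)
  with cmod_ent_le[of "herm_of_coords k c" i j] ij show "\<bar>c p\<bar> \<le> 1 * norm (herm_of_coords k c)" by simp
next
  fix c :: "nat \<times> nat \<Rightarrow> real" and h :: real
  assume c: "\<And>p. p \<in> {..<k} \<times> {..<k} \<Longrightarrow> \<bar>c p\<bar> \<le> h" and h: "0 \<le> h"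
  show "norm (herm_of_coords k c) \<le> (2 * (real k)\<^sup>2 + 1) * h"
  proof (rule norm_le_of_entries[OF _ _ h])
    show "herm_of_coords k c \<in> rect k k" by (auto simp: rect_def ent_herm_of_coords)
    fix i j assume ij: "i < k" "j < k"
    then show "cmod (ent (herm_of_coords k c) i j) \<le> 2 * h"
      using c[of "(i, j)"] c[of "(j, i)"] h
      by (auto simp: ent_herm_of_coords intro!: cmod_Complex_le)
  qed
qed (auto intro!: fmat_eqI simp: ent_herm_of_coords complex_eq_iff add_pos_nonneg add_nonneg_pos)

lemma mat_coordinates:
  "real_coordinates ({..<k} \<times> {..<k} \<times> UNIV) (mat_of_coords k) 1 (2 * (real k)\<^sup>2 + 1)"
proof
  fix c :: "nat \<times> nat \<times> bool \<Rightarrow> real" and p assume p: "p \<in> {..<k} \<times> {..<k} \<times> (UNIV::bool set)"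
  then obtain i j b where ij: "p = (i, j, b)" "i < k" "j < k" by auto
  have "\<bar>c (i, j, b)\<bar> \<le> cmod (ent (mat_of_coords k c) i j)"
    using ij abs_Re_le_cmod[of "Complex (c (i, j, True)) (c (i, j, False))"]
        abs_Im_le_cmod[of "Complex (c (i, j, True)) (c (i, j, False))"]
    by (cases b) (auto simp: ent_mat_of_coords)
  with cmod_ent_le[of "mat_of_coords k c" i j] ij show "\<bar>c p\<bar> \<le> 1 * norm (mat_of_coords k c)" by simp
next
  fix c :: "nat \<times> nat \<times> bool \<Rightarrow> real" and h :: real
  assume c: "\<And>p. p \<in> {..<k} \<times> {..<k} \<times> UNIV \<Longrightarrow> \<bar>c p\<bar> \<le> h" and h: "0 \<le> h"
  show "norm (mat_of_coords k c) \<le> (2 * (real k)\<^sup>2 + 1) * h"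
  proof (rule norm_le_of_entries[OF _ _ h])
    show "mat_of_coords k c \<in> rect k k" by (auto simp: rect_def ent_mat_of_coords)
    fix i j assume ij: "i < k" "j < k"
    then show "cmod (ent (mat_of_coords k c) i j) \<le> 2 * h"
      using c[of "(i, j, True)"] c[of "(i, j, False)"]
      by (auto simp: ent_mat_of_coords intro!: cmod_Complex_le)
  qed
qed (auto intro!: fmat_eqI simp: ent_mat_of_coords complex_eq_iff add_pos_nonneg add_nonneg_pos)

lemma range_mat_of_coords: "range (mat_of_coords k) = rect k k"
proof
  show "range (mat_of_coords k) \<subseteq> rect k k" by (auto simp: rect_def ent_mat_of_coords)
  show "rect k k \<subseteq> range (mat_of_coords k)"
  proof
    fix A assume A: "A \<in> rect k k"
    have "A = mat_of_coords k (\<lambda>(i, j, b). if b then Re (ent A i j) else Im (ent A i j))"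
      using rectD[OF A] by (intro fmat_eqI) (auto simp: ent_mat_of_coords)
    then show "A \<in> range (mat_of_coords k)" by blast
  qed
qed

lemma range_herm_of_coords: "range (herm_of_coords k) = {A \<in> rect k k. adj A = A}"
proof
  show "range (herm_of_coords k) \<subseteq> {A \<in> rect k k. adj A = A}"
    by (auto simp: rect_def ent_herm_of_coords complex_eq_iff intro!: fmat_eqI)
  show "{A \<in> rect k k. adj A = A} \<subseteq> range (herm_of_coords k)"
  proof
    fix A assume "A \<in> {A \<in> rect k k. adj A = A}"
    then have A: "A \<in> rect k k" and "adj A = A" by auto
    then have sym: "ent A i j = cnj (ent A j i)" for i j by (metis ent_adj)
    have "A = herm_of_coords k (\<lambda>(i, j). if i \<le> j then Re (ent A i j) else Im (ent A j i))"
    proof (rule fmat_eqI)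
      fix i j
      show "ent A i j = ent (herm_of_coords k (\<lambda>(i, j). if i \<le> j then Re (ent A i j) else Im (ent A j i))) i j"
        using rectD[OF A, of i j] sym[of i j] by (cases "ent A i j"; cases "ent A j i") (auto simp: ent_herm_of_coords complex_eq_iff)
    qed
    then show "A \<in> range (herm_of_coords k)" by blast
  qed
qed

lemma hermitian_separated_card_le:
  assumes "finite T" "\<And>A. A \<in> T \<Longrightarrow> A \<in> rect k k \<and> adj A = A \<and> norm A \<le> \<rho>" "nsep s T" "0 < s" "s \<le> \<rho>"
  shows "real (card T) \<le> (8 * \<rho> / s) ^ (k\<^sup>2)"
  using real_coordinates.separated_card_le[OF herm_coordinates, of T k \<rho> s] assms
  by (auto simp: range_herm_of_coords power2_eq_square subset_iff)

lemma matrix_separated_card_le: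
  assumes "finite T" "\<And>A. A \<in> T \<Longrightarrow> A \<in> rect k k \<and> norm A \<le> \<rho>" "nsep s T" "0 < s" "s \<le> \<rho>"
  shows "real (card T) \<le> (8 * \<rho> / s) ^ (2 * k\<^sup>2)"
  using real_coordinates.separated_card_le[OF mat_coordinates, of T k \<rho> s] assms
  by (auto simp: range_mat_of_coords power2_eq_square subset_iff card_cartesian_product mult_ac)

lemma hermitian_separated_set:
  assumes "0 < s" "s \<le> \<rho>"
  shows "\<exists>T. finite T \<and> (\<forall>A\<in>T. A \<in> rect k k \<and> adj A = A \<and> norm A \<le> \<rho>) \<and> nsep s T
    \<and> (\<rho> / s) ^ (k\<^sup>2) \<le> real (card T)"
  using real_coordinates.separated_set_exists[OF herm_coordinates, of s \<rho> k] assms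
  unfolding range_herm_of_coords by (auto simp: power2_eq_square subset_iff)

lemma norm_mult_le: "norm A \<le> a \<Longrightarrow> norm B \<le> b \<Longrightarrow> norm (A * B) \<le> a * b" for A B :: "'a::real_normed_algebra"
  by (rule order.trans[OF norm_mult_ineq]) (meson mult_mono norm_ge_zero order.trans)

definition near_isometry :: "nat \<Rightarrow> real \<Rightarrow> fmat \<Rightarrow> bool" where
  "near_isometry k \<delta> W \<longleftrightarrow> W \<in> rect k k \<and> norm (adj W * W - idm k) \<le> \<delta> \<and> norm (W * adj W - idm k) \<le> \<delta>"

lemma near_isometry_norm:
  assumes "norm (adj W * W - idm k) \<le> \<delta>" "\<delta> \<le> 1 / 100"
  shows "norm W \<le> 101 / 100"
proof -
  have "(norm W)\<^sup>2 \<le> norm (adj W * W - idm k) + norm (idm k)"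
    unfolding norm_adj_mult_self[symmetric] using norm_triangle_ineq[of "adj W * W - idm k" "idm k"] by simp
  also have "\<dots> \<le> (101 / 100)\<^sup>2" using assms norm_idm_le[of k] by (simp add: power2_eq_square)
  finally show ?thesis by (rule power2_le_imp_le) simp
qed

text \<open>The near-isometries close to \<open>V\<close> form a space of real dimension \<open>k\<^sup>2\<close>, because \<open>X = V\<^sup>* W\<close> is determined
  by its skew-adjoint part: for unitary \<open>X\<close> one has \<open>(X + X\<^sup>*)\<^sup>2 - (X - X\<^sup>*)\<^sup>2 = 4\<close>, and near the unit the
  square root \<open>X + X\<^sup>*\<close> depends on its square in a Lipschitz way. The error term \<open>\<delta>\<close> accounts for \<open>X\<close>
  being unitary only approximately.\<close>

lemma skew_part_separates:
  assumes V: "near_isometry k \<delta> V" and W: "near_isometry k \<delta> W" and W': "near_isometry k \<delta> W'"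
    and \<delta>: "\<delta> \<le> 1 / 100" and near: "norm (W - V) \<le> 1 / 8" "norm (W' - V) \<le> 1 / 8"
  shows "norm (W - W') \<le> norm ((adj V * W - adj W * V) - (adj V * W' - adj W' * V)) + 5 * \<delta>"
    and "norm (adj V * W - adj W * V) \<le> 1"
proof -
  have \<delta>0: "0 \<le> \<delta>" using V norm_ge_zero order.trans unfolding near_isometry_def by blast
  have k: "V \<in> rect k k" "W \<in> rect k k" "W' \<in> rect k k" using V W W' by (auto simp: near_isometry_def)
  have nV: "norm V \<le> 101 / 100" "norm (adj V) \<le> 101 / 100"
    using V near_isometry_norm[OF _ \<delta>] by (auto simp: near_isometry_def)
  have nW: "norm W \<le> 101 / 100" "norm W' \<le> 101 / 100"
    using W W' near_isometry_norm[OF _ \<delta>] by (auto simp: near_isometry_def)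
  define e where "e = idm k"
  have fact: "norm (adj (adj V * W) * (adj V * W) - e) \<le> 21 / 10 * \<delta>
      \<and> norm ((adj V * W) * adj (adj V * W) - e) \<le> 21 / 10 * \<delta>
      \<and> norm (adj V * W - e) \<le> 14 / 100 \<and> adj V * W \<in> rect k k"
    if W: "near_isometry k \<delta> W" and nr: "norm (W - V) \<le> 1 / 8" for W
  proof -
    have Wk: "W \<in> rect k k" using W by (simp add: near_isometry_def)
    have nW: "norm W \<le> 101 / 100" using W near_isometry_norm[OF _ \<delta>] by (auto simp: near_isometry_def)
    have "adj (adj V * W) * (adj V * W) - e = adj W * (V * adj V - e) * W + (adj W * W - e)"
      using mult_idm[OF rect_adj[OF Wk]] idm_mult[OF Wk] by (simp add: e_def adj_mult algebra_simps)
    also have "norm \<dots> \<le> 101 / 100 * \<delta> * (101 / 100) + \<delta>"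
      using V W nW unfolding near_isometry_def e_def
      by (intro norm_triangle_le add_mono norm_mult_le) auto
    also have "\<dots> \<le> 21 / 10 * \<delta>" using \<delta>0 by simp
    finally have 1: "norm (adj (adj V * W) * (adj V * W) - e) \<le> 21 / 10 * \<delta>" .
    have "(adj V * W) * adj (adj V * W) - e = adj V * (W * adj W - e) * V + (adj V * V - e)"
      using mult_idm[OF rect_adj[OF k(1)]] by (simp add: e_def adj_mult algebra_simps)
    also have "norm \<dots> \<le> 101 / 100 * \<delta> * (101 / 100) + \<delta>"
      using V W nV unfolding near_isometry_def e_def
      by (intro norm_triangle_le add_mono norm_mult_le) auto
    also have "\<dots> \<le> 21 / 10 * \<delta>" using \<delta>0 by simp
    finally have 2: "norm ((adj V * W) * adj (adj V * W) - e) \<le> 21 / 10 * \<delta>" .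
    have "adj V * W - e = adj V * (W - V) + (adj V * V - e)" by (simp add: algebra_simps)
    also have "norm \<dots> \<le> 101 / 100 * (1 / 8) + \<delta>"
      using V nr nV unfolding near_isometry_def e_def
      by (intro norm_triangle_le add_mono norm_mult_le) auto
    also have "\<dots> \<le> 14 / 100" using \<delta> by simp
    finally show ?thesis using 1 2 rect_times[OF rect_adj[OF k(1)] Wk] by blast
  qed
  define X X' where "X = adj V * W" and "X' = adj V * W'"
  have aX: "adj W * V = adj X" "adj W' * V = adj X'" by (simp_all add: X_def X'_def adj_mult)
  have Xk: "X \<in> rect k k" "X' \<in> rect k k"
    and X1: "norm (X - e) \<le> 14 / 100" "norm (X' - e) \<le> 14 / 100"
    and Xi: "norm (adj X * X - e) \<le> 21 / 10 * \<delta>" "norm (X * adj X - e) \<le> 21 / 10 * \<delta>"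
      "norm (adj X' * X' - e) \<le> 21 / 10 * \<delta>" "norm (X' * adj X' - e) \<le> 21 / 10 * \<delta>"
    using fact[OF W near(1)] fact[OF W' near(2)] by (auto simp: X_def X'_def)
  have ae: "adj e = e" by (simp add: e_def)
  have X1': "norm (adj X - e) \<le> 14 / 100" "norm (adj X' - e) \<le> 14 / 100"
    using X1 norm_adj[of "X - e"] norm_adj[of "X' - e"] by (simp_all add: adj_diff ae)
  have eX: "e * X = X" "X * e = X" "e * X' = X'" "X' * e = X'" "e * adj X = adj X" "adj X * e = adj X"
     "e * adj X' = adj X'" "adj X' * e = adj X'" "e * e = e"
    using Xk by (auto simp: e_def intro: idm_mult mult_idm rect_adj)
  define K K' p p' where "K = X - adj X" and "K' = X' - adj X'"
    and "p = X + adj X - 2 *\<^sub>R e" and "p' = X' + adj X' - 2 *\<^sub>R e"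
  have nK: "norm K \<le> 28 / 100" "norm K' \<le> 28 / 100"
  proof -
    have "K = (X - e) - (adj X - e)" "K' = (X' - e) - (adj X' - e)" by (simp_all add: K_def K'_def)
    then show "norm K \<le> 28 / 100" "norm K' \<le> 28 / 100"
      using norm_triangle_ineq4[of "X - e" "adj X - e"] norm_triangle_ineq4[of "X' - e" "adj X' - e"] X1 X1' by auto
  qed
  then show "norm (adj V * W - adj W * V) \<le> 1" by (simp add: aX K_def flip: X_def)
  have np: "norm p \<le> 28 / 100" "norm p' \<le> 28 / 100"
  proof -
    have "p = (X - e) + (adj X - e)" "p' = (X' - e) + (adj X' - e)"
      by (simp_all add: p_def p'_def scaleR_2)
    then show "norm p \<le> 28 / 100" "norm p' \<le> 28 / 100"
      using norm_triangle_ineq[of "X - e" "adj X - e"] norm_triangle_ineq[of "X' - e" "adj X' - e"] X1 X1' by auto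
  qed
  have ep: "e * p = p" "p * e = p" "e * p' = p'" "p' * e = p'"
    by (simp_all add: p_def p'_def algebra_simps eX)
  define Dp DK where "Dp = p - p'" and "DK = K - K'"
  \<comment> \<open>The identity \<open>(X + X\<^sup>*)\<^sup>2 - (X - X\<^sup>*)\<^sup>2 = 2 (X X\<^sup>* + X\<^sup>* X)\<close>, whose right side is almost constant.\<close>
  have P2: "4 *\<^sub>R p + p * p = K * K + 2 *\<^sub>R (X * adj X + adj X * X) - 4 *\<^sub>R e"
    "4 *\<^sub>R p' + p' * p' = K' * K' + 2 *\<^sub>R (X' * adj X' + adj X' * X') - 4 *\<^sub>R e"
  proof -
    have "4 *\<^sub>R y = y + y + y + y" for y :: fmat by (metis add.assoc numeral_Bit0 scaleR_2 scaleR_add_left)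
    then show "4 *\<^sub>R p + p * p = K * K + 2 *\<^sub>R (X * adj X + adj X * X) - 4 *\<^sub>R e"
      "4 *\<^sub>R p' + p' * p' = K' * K' + 2 *\<^sub>R (X' * adj X' + adj X' * X') - 4 *\<^sub>R e"
      by (simp_all add: p_def p'_def K_def K'_def algebra_simps eX scaleR_2)
  qed
  define E where "E = (X * adj X - e) + (adj X * X - e) - ((X' * adj X' - e) + (adj X' * X' - e))"
  have nE: "norm E \<le> 84 / 10 * \<delta>"
  proof -
    have "norm E \<le> (norm (X * adj X - e) + norm (adj X * X - e)) + (norm (X' * adj X' - e) + norm (adj X' * X' - e))"
      unfolding E_def by (intro norm_triangle_le_diff add_mono norm_triangle_ineq)
    then show ?thesis using Xi by linarith
  qed
  have "4 *\<^sub>R Dp = - (p * Dp) - Dp * p' + (K * DK + DK * K') + 2 *\<^sub>R E"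
  proof -
    have "4 *\<^sub>R p - 4 *\<^sub>R p' = (K * K - K' * K') - (p * p - p' * p') + 2 *\<^sub>R E"
    proof -
      have "4 *\<^sub>R p - 4 *\<^sub>R p' = (4 *\<^sub>R p + p * p) - (4 *\<^sub>R p' + p' * p') - (p * p - p' * p')"
        by simp
      then show ?thesis unfolding P2 by (simp add: E_def algebra_simps scaleR_2)
    qed
    moreover have "K * K - K' * K' = K * DK + DK * K'" "p * p - p' * p' = p * Dp + Dp * p'"
      by (simp_all add: DK_def Dp_def algebra_simps)
    ultimately show ?thesis by (simp add: Dp_def scaleR_diff_right)
  qed
  then have "norm (4 *\<^sub>R Dp) \<le> (28 / 100 * norm Dp + norm Dp * (28 / 100))
      + (28 / 100 * norm DK + norm DK * (28 / 100)) + 2 * (84 / 10 * \<delta>)"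
  proof -
    have "norm (4 *\<^sub>R Dp) \<le> norm (- (p * Dp) - Dp * p') + norm (K * DK + DK * K') + norm (2 *\<^sub>R E)"
      by (simp only: \<open>4 *\<^sub>R Dp = _\<close>) (meson norm_triangle_le add_mono order_refl)
    moreover have "norm (- (p * Dp) - Dp * p') \<le> 28 / 100 * norm Dp + norm Dp * (28 / 100)"
      using norm_triangle_ineq4[of "- (p * Dp)" "Dp * p'"] norm_mult_le[OF np(1) order_refl, of Dp]
        norm_mult_le[OF order_refl np(2), of Dp] by simp
    moreover have "norm (K * DK + DK * K') \<le> 28 / 100 * norm DK + norm DK * (28 / 100)"
      by (intro norm_triangle_le add_mono norm_mult_le nK order_refl)
    ultimately show ?thesis using nE by simp
  qed
  then have nD: "norm Dp \<le> 49 / 10 * \<delta> + 17 / 100 * norm DK"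
    using \<delta>0 norm_ge_zero[of DK] unfolding norm_scaleR by linarith
  have "2 *\<^sub>R (X - X') = Dp + DK" by (simp add: Dp_def DK_def p_def p'_def K_def K'_def scaleR_2)
  then have "2 * norm (X - X') = norm (Dp + DK)" by (metis abs_numeral norm_scaleR)
  then have nX: "2 * norm (X - X') \<le> norm Dp + norm DK" using norm_triangle_ineq[of Dp DK] by simp
  have "W - W' = V * (X - X') - (V * adj V - e) * (W - W')"
    using idm_mult[OF k(2)] idm_mult[OF k(3)] by (simp add: X_def X'_def e_def algebra_simps)
  then have "norm (W - W') \<le> norm (V * (X - X')) + norm ((V * adj V - e) * (W - W'))"
    by (metis norm_triangle_ineq4)
  also have "\<dots> \<le> 101 / 100 * norm (X - X') + \<delta> * (202 / 100)"
    using V nW norm_triangle_ineq4[of W W'] unfolding near_isometry_def e_def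
    by (intro add_mono norm_mult_le nV) auto
  also have "\<dots> \<le> norm DK + 5 * \<delta>" using nD nX \<delta>0 norm_ge_zero[of DK] by linarith
  finally show "norm (W - W') \<le> norm ((adj V * W - adj W * V) - (adj V * W' - adj W' * V)) + 5 * \<delta>"
    by (simp add: DK_def K_def K'_def aX flip: X_def X'_def)
qed

text \<open>Two scales: the \<open>2 k\<^sup>2\<close> real dimensions of all matrices are used at the fixed scale \<open>1 / 8\<close>, where
  they only cost a constant to the power \<open>k\<^sup>2\<close>; within one ball of this size the skew-adjoint parts
  leave \<open>k\<^sup>2\<close> dimensions for the small scale \<open>s\<close>.\<close>

theorem near_isometries_separated_card_le:
  assumes T: "finite T" "\<And>W. W \<in> T \<Longrightarrow> near_isometry k \<delta> W" "nsep s T"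
    and s: "0 < s" "s \<le> 1" and \<delta>: "\<delta> \<le> 1 / 100" "\<delta> \<le> s / 16"
  shows "real (card T) \<le> (2 ^ 18 / s) ^ (k\<^sup>2)"
proof -
  have Tk: "W \<in> rect k k" "norm W \<le> 2" if "W \<in> T" for W
    using T(2)[OF that] near_isometry_norm[OF _ \<delta>(1)] by (force simp: near_isometry_def)+
  have cardC: "real (card S) \<le> (8 * 2 / (1 / 8)) ^ (2 * k\<^sup>2)" if "finite S" "S \<subseteq> T" "nsep (1 / 8) S" for S
    by (rule matrix_separated_card_le) (use that Tk in auto)
  have "\<exists>C. finite C \<and> C \<subseteq> T \<and> nsep (1 / 8) C \<and> (\<forall>x\<in>T. \<exists>t\<in>C. norm (x - t) < 1 / 8)"
    by (rule maximal_separated_set[where n = "card T"])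
      (use T in \<open>auto intro: card_mono simp: norm_minus_commute\<close>)
  then obtain C where C: "finite C" "C \<subseteq> T" "nsep (1 / 8) C" and cov: "\<And>x. x \<in> T \<Longrightarrow> \<exists>t\<in>C. norm (x - t) < 1 / 8"
    by blast
  have fiber: "real (card {W \<in> T. norm (W - V) < 1 / 8}) \<le> (16 / s) ^ (k\<^sup>2)" if V: "V \<in> C" for V
  proof -
    define F where "F = {W \<in> T. norm (W - V) < 1 / 8}"
    define g where "g W = cs \<i> (adj V * W - adj W * V)" for W
    have VT: "V \<in> T" using V C by blast
    have gap: "s / 2 \<le> norm (g W - g W')" if "W \<in> F" "W' \<in> F" "W \<noteq> W'" for W W'
    proof -
      have "s \<le> norm (W - W')" using separatedD[OF T(3)] that by (auto simp: F_def)
      also have "\<dots> \<le> norm ((adj V * W - adj W * V) - (adj V * W' - adj W' * V)) + 5 * \<delta>"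
        using that VT by (intro skew_part_separates(1)[OF T(2) T(2) T(2) \<delta>(1)]) (auto simp: F_def)
      also have "norm ((adj V * W - adj W * V) - (adj V * W' - adj W' * V)) = norm (g W - g W')"
        by (simp add: g_def norm_cs flip: cs_diff_right)
      finally show ?thesis using \<delta> s by linarith
    qed
    have inj: "inj_on g F" by (rule inj_onI) (use gap s in fastforce)
    have "real (card (g ` F)) \<le> (8 * 1 / (s / 2)) ^ (k\<^sup>2)"
    proof (rule hermitian_separated_card_le)
      show "finite (g ` F)" using T by (simp add: F_def)
      show "nsep (s / 2) (g ` F)" using gap by (force simp: separated_def)
      fix A assume "A \<in> g ` F"
      then obtain W where W: "W \<in> F" "A = g W" by blast
      have "norm A \<le> 1" unfolding W g_def norm_cs
        using skew_part_separates(2)[OF T(2)[OF VT] T(2) T(2)[OF VT] \<delta>(1), of W] W by (simp add: F_def)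
      moreover have "A \<in> rect k k"
        using W Tk[OF VT] Tk[of W] unfolding W g_def
        by (intro rect_cs rect_diff rect_times[OF rect_adj]) (auto simp: F_def)
      moreover have "adj A = A" by (simp add: W g_def adj_cs adj_diff adj_mult cs_diff_right) (simp add: fmat_eqI)
      ultimately show "A \<in> rect k k \<and> adj A = A \<and> norm A \<le> 1" by blast
    qed (use s in auto)
    then show ?thesis unfolding F_def[symmetric] by (simp add: card_image[OF inj])
  qed
  have T_eq: "T = (\<Union>V\<in>C. {W \<in> T. norm (W - V) < 1 / 8})" using cov by auto
  have "card T \<le> (\<Sum>V\<in>C. card {W \<in> T. norm (W - V) < 1 / 8})"
    by (subst T_eq) (rule card_UN_le[OF C(1)])
  then have "real (card T) \<le> (\<Sum>V\<in>C. real (card {W \<in> T. norm (W - V) < 1 / 8}))"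
    by (simp flip: of_nat_sum)
  also have "\<dots> \<le> real (card C) * (16 / s) ^ (k\<^sup>2)"
    using sum_mono[OF fiber] by simp
  also have "\<dots> \<le> (128 ^ 2) ^ (k\<^sup>2) * (16 / s) ^ (k\<^sup>2)"
    using cardC[OF C] s by (intro mult_right_mono) (auto simp: power_mult)
  also have "\<dots> = (2 ^ 18 / s) ^ (k\<^sup>2)" by (simp flip: power_mult_distrib)
  finally show ?thesis .
qed

text \<open>\<open>U = (1 + \<i> H) (1 - \<i> H)\<^sup>-\<^sup>1\<close>, written with \<open>X = (1 - \<i> H)\<^sup>-\<^sup>1\<close>. In a basis of eigenvectors of
  \<open>H\<close> everything is diagonal.\<close>

lemma cayley_transform:
  assumes H: "H \<in> rect k k" "adj H = H"
  shows "\<exists>U X. unitary_in k U \<and> X \<in> rect k k \<and> (idm k - cs \<i> H) * X = idm k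
    \<and> X * (idm k - cs \<i> H) = idm k \<and> U + idm k = 2 *\<^sub>R X"
proof -
  obtain V d where V: "unitary_in k V" and HV: "H = V * diagm k (\<lambda>i. of_real (d i)) * adj V"
    using hermitian_diagonalisation[OF H] by blast
  have Vk: "V \<in> rect k k" and V': "adj V * V = idm k" "V * adj V = idm k" using V by (auto simp: unitary_in_def)
  define z where "z i = 1 - \<i> * of_real (d i)" for i
  have z0: "z i \<noteq> 0" for i by (simp add: z_def complex_eq_iff)
  have z2: "2 / z i - 1 = cnj (z i) / z i" for i using z0[of i] by (simp add: z_def field_simps)
  define C where "C f = V * diagm k f * adj V" for f
  have Ck: "C f \<in> rect k k" for f unfolding C_def by (rule rect_times[OF rect_times[OF Vk rect_diagm] rect_adj[OF Vk]])
  have CC: "C f * C g = C (\<lambda>i. f i * g i)" for f g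
  proof -
    have "C f * C g = V * diagm k f * (adj V * V) * diagm k g * adj V" by (simp add: C_def mult.assoc)
    also have "\<dots> = V * (diagm k f * diagm k g) * adj V"
      by (simp add: V' mult.assoc idm_mult[OF rect_diagm] mult_idm[OF rect_diagm])
    finally show ?thesis by (simp add: diagm_mult C_def)
  qed
  have C1: "C (\<lambda>_. 1) = idm k" using mult_idm[OF Vk] by (simp add: C_def V' flip: idm_def)
  have Ca: "adj (C f) = C (\<lambda>i. cnj (f i))" for f by (simp add: C_def adj_mult adj_diagm mult.assoc)
  have Cd: "C f - C g = C (\<lambda>i. f i - g i)" for f g
    by (simp add: C_def diagm_diff flip: left_diff_distrib right_diff_distrib)
  have Cs: "cs c (C f) = C (\<lambda>i. c * f i)" for c f
  proof -
    have "diagm k (\<lambda>i. c * f i) = cs c (diagm k f)" by (rule fmat_eqI) simp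
    then show ?thesis by (simp add: C_def cs_mult_left cs_mult_right)
  qed
  have HC: "H = C (\<lambda>i. of_real (d i))" by (simp add: C_def HV)
  have zC: "idm k - cs \<i> H = C z" unfolding HC Cs C1[symmetric] Cd by (simp add: z_def[abs_def])
  define X where "X = C (\<lambda>i. 1 / z i)"
  define U where "U = C (\<lambda>i. 2 / z i - 1)"
  have "unitary_in k U"
    unfolding unitary_in_def U_def using z0 by (simp add: Ck Ca CC z2 C1)
  moreover have "U = 2 *\<^sub>R X - idm k"
    unfolding U_def X_def scaleR_fmat_def Cs C1[symmetric] Cd by simp
  ultimately show ?thesis
    unfolding zC using z0 by (intro exI[of _ U] exI[of _ X]) (simp add: X_def Ck CC C1)
qed

text \<open>On the unit ball of the Hermitian matrices the Cayley transform shrinks distances at most by the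
  factor two, since \<open>(1 - \<i> H) (X - X') (1 - \<i> H') = \<i> (H - H')\<close>.\<close>

theorem separated_unitaries:
  assumes s: "0 < s" "2 * s \<le> 1"
  shows "\<exists>T. finite T \<and> (\<forall>U\<in>T. unitary_in k U) \<and> nsep s T \<and> (1 / (2 * s)) ^ (k\<^sup>2) \<le> real (card T)"
proof -
  obtain S where S: "finite S" "\<And>A. A \<in> S \<Longrightarrow> A \<in> rect k k \<and> adj A = A \<and> norm A \<le> 1" "nsep (2 * s) S"
    "(1 / (2 * s)) ^ (k\<^sup>2) \<le> real (card S)"
    using hermitian_separated_set[of "2 * s" 1 k] s by auto
  have "\<forall>H\<in>S. \<exists>U X. unitary_in k U \<and> X \<in> rect k k \<and> (idm k - cs \<i> H) * X = idm k
    \<and> X * (idm k - cs \<i> H) = idm k \<and> U + idm k = 2 *\<^sub>R X"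
    using S(2) cayley_transform by blast
  then obtain U X where UX: "\<And>H. H \<in> S \<Longrightarrow> unitary_in k (U H)" "\<And>H. H \<in> S \<Longrightarrow> X H \<in> rect k k"
    "\<And>H. H \<in> S \<Longrightarrow> (idm k - cs \<i> H) * X H = idm k" "\<And>H. H \<in> S \<Longrightarrow> X H * (idm k - cs \<i> H) = idm k"
    "\<And>H. H \<in> S \<Longrightarrow> U H + idm k = 2 *\<^sub>R X H" by metis
  have gap: "s \<le> norm (U H - U H')" if H: "H \<in> S" "H' \<in> S" "H \<noteq> H'" for H H'
  proof -
    have n: "norm (idm k - cs \<i> A) \<le> 2" if "A \<in> S" for A
      using norm_triangle_ineq4[of "idm k" "cs \<i> A"] norm_idm_le[of k] S(2)[OF that] by (simp add: norm_cs)
    have "(idm k - cs \<i> H) * (X H - X H') * (idm k - cs \<i> H')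
      = ((idm k - cs \<i> H) * X H) * (idm k - cs \<i> H') - (idm k - cs \<i> H) * (X H' * (idm k - cs \<i> H'))"
      by (simp add: left_diff_distrib right_diff_distrib mult.assoc)
    also have "\<dots> = (idm k - cs \<i> H') - (idm k - cs \<i> H)"
    proof -
      have r: "idm k - cs \<i> A \<in> rect k k" if "A \<in> S" for A
        using S(2)[OF that] by (intro rect_diff rect_idm rect_cs) auto
      show ?thesis
        by (simp only: UX(3)[OF H(1)] UX(4)[OF H(2)] idm_mult[OF r[OF H(2)]] mult_idm[OF r[OF H(1)]])
    qed
    also have "\<dots> = cs \<i> (H - H')" by (simp add: cs_diff_right)
    finally have "norm (H - H') \<le> 2 * norm (X H - X H') * 2"
      using n[OF H(1)] n[OF H(2)] by (metis norm_cs norm_ii mult_1 norm_mult_le order_refl)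
    moreover have "2 *\<^sub>R (X H - X H') = U H - U H'"
      by (simp add: scaleR_diff_right UX(5)[OF H(1), symmetric] UX(5)[OF H(2), symmetric])
    then have "norm (U H - U H') = 2 * norm (X H - X H')" by (metis abs_numeral norm_scaleR)
    moreover have "2 * s \<le> norm (H - H')" using separatedD[OF S(3)] H by blast
    ultimately show ?thesis by simp
  qed
  have inj: "inj_on U S" by (rule inj_onI) (use gap s in fastforce)
  have "nsep s (U ` S)" unfolding separated_def by (blast intro: gap)
  then show ?thesis
    using S UX(1) card_image[OF inj] by (intro exI[of _ "U ` S"]) auto
qed

section \<open>Approximate matrix units\<close>

lemma norm_unitary_le: "unitary_in k U \<Longrightarrow> norm U \<le> 1"
proof -
  assume "unitary_in k U"
  then have "(norm U)\<^sup>2 \<le> 1\<^sup>2" using norm_adj_mult_self[of U] norm_idm_le[of k] by (simp add: unitary_in_def)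
  then show ?thesis by (rule power2_le_imp_le) simp
qed

text \<open>An eigenvalue \<open>d\<close> of \<open>f\<close> satisfies \<open>\<bar>d\<^sup>2 - d\<bar> \<le> \<eta>\<close> and therefore is within \<open>2 \<eta>\<close> of \<open>0\<close> or of \<open>1\<close>. The columns
  of \<open>S\<close> are the eigenvectors of the second kind.\<close>

lemma spectral_projection_isometry:
  assumes f: "f \<in> rect k k" "adj f = f" "norm (f * f - f) \<le> \<eta>"
  shows "\<exists>t S. S \<in> rect k t \<and> adj S * S = idm t \<and> norm (S * adj S - f) \<le> 2 * \<eta>"
proof -
  obtain U d where U: "unitary_in k U" and fU: "f = U * diagm k (\<lambda>i. of_real (d i)) * adj U"
    using hermitian_diagonalisation[OF f(1,2)] by blast
  have Uk: "U \<in> rect k k" and U': "adj U * U = idm k" "U * adj U = idm k" using U by (auto simp: unitary_in_def)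
  have nU: "norm U \<le> 1" "norm (adj U) \<le> 1" using norm_unitary_le[OF U] by auto
  have \<eta>: "0 \<le> \<eta>" using f(3) norm_ge_zero order.trans by blast
  have Uf: "adj U * f * U = diagm k (\<lambda>i. of_real (d i))"
  proof -
    have "adj U * f * U = (adj U * U) * diagm k (\<lambda>i. of_real (d i)) * (adj U * U)" by (simp add: fU mult.assoc)
    then show ?thesis by (simp add: U' idm_mult[OF rect_diagm] mult_idm[OF rect_diagm])
  qed
  have dd: "\<bar>d i * d i - d i\<bar> \<le> \<eta>" if "i < k" for i
  proof -
    have "adj U * (f * f - f) * U = (adj U * f * U) * (adj U * f * U) - adj U * f * U"
    proof -
      have "(adj U * f * U) * (adj U * f * U) = adj U * f * (U * adj U) * f * U" by (simp add: mult.assoc)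
      also have "\<dots> = adj U * (f * idm k) * f * U" by (simp add: U' mult.assoc)
      finally show ?thesis by (simp add: mult_idm[OF f(1)] algebra_simps)
    qed
    then have "adj U * (f * f - f) * U = diagm k (\<lambda>i. of_real (d i * d i - d i))"
      by (simp add: Uf diagm_mult diagm_diff)
    then have "cmod (of_real (d i * d i - d i)) \<le> norm (adj U * (f * f - f) * U)"
      using cmod_ent_le[of "adj U * (f * f - f) * U" i i] that by simp
    also have "\<dots> \<le> 1 * \<eta> * 1" by (intro norm_mult_le nU f)
    finally show ?thesis unfolding norm_of_real by simp
  qed
  define J where "J = {i. i < k \<and> 1 / 2 < d i}"
  define t where "t = card J"
  have "finite J" by (simp add: J_def)
  then obtain \<iota> where \<iota>: "bij_betw \<iota> {..<t} J"
    unfolding t_def using ex_bij_betw_nat_finite by (metis atLeast0LessThan)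
  have \<iota>J: "\<iota> r < k" "1 / 2 < d (\<iota> r)" if "r < t" for r using bij_betwE[OF \<iota>] that by (auto simp: J_def)
  define Q where "Q = emb (mat k t (\<lambda>(i, r). if i = \<iota> r then 1 else 0))"
  have Qe: "ent Q i r = (if r < t \<and> i = \<iota> r then 1 else 0)" for i r using \<iota>J by (auto simp: Q_def)
  have Qk: "Q \<in> rect k t" unfolding Q_def by (rule emb_rect) simp
  have Q1: "adj Q * Q = idm t"
  proof (rule fmat_eqI)
    fix r r'
    have "ent (adj Q * Q) r r' = (\<Sum>i<k. if i = \<iota> r then (if r < t \<and> r' < t \<and> \<iota> r = \<iota> r' then 1 else 0) else 0)"
      unfolding ent_times'[OF Qk] by (rule sum.cong) (auto simp: Qe)
    also have "\<dots> = ent (idm t) r r'"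
      using \<iota>J \<iota> by (auto simp: bij_betw_def inj_on_def)
    finally show "ent (adj Q * Q) r r' = ent (idm t) r r'" .
  qed
  have Q2: "Q * adj Q = diagm k (\<lambda>i. if i \<in> J then 1 else 0)"
  proof (rule fmat_eqI)
    fix i j
    have "ent (Q * adj Q) i j = (\<Sum>r<t. if i = j \<and> i = \<iota> r then 1 else 0)"
      unfolding ent_times[OF Qk] by (rule sum.cong) (auto simp: Qe)
    also have "\<dots> = (if i = j then (\<Sum>r\<in>{..<t}. (\<lambda>x. if x = i then 1 else 0) (\<iota> r)) else 0)"
      by (auto intro!: sum.cong)
    also have "\<dots> = (if i = j then (\<Sum>x\<in>J. if x = i then 1 else 0) else 0)"
      using sum.reindex_bij_betw[OF \<iota>, of "(\<lambda>x. if x = i then 1 else 0) :: nat \<Rightarrow> complex"]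
      by (cases "i = j") auto
    also have "\<dots> = ent (diagm k (\<lambda>i. if i \<in> J then 1 else 0)) i j"
      using \<open>finite J\<close> by (auto simp: J_def)
    finally show "ent (Q * adj Q) i j = ent (diagm k (\<lambda>i. if i \<in> J then 1 else 0)) i j" .
  qed
  define S where "S = U * Q"
  have "S \<in> rect k t" unfolding S_def by (rule rect_times[OF Uk Qk])
  moreover have "adj S * S = idm t"
  proof -
    have "adj S * S = adj Q * (adj U * U) * Q" by (simp add: S_def adj_mult mult.assoc)
    then show ?thesis using idm_mult[OF Qk] by (simp add: U' mult.assoc Q1)
  qed
  moreover have "norm (S * adj S - f) \<le> 2 * \<eta>"
  proof -
    have "S * adj S - f = U * (Q * adj Q - diagm k (\<lambda>i. of_real (d i))) * adj U"
      by (simp add: S_def fU adj_mult algebra_simps)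
    moreover have "norm (Q * adj Q - diagm k (\<lambda>i. of_real (d i))) \<le> 2 * \<eta>"
      unfolding Q2 diagm_diff
    proof (rule norm_diagm_le)
      fix i assume i: "i < k"
      show "cmod ((if i \<in> J then 1 else 0) - of_real (d i)) \<le> 2 * \<eta>"
      proof (cases "1 / 2 < d i")
        case True
        have "(1 / 2) * \<bar>1 - d i\<bar> \<le> d i * \<bar>1 - d i\<bar>" using True by (intro mult_right_mono) auto
        also have "\<dots> = \<bar>d i * (1 - d i)\<bar>" using True by (simp add: abs_mult)
        also have "\<dots> = \<bar>d i * d i - d i\<bar>" by (simp add: right_diff_distrib abs_minus_commute)
        also have "\<dots> \<le> \<eta>" by (rule dd[OF i])
        finally have "\<bar>1 - d i\<bar> \<le> 2 * \<eta>" by simp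
        moreover have "cmod (1 - of_real (d i)) = \<bar>1 - d i\<bar>" by (metis norm_of_real of_real_1 of_real_diff)
        ultimately show ?thesis using True i by (simp add: J_def)
      next
        case False
        have "\<bar>d i\<bar> * (1 / 2) \<le> \<bar>d i\<bar> * (1 - d i)" using False by (intro mult_left_mono) auto
        also have "\<dots> = \<bar>d i * (1 - d i)\<bar>" using False by (simp add: abs_mult)
        also have "\<dots> = \<bar>d i * d i - d i\<bar>" by (simp add: right_diff_distrib abs_minus_commute)
        finally show ?thesis using dd[OF i] False i by (simp add: J_def)
      qed
    qed (use \<eta> in simp)
    ultimately show ?thesis using norm_mult_le[OF norm_mult_le[OF nU(1)] nU(2)] by force
  qed
  ultimately show ?thesis by blast
qed

definition tr :: "nat \<Rightarrow> fmat \<Rightarrow> complex" where "tr k A = (\<Sum>i<k. ent A i i)"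

lemma tr_commute:
  assumes "A \<in> rect k l" "B \<in> rect l k"
  shows "tr k (A * B) = tr l (B * A)"
proof -
  have "tr k (A * B) = (\<Sum>i<k. \<Sum>j<l. ent B j i * ent A i j)"
    by (simp add: tr_def ent_times[OF assms(1)] mult.commute)
  also have "\<dots> = tr l (B * A)" unfolding tr_def ent_times[OF assms(2)] by (rule sum.swap)
  finally show ?thesis .
qed

text \<open>\<open>P = W (W\<^sup>* W)\<^sup>-\<^sup>1 W\<^sup>*\<close> is a projection of trace \<open>l\<close> among matrices of size \<open>k\<close>, and the complementary
  projection has nonnegative trace.\<close>

lemma near_isometry_rank_le:
  assumes W: "W \<in> rect k l" and near: "norm (adj W * W - idm l) < 1"
  shows "l \<le> k"
proof -
  define G where "G = adj W * W"
  have Gl: "G \<in> rect l l" unfolding G_def by (rule rect_times[OF rect_adj[OF W] W])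
  have aG: "adj G = G" by (simp add: G_def adj_mult)
  obtain U d where U: "unitary_in l U" and GU: "G = U * diagm l (\<lambda>i. of_real (d i)) * adj U"
    using hermitian_diagonalisation[OF Gl aG] by blast
  have Uk: "U \<in> rect l l" and U': "adj U * U = idm l" "U * adj U = idm l" using U by (auto simp: unitary_in_def)
  have nU: "norm U \<le> 1" "norm (adj U) \<le> 1" using norm_unitary_le[OF U] by auto
  have "adj U * (G - idm l) * U = diagm l (\<lambda>i. of_real (d i - 1))"
  proof -
    have "adj U * (G - idm l) * U = adj U * G * U - adj U * (idm l * U)" by (simp add: algebra_simps)
    also have "adj U * G * U = (adj U * U) * diagm l (\<lambda>i. of_real (d i)) * (adj U * U)" by (simp add: GU mult.assoc)
    finally show ?thesis
      by (simp add: idm_mult[OF Uk] U' idm_mult[OF rect_diagm] mult_idm[OF rect_diagm]) (simp add: idm_def diagm_diff)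
  qed
  then have "cmod (of_real (d i - 1)) \<le> norm (adj U * (G - idm l) * U)" if "i < l" for i
    using cmod_ent_le[of "adj U * (G - idm l) * U" i i] that by simp
  moreover have "norm (adj U * (G - idm l) * U) \<le> 1 * norm (G - idm l) * 1"
    by (intro norm_mult_le nU order_refl)
  ultimately have "\<bar>d i - 1\<bar> < 1" if "i < l" for i
    using near that unfolding norm_of_real G_def by fastforce
  then have d0: "d i \<noteq> 0" if "i < l" for i using that by force
  define R where "R = U * diagm l (\<lambda>i. of_real (1 / d i)) * adj U"
  have Rl: "R \<in> rect l l" unfolding R_def by (rule rect_times[OF rect_times[OF Uk rect_diagm] rect_adj[OF Uk]])
  have aR: "adj R = R" by (simp add: R_def adj_mult adj_diagm mult.assoc)
  have GR: "G * R = idm l"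
  proof -
    have "G * R = U * diagm l (\<lambda>i. of_real (d i)) * (adj U * U) * diagm l (\<lambda>i. of_real (1 / d i)) * adj U"
      by (simp add: GU R_def mult.assoc)
    also have "\<dots> = U * (diagm l (\<lambda>i. of_real (d i)) * idm l) * diagm l (\<lambda>i. of_real (1 / d i)) * adj U"
      by (simp add: U' mult.assoc)
    also have "\<dots> = U * (diagm l (\<lambda>i. of_real (d i)) * diagm l (\<lambda>i. of_real (1 / d i))) * adj U"
      by (simp only: mult_idm[OF rect_diagm] mult.assoc)
    also have "diagm l (\<lambda>i. of_real (d i)) * diagm l (\<lambda>i. of_real (1 / d i)) = idm l"
      unfolding diagm_mult using d0 by (intro fmat_eqI) auto
    finally show ?thesis using mult_idm[OF Uk] U' by simp
  qed
  define P where "P = W * (R * adj W)"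
  have Pk: "P \<in> rect k k" unfolding P_def by (rule rect_times[OF W rect_times[OF Rl rect_adj[OF W]]])
  have "P * P = W * R * (G * R) * adj W" by (simp add: P_def G_def mult.assoc)
  then have PP: "P * P = P" using mult_idm[OF Rl] by (simp add: GR P_def mult.assoc)
  have aP: "adj P = P" by (simp add: P_def adj_mult aR mult.assoc)
  have "R * G = idm l" using arg_cong[OF GR, of adj] by (simp add: adj_mult aR aG)
  then have "tr k P = tr l (idm l)"
    unfolding P_def by (subst tr_commute[OF W rect_times[OF Rl rect_adj[OF W]]]) (simp add: G_def mult.assoc)
  then have trP: "tr k P = of_nat l" by (simp add: tr_def)
  define Q where "Q = idm k - P"
  have Qk: "Q \<in> rect k k" unfolding Q_def by (intro rect_diff rect_idm Pk)
  have "Q * adj Q = Q" by (simp add: Q_def adj_diff aP algebra_simps PP idm_mult[OF Pk] mult_idm[OF Pk])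
  moreover have "tr k (Q * adj Q) = (\<Sum>i<k. \<Sum>j<k. of_real ((cmod (ent Q i j))\<^sup>2))"
    unfolding tr_def ent_times[OF Qk] ent_adj complex_norm_square ..
  ultimately have "0 \<le> Re (tr k Q)" by (simp add: sum_nonneg del: of_real_power flip: of_real_sum)
  moreover have "tr k Q = of_nat k - tr k P" by (simp add: Q_def tr_def sum_subtractf)
  ultimately show ?thesis by (simp add: trP)
qed

text \<open>The projection of a space of dimension \<open>m t\<close> onto the \<open>s\<close>-th of its \<open>m\<close> consecutive blocks of
  coordinates; its adjoint is the inclusion of this block.\<close>

definition block :: "nat \<Rightarrow> nat \<Rightarrow> nat \<Rightarrow> fmat" where
  "block m t s = emb (mat t (m * t) (\<lambda>(i, j). if j = s * t + i then 1 else 0))"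

text \<open>The matrix unit \<open>e a b\<close> of size \<open>m\<close> tensored with the unit of size \<open>t\<close>.\<close>

definition munit :: "nat \<Rightarrow> nat \<Rightarrow> nat \<Rightarrow> nat \<Rightarrow> fmat" where
  "munit m t a b = adj (block m t a) * block m t b"

lemma block_rect [simp, intro]: "block m t s \<in> rect t (m * t)"
  unfolding block_def by (rule emb_rect) simp

lemma block_index_less: "s < m \<Longrightarrow> i < t \<Longrightarrow> s * t + i < m * t" for s m i t :: nat
proof -
  assume "s < m" "i < t"
  then have "s * t + i < Suc s * t" by simp
  also have "\<dots> \<le> m * t" using \<open>s < m\<close> by (intro mult_right_mono) auto
  finally show ?thesis .
qed

lemma ent_block: "s < m \<Longrightarrow> ent (block m t s) i j = (if i < t \<and> j = s * t + i then 1 else 0)"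
  by (auto simp: block_def block_index_less)

lemma block_mult_adj:
  assumes "s < m" "s' < m"
  shows "block m t s * adj (block m t s') = (if s = s' then idm t else 0)"
proof (rule fmat_eqI)
  fix i j
  have "ent (block m t s * adj (block m t s')) i j
    = (\<Sum>l<m * t. if l = s * t + i then (if i < t \<and> j < t \<and> s * t + i = s' * t + j then 1 else 0) else 0)"
    unfolding ent_times[OF block_rect] by (rule sum.cong) (auto simp: ent_block assms)
  also have "\<dots> = (if i < t \<and> j < t \<and> s * t + i = s' * t + j then 1 else 0)"
    using assms by (auto simp: block_index_less)
  also have "\<dots> = (if i < t \<and> s = s' \<and> i = j then 1 else 0)"
  proof -
    have "s = s' \<and> i = j" if "i < t" "j < t" "s * t + i = s' * t + j"
    proof -
      have "(s * t + i) div t = s" "(s' * t + j) div t = s'" using that(1,2) by auto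
      with that(3) show ?thesis by auto
    qed
    then show ?thesis by auto
  qed
  finally show "ent (block m t s * adj (block m t s')) i j = ent (if s = s' then idm t else 0) i j" by simp
qed

lemma sum_adj_block: "(\<Sum>s<m. adj (block m t s) * block m t s) = idm (m * t)"
proof (rule fmat_eqI)
  fix i j
  have e: "ent (adj (block m t s) * block m t s) i j = (if i = j \<and> i div t = s \<and> i < m * t then 1 else 0)" if s: "s < m" for s
  proof -
    have "ent (adj (block m t s) * block m t s) i j
      = (\<Sum>l<t. if l = i - s * t then (if i = j \<and> i = s * t + l then 1 else 0) else 0)"
      unfolding ent_times'[OF block_rect] by (rule sum.cong) (auto simp: ent_block s)
    also have "\<dots> = (if i = j \<and> s * t \<le> i \<and> i - s * t < t then 1 else 0)" by auto
    also have "\<dots> = (if i = j \<and> i div t = s \<and> i < m * t then 1 else 0)"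
    proof -
      have "s * t \<le> i \<and> i - s * t < t \<longleftrightarrow> i div t = s \<and> i < m * t"
      proof
        assume a: "s * t \<le> i \<and> i - s * t < t"
        then have "i = s * t + (i - s * t)" by simp
        with a show "i div t = s \<and> i < m * t"
          using block_index_less[OF s, of "i - s * t" t]
          by (metis add.right_neutral div_less div_mult_self3 gr_implies_not0)
      next
        assume a: "i div t = s \<and> i < m * t"
        then have "t > 0" by (cases t) auto
        then have "i mod t < t" by simp
        moreover have "i = s * t + i mod t" using a by (metis div_mult_mod_eq)
        ultimately show "s * t \<le> i \<and> i - s * t < t" by linarith
      qed
      then show ?thesis by auto
    qed
    finally show ?thesis .
  qed
  have "ent (\<Sum>s<m. adj (block m t s) * block m t s) i j = (\<Sum>s<m. if s = i div t then (if i = j \<and> i < m * t then 1 else 0) else 0)"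
    unfolding ent_sum by (rule sum.cong) (auto simp: e)
  also have "\<dots> = (if i = j \<and> i < m * t \<and> i div t < m then 1 else 0)" by auto
  also have "\<dots> = ent (idm (m * t)) i j" by (auto simp: less_mult_imp_div_less)
  finally show "ent (\<Sum>s<m. adj (block m t s) * block m t s) i j = ent (idm (m * t)) i j" .
qed

lemma norm_sum_le_mult: "(\<And>s. s < m \<Longrightarrow> norm (f s) \<le> c) \<Longrightarrow> norm (\<Sum>s<m. f s) \<le> real m * c"
  for f :: "nat \<Rightarrow> 'a::real_normed_vector"
  using sum_norm_le[of "{..<m}" f "\<lambda>_. c"] by simp

text \<open>Stability of matrix units. The isometry \<open>S\<close> onto the almost range of \<open>F 0 0\<close> is transported by
  \<open>F s 0\<close> for each \<open>s < m\<close>; the \<open>m\<close> resulting maps are put next to each other to form \<open>W\<close>. The relations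
  say that the pieces are almost isometric, almost orthogonal and almost exhaust the space, and that
  \<open>F a b\<close> almost maps the piece \<open>b\<close> to the piece \<open>a\<close>.\<close>

theorem approximate_matrix_units:
  assumes m: "1 \<le> m" and Fk: "\<And>a b. a < m \<Longrightarrow> b < m \<Longrightarrow> F a b \<in> rect k k"
    and \<eta>: "0 \<le> \<eta>"
    and mult: "\<And>a b c d. a < m \<Longrightarrow> b < m \<Longrightarrow> c < m \<Longrightarrow> d < m \<Longrightarrow>
        norm (F a b * F c d - (if b = c then F a d else 0)) \<le> \<eta>"
    and star: "\<And>a b. a < m \<Longrightarrow> b < m \<Longrightarrow> norm (adj (F a b) - F b a) \<le> \<eta>"
    and unit: "norm ((\<Sum>a<m. F a a) - idm k) \<le> \<eta>"
    and bnd: "\<And>a b. a < m \<Longrightarrow> b < m \<Longrightarrow> norm (F a b) \<le> 2"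
  shows "\<exists>t W. W \<in> rect k (m * t) \<and> norm (adj W * W - idm (m * t)) \<le> 40 * (real m)\<^sup>2 * \<eta>
    \<and> norm (W * adj W - idm k) \<le> 40 * (real m)\<^sup>2 * \<eta>
    \<and> (\<forall>a<m. \<forall>b<m. norm (F a b - W * munit m t a b * adj W) \<le> 40 * (real m)\<^sup>2 * \<eta>)"
proof -
  have m0: "0 < m" using m by simp
  define f where "f = (1 / 2) *\<^sub>R (F 0 0 + adj (F 0 0))"
  have fk: "f \<in> rect k k" unfolding f_def by (intro rect_scaleR rect_add rect_adj Fk m0)
  have af: "adj f = f" by (simp add: f_def adj_scaleR adj_add add.commute)
  have nf: "norm f \<le> 2"
    using norm_triangle_ineq[of "F 0 0" "adj (F 0 0)"] bnd[OF m0 m0] by (simp add: f_def)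
  have "f - F 0 0 = (1 / 2) *\<^sub>R (adj (F 0 0) - F 0 0)"
    by (simp add: f_def algebra_simps flip: scaleR_add_left)
  then have fF: "norm (f - F 0 0) \<le> \<eta> / 2" using star[OF m0 m0] by simp
  have "norm (f * f - f) \<le> 7 / 2 * \<eta>"
  proof -
    have "f * f - f = f * (f - F 0 0) + (f - F 0 0) * F 0 0 + (F 0 0 * F 0 0 - F 0 0) + (F 0 0 - f)"
      by (simp add: algebra_simps)
    also have "norm \<dots> \<le> (2 * (\<eta> / 2) + (\<eta> / 2) * 2 + \<eta>) + \<eta> / 2"
      using mult[OF m0 m0 m0 m0] fF
      by (intro norm_triangle_le add_mono norm_mult_le nf fF bnd m0) (auto simp: norm_minus_commute)
    finally show ?thesis by simp
  qed
  from spectral_projection_isometry[OF fk af this] obtain t S where S: "S \<in> rect k t" "adj S * S = idm t"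
    and Sf: "norm (S * adj S - f) \<le> 7 * \<eta>" by auto
  have SF: "norm (S * adj S - F 0 0) \<le> 8 * \<eta>"
    using norm_triangle_ineq[of "S * adj S - f" "f - F 0 0"] Sf fF \<eta> by simp
  have "(norm S)\<^sup>2 \<le> 1\<^sup>2" using norm_adj_mult_self[of S] norm_idm_le[of t] S by simp
  then have "norm S \<le> 1" by (rule power2_le_imp_le) simp
  then have nS: "norm S \<le> 1" "norm (adj S) \<le> 1" by simp_all
  define V where "V s = F s 0 * S" for s
  have Vk: "V s \<in> rect k t" if "s < m" for s unfolding V_def by (rule rect_times[OF Fk[OF that m0] S(1)])
  \<comment> \<open>The approximate isometries \<open>V s\<close> have almost orthogonal ranges, which add up to the whole space.\<close>
  have VV: "norm (adj (V s) * V s' - (if s = s' then idm t else 0)) \<le> 11 * \<eta>" if s: "s < m" "s' < m" for s s'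
  proof -
    have "adj (V s) * V s' - (if s = s' then idm t else 0)
      = adj S * ((adj (F s 0) - F 0 s) * F s' 0 + (F 0 s * F s' 0 - (if s = s' then F 0 0 else 0))) * S
        + (if s = s' then adj S * (F 0 0 - S * adj S) * S else 0)"
    proof -
      have "adj S * (S * adj S) * S = idm t" by (simp add: mult.assoc[symmetric] S(2)) (simp add: mult.assoc S(2))
      then show ?thesis by (simp add: V_def adj_mult algebra_simps)
    qed
    also have "norm \<dots> \<le> 1 * (\<eta> * 2 + \<eta>) * 1 + 8 * \<eta>"
    proof (intro norm_triangle_le add_mono norm_mult_le nS)
      have "norm (F 0 0 - S * adj S) \<le> 8 * \<eta>" using SF by (simp add: norm_minus_commute)
      then show "norm (if s = s' then adj S * (F 0 0 - S * adj S) * S else 0) \<le> 8 * \<eta>"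
        using norm_mult_le[OF norm_mult_le[OF nS(2)] nS(1), of "F 0 0 - S * adj S" "8 * \<eta>"] \<eta> by auto
    qed (use s m0 star bnd mult in auto)
    finally show ?thesis by simp
  qed
  have VF: "norm (V a * adj (V b) - F a b) \<le> 39 * \<eta>" if ab: "a < m" "b < m" for a b
  proof -
    have "V a * adj (V b) - F a b = F a 0 * (S * adj S - F 0 0) * adj (F b 0)
      + F a 0 * F 0 0 * (adj (F b 0) - F 0 b) + (F a 0 * F 0 0 - F a 0) * F 0 b + (F a 0 * F 0 b - F a b)"
      by (simp add: V_def adj_mult algebra_simps)
    also have "norm \<dots> \<le> 2 * (8 * \<eta>) * 2 + 2 * 2 * \<eta> + \<eta> * 2 + \<eta>"
      using mult[of a 0 0 0] mult[of a 0 0 b] ab m0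
      by (intro norm_triangle_le add_mono norm_mult_le SF star) (auto intro: bnd)
    finally show ?thesis by simp
  qed
  define J where "J = block m t"
  have JJ: "J s * adj (J s') = (if s = s' then idm t else 0)" if "s < m" "s' < m" for s s'
    unfolding J_def by (rule block_mult_adj[OF that])
  have nJ: "norm (J s) \<le> 1" "norm (adj (J s)) \<le> 1" if "s < m" for s
  proof -
    have "(norm (J s))\<^sup>2 \<le> 1\<^sup>2" using norm_mult_adj_self[of "J s"] norm_idm_le[of t] JJ[OF that that] by simp
    then have "norm (J s) \<le> 1" by (rule power2_le_imp_le) simp
    then show "norm (J s) \<le> 1" "norm (adj (J s)) \<le> 1" by simp_all
  qed
  define W where "W = (\<Sum>s<m. V s * J s)"
  have Wk: "W \<in> rect k (m * t)"
    unfolding W_def J_def by (rule rect_sum) (metis Vk block_rect lessThan_iff rect_times)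
  have aW: "adj W = (\<Sum>s<m. adj (J s) * adj (V s))" by (simp add: W_def adj_sum adj_mult)
  have WJ: "W * adj (J a) = V a" if a: "a < m" for a
  proof -
    have "W * adj (J a) = (\<Sum>s<m. if s = a then V a else 0)"
      unfolding W_def sum_distrib_right
      by (rule sum.cong) (use JJ[OF _ a] mult_idm[OF Vk[OF a]] in \<open>auto simp: mult.assoc\<close>)
    then show ?thesis using a by simp
  qed
  have "norm (adj W * W - idm (m * t)) \<le> real m * (real m * (11 * \<eta>))"
  proof -
    have "idm (m * t) = (\<Sum>s<m. \<Sum>s'<m. adj (J s) * (if s = s' then idm t else 0) * J s')"
    proof -
      have "(\<Sum>s'<m. adj (J s) * (if s = s' then idm t else 0) * J s') = adj (J s) * J s" if "s < m" for s
      proof -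
        have "(\<Sum>s'<m. adj (J s) * (if s = s' then idm t else 0) * J s') = (\<Sum>s'<m. if s' = s then adj (J s) * J s else 0)"
          using mult_idm[OF rect_adj[OF block_rect[of m t s]]] by (intro sum.cong) (auto simp: J_def)
        then show ?thesis using that by simp
      qed
      then show ?thesis using sum_adj_block[of m t] by (simp add: J_def)
    qed
    moreover have "adj W * W = (\<Sum>s<m. \<Sum>s'<m. adj (J s) * (adj (V s) * V s') * J s')"
      by (simp add: aW) (simp add: W_def sum_product mult.assoc)
    ultimately have "adj W * W - idm (m * t)
      = (\<Sum>s<m. \<Sum>s'<m. adj (J s) * (adj (V s) * V s' - (if s = s' then idm t else 0)) * J s')"
      by (simp only: sum_subtractf[symmetric] left_diff_distrib right_diff_distrib)
    also have "norm \<dots> \<le> real m * (real m * (1 * (11 * \<eta>) * 1))"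
      by (intro norm_sum_le_mult norm_mult_le nJ VV)
    finally show ?thesis by simp
  qed
  also have "\<dots> \<le> 40 * (real m)\<^sup>2 * \<eta>" using \<eta> by (simp add: power2_eq_square)
  finally have 1: "norm (adj W * W - idm (m * t)) \<le> 40 * (real m)\<^sup>2 * \<eta>" .
  have mm: "real m \<le> (real m)\<^sup>2" "1 \<le> (real m)\<^sup>2" using m by (auto intro: self_le_power one_le_power)
  have WW: "W * adj W = (\<Sum>s<m. V s * adj (V s))"
    unfolding aW sum_distrib_left by (rule sum.cong) (simp_all add: WJ flip: mult.assoc)
  have "W * adj W - idm k = (\<Sum>s<m. V s * adj (V s) - F s s) + ((\<Sum>s<m. F s s) - idm k)"
    by (simp add: WW sum_subtractf)
  also have "norm \<dots> \<le> real m * (39 * \<eta>) + \<eta>"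
    by (intro norm_triangle_le add_mono norm_sum_le_mult VF unit)
  also have "\<dots> \<le> (39 * (real m)\<^sup>2 + (real m)\<^sup>2) * \<eta>"
    using mult_right_mono[OF mm(1) \<eta>] mult_right_mono[OF mm(2) \<eta>] by (simp add: distrib_right)
  finally have 2: "norm (W * adj W - idm k) \<le> 40 * (real m)\<^sup>2 * \<eta>" by simp
  have 3: "norm (F a b - W * munit m t a b * adj W) \<le> 40 * (real m)\<^sup>2 * \<eta>" if ab: "a < m" "b < m" for a b
  proof -
    have "W * munit m t a b * adj W = (W * adj (J a)) * adj (W * adj (J b))"
      by (simp add: munit_def J_def adj_mult mult.assoc)
    also have "\<dots> = V a * adj (V b)" by (simp add: WJ ab)
    finally have "norm (F a b - W * munit m t a b * adj W) \<le> 39 * \<eta>"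
      using VF[OF ab] by (simp add: norm_minus_commute)
    also have "\<dots> \<le> 40 * (real m)\<^sup>2 * \<eta>"
      using mult_right_mono[OF mm(2) \<eta>] \<eta> by simp
    finally show ?thesis .
  qed
  show ?thesis using Wk 1 2 3 by blast
qed

text \<open>With \<open>\<eta> = 0\<close> the map \<open>W\<close> is unitary, and comparing ranks in both directions gives \<open>k = m t\<close>.\<close>

corollary exact_matrix_units:
  assumes m: "1 \<le> m" and Fk: "\<And>a b. a < m \<Longrightarrow> b < m \<Longrightarrow> F a b \<in> rect k k"
    and mult: "\<And>a b c d. a < m \<Longrightarrow> b < m \<Longrightarrow> c < m \<Longrightarrow> d < m \<Longrightarrow>
        F a b * F c d = (if b = c then F a d else 0)"
    and star: "\<And>a b. a < m \<Longrightarrow> b < m \<Longrightarrow> adj (F a b) = F b a"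
    and unit: "(\<Sum>a<m. F a a) = idm k"
  shows "\<exists>t W. k = m * t \<and> unitary_in k W \<and> (\<forall>a<m. \<forall>b<m. F a b = W * munit m t a b * adj W)"
proof -
  have "norm (F a b) \<le> 2" if ab: "a < m" "b < m" for a b
  proof -
    have p: "norm (F b b) \<le> 1"
    proof (rule ccontr)
      assume n: "\<not> norm (F b b) \<le> 1"
      have "(norm (F b b))\<^sup>2 = norm (F b b)"
        using norm_adj_mult_self[of "F b b"] star[of b b] mult[of b b b b] ab by simp
      with n show False by (simp add: power2_eq_square)
    qed
    have "(norm (F a b))\<^sup>2 \<le> 2\<^sup>2"
      using norm_adj_mult_self[of "F a b"] star[of a b] mult[of b a a b] ab p by simp
    then show ?thesis by (rule power2_le_imp_le) simp
  qed
  then obtain t W where W: "W \<in> rect k (m * t)" "adj W * W = idm (m * t)" "W * adj W = idm k"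
      "\<forall>a<m. \<forall>b<m. F a b = W * munit m t a b * adj W"
    using approximate_matrix_units[of m F k 0] assms by auto
  have "m * t \<le> k" using near_isometry_rank_le[OF W(1)] W by simp
  moreover have "k \<le> m * t" using near_isometry_rank_le[OF rect_adj[OF W(1)]] W by simp
  ultimately show ?thesis using W unfolding unitary_in_def by (intro exI[of _ t] exI[of _ W]) auto
qed

section \<open>Evaluating noncommutative polynomials\<close>

text \<open>Both evaluations of a polynomial are linear extensions of a function on words.\<close>

definition word_linear :: "(complex \<Rightarrow> 'v \<Rightarrow> 'v) \<Rightarrow> ('n list \<Rightarrow> 'v::ab_group_add) \<Rightarrow> 'n ncpoly \<Rightarrow> 'v" where
  "word_linear sc \<phi> p = (\<Sum>w\<in>Poly_Mapping.keys p. sc (Poly_Mapping.lookup p w) (\<phi> w))"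

locale scalar_mult =
  fixes sc :: "complex \<Rightarrow> 'v::ring \<Rightarrow> 'v"
  assumes sc_add: "sc (a + b) x = sc a x + sc b x"
    and sc_mult: "sc a x * sc b y = sc (a * b) (x * y)"
begin

lemma sc_zero: "sc 0 x = 0" using sc_add[of 0 0 x] by simp

lemma word_linear_superset:
  "finite S \<Longrightarrow> Poly_Mapping.keys p \<subseteq> S \<Longrightarrow> word_linear sc \<phi> p = (\<Sum>w\<in>S. sc (Poly_Mapping.lookup p w) (\<phi> w))"
  unfolding word_linear_def
  by (rule sum.mono_neutral_left) (auto simp: in_keys_iff sc_zero)

lemma word_linear_add: "word_linear sc \<phi> (p + q) = word_linear sc \<phi> p + word_linear sc \<phi> q"
proof -
  let ?S = "Poly_Mapping.keys p \<union> Poly_Mapping.keys q"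
  have "Poly_Mapping.keys (p + q) \<subseteq> ?S" by (rule keys_add)
  then show ?thesis
    by (simp add: word_linear_superset[of ?S] lookup_add sc_add sum.distrib)
qed

lemma word_linear_zero: "word_linear sc \<phi> 0 = 0" by (simp add: word_linear_def)

lemma word_linear_diff: "word_linear sc \<phi> (p - q) = word_linear sc \<phi> p - word_linear sc \<phi> q"
  using word_linear_add[of \<phi> "p - q" q] by simp

lemma word_linear_sum: "word_linear sc \<phi> (sum f S) = (\<Sum>s\<in>S. word_linear sc \<phi> (f s))"
  by (induction S rule: infinite_finite_induct) (simp_all add: word_linear_add word_linear_zero)

lemma word_linear_single: "word_linear sc \<phi> (Poly_Mapping.single w c) = sc c (\<phi> w)"
  by (simp add: word_linear_def sc_zero)

end

definition poly_mult :: "'n ncpoly \<Rightarrow> 'n ncpoly \<Rightarrow> 'n ncpoly" where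
  "poly_mult p q = (\<Sum>u\<in>Poly_Mapping.keys p. \<Sum>v\<in>Poly_Mapping.keys q.
     Poly_Mapping.single (u @ v) (Poly_Mapping.lookup p u * Poly_Mapping.lookup q v))"

definition poly_star :: "'n ncpoly \<Rightarrow> 'n ncpoly" where
  "poly_star p = (\<Sum>u\<in>Poly_Mapping.keys p. Poly_Mapping.single (rev u) (cnj (Poly_Mapping.lookup p u)))"

lemma (in scalar_mult) word_linear_mult:
  assumes "\<And>u v. \<phi> (u @ v) = \<phi> u * \<phi> v"
  shows "word_linear sc \<phi> (poly_mult p q) = word_linear sc \<phi> p * word_linear sc \<phi> q"
  unfolding poly_mult_def word_linear_sum word_linear_single
  by (simp add: word_linear_def sum_product sc_mult assms)

lemma (in scalar_mult) word_linear_star: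
  fixes \<phi> :: "'n list \<Rightarrow> 'v"
  assumes st: "st (0::'v) = 0" "\<And>x y. st (x + y) = st x + st y" "\<And>c x. st (sc c x) = sc (cnj c) (st x)"
    and "\<And>u. \<phi> (rev u) = st (\<phi> u)"
  shows "word_linear sc \<phi> (poly_star p) = st (word_linear sc \<phi> p)"
proof -
  have "st (sum f S) = (\<Sum>s\<in>S. st (f s))" for f :: "'n list \<Rightarrow> 'v" and S
    by (induction S rule: infinite_finite_induct) (simp_all add: st)
  then show ?thesis
    unfolding poly_star_def word_linear_sum word_linear_single
    by (simp add: word_linear_def st assms(4))
qed

definition rational_complex :: "complex set" where
  "rational_complex = {c. Re c \<in> \<rat> \<and> Im c \<in> \<rat>}"

lemma rational_complex_intros:
  "a \<in> rational_complex \<Longrightarrow> b \<in> rational_complex \<Longrightarrow> a + b \<in> rational_complex"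
  "a \<in> rational_complex \<Longrightarrow> b \<in> rational_complex \<Longrightarrow> a - b \<in> rational_complex"
  "a \<in> rational_complex \<Longrightarrow> b \<in> rational_complex \<Longrightarrow> a * b \<in> rational_complex"
  "a \<in> rational_complex \<Longrightarrow> cnj a \<in> rational_complex"
  "0 \<in> rational_complex" "1 \<in> rational_complex"
  by (auto simp: rational_complex_def)

lemma rational_ncpolysD: "p \<in> rational_ncpolys \<Longrightarrow> Poly_Mapping.lookup p w \<in> rational_complex"
  by (simp add: rational_ncpolys_def rational_complex_def)
lemma rational_ncpolysI: "(\<And>w. Poly_Mapping.lookup p w \<in> rational_complex) \<Longrightarrow> p \<in> rational_ncpolys"
  by (simp add: rational_ncpolys_def rational_complex_def)

lemma rational_add: "p \<in> rational_ncpolys \<Longrightarrow> q \<in> rational_ncpolys \<Longrightarrow> p + q \<in> rational_ncpolys"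
  by (intro rational_ncpolysI) (simp add: lookup_add rational_complex_intros rational_ncpolysD)
lemma rational_diff: "p \<in> rational_ncpolys \<Longrightarrow> q \<in> rational_ncpolys \<Longrightarrow> p - q \<in> rational_ncpolys"
  by (intro rational_ncpolysI) (simp add: lookup_minus rational_complex_intros rational_ncpolysD)
lemma rational_zero: "0 \<in> rational_ncpolys"
  by (intro rational_ncpolysI) (simp add: rational_complex_intros)
lemma rational_sum: "(\<And>s. s \<in> S \<Longrightarrow> f s \<in> rational_ncpolys) \<Longrightarrow> sum f S \<in> rational_ncpolys"
  by (induction S rule: infinite_finite_induct) (simp_all add: rational_zero rational_add)
lemma rational_single: "c \<in> rational_complex \<Longrightarrow> Poly_Mapping.single w c \<in> rational_ncpolys"
  by (intro rational_ncpolysI) (auto simp: lookup_single when_def rational_complex_intros)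
lemma rational_mult: "p \<in> rational_ncpolys \<Longrightarrow> q \<in> rational_ncpolys \<Longrightarrow> poly_mult p q \<in> rational_ncpolys"
  unfolding poly_mult_def by (intro rational_sum rational_single rational_complex_intros rational_ncpolysD)
lemma rational_star: "p \<in> rational_ncpolys \<Longrightarrow> poly_star p \<in> rational_ncpolys"
  unfolding poly_star_def by (intro rational_sum rational_single rational_complex_intros rational_ncpolysD)

subsection \<open>Evaluation in the C*-algebra\<close>

interpretation cstar_scalar: scalar_mult "scaleC :: complex \<Rightarrow> 'a::cstar_algebra \<Rightarrow> 'a"
  by standard (simp_all add: scaleC_add_left scaleC_mult_left scaleC_mult_right scaleC_scaleC mult.commute)

lemma eval_ncpoly_word_linear: "eval_ncpoly p x = word_linear scaleC (\<lambda>w. prod_list (map x w)) p"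
  by (simp add: eval_ncpoly_def word_linear_def)

lemmas eval_add = cstar_scalar.word_linear_add[of "\<lambda>w. prod_list (map x w)" for x, folded eval_ncpoly_word_linear]
  and eval_diff = cstar_scalar.word_linear_diff[of "\<lambda>w. prod_list (map x w)" for x, folded eval_ncpoly_word_linear]
  and eval_sum = cstar_scalar.word_linear_sum[of "\<lambda>w. prod_list (map x w)" for x, folded eval_ncpoly_word_linear]
  and eval_single = cstar_scalar.word_linear_single[of "\<lambda>w. prod_list (map x w)" for x, folded eval_ncpoly_word_linear]

lemma eval_mult: "eval_ncpoly (poly_mult p q) x = eval_ncpoly p x * eval_ncpoly q x"
  unfolding eval_ncpoly_word_linear by (rule cstar_scalar.word_linear_mult) simp

lemma star_zero [simp]: "star (0::'a::cstar_algebra) = 0"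
  using star_add[of "0::'a" 0] by simp
lemma star_one [simp]: "star (1::'a::cstar_algebra) = 1"
  using star_mult[of "star (1::'a)" 1] by (simp add: star_star)
lemma star_uminus: "star (- x) = - star (x::'a::cstar_algebra)"
  using star_add[of x "- x"] by (simp add: eq_neg_iff_add_eq_0 add.commute)
lemma star_diff: "star (x - y) = star x - star (y::'a::cstar_algebra)"
  using star_add[of x "- y"] by (simp add: star_uminus)

lemma norm_star [simp]: "norm (star x) = norm (x::'a::cstar_algebra)"
proof -
  have le: "norm y \<le> norm (star y)" for y :: 'a
  proof (cases "norm y = 0")
    case False
    have "norm y * norm y \<le> norm (star y) * norm y"
      using cstar_identity[of y] norm_mult_ineq[of "star y" y] by (simp add: power2_eq_square)
    then show ?thesis using False by simp
  qed simp
  from le[of x] le[of "star x"] show ?thesis by (simp add: star_star)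
qed

lemma star_prod_list_rev:
  assumes "\<And>i. star (x i) = (x i :: 'a::cstar_algebra)"
  shows "prod_list (map x (rev w)) = star (prod_list (map x w))"
  by (induction w) (simp_all add: star_mult assms)

lemma eval_star:
  assumes "\<And>i. star (x i) = x i"
  shows "eval_ncpoly (poly_star p) x = star (eval_ncpoly p x)"
  unfolding eval_ncpoly_word_linear
  by (rule cstar_scalar.word_linear_star) (simp_all add: star_add star_scaleC star_prod_list_rev[OF assms])

lemma tendsto_scaleC:
  assumes "(f \<longlongrightarrow> (a::'a::cstar_algebra)) F"
  shows "((\<lambda>t. c *\<^sub>C f t) \<longlongrightarrow> c *\<^sub>C a) F"
proof -
  have "norm (c *\<^sub>C f t - c *\<^sub>C a) = cmod c * norm (f t - a)" for t
    by (simp add: norm_scaleC flip: complex_vs.scale_right_diff_distrib)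
  moreover have "((\<lambda>t. cmod c * norm (f t - a)) \<longlongrightarrow> cmod c * 0) F"
    using assms by (intro tendsto_mult_left) (simp add: tendsto_norm_zero_iff LIM_zero)
  ultimately have "((\<lambda>t. norm (c *\<^sub>C f t - c *\<^sub>C a)) \<longlongrightarrow> 0) F" by simp
  then show ?thesis by (rule LIM_zero_cancel[OF tendsto_norm_zero_cancel])
qed

lemma tendsto_eval:
  assumes "\<And>i. ((\<lambda>t. y t i) \<longlongrightarrow> (x i :: 'a::cstar_algebra)) F"
  shows "((\<lambda>t. eval_ncpoly p (y t)) \<longlongrightarrow> eval_ncpoly p x) F"
proof -
  have "((\<lambda>t. prod_list (map (y t) w)) \<longlongrightarrow> prod_list (map x w)) F" for w
    by (induction w) (auto intro!: tendsto_intros assms)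
  then show ?thesis unfolding eval_ncpoly_def by (intro tendsto_sum tendsto_scaleC)
qed

lemma rational_complex_approx: "0 < e \<Longrightarrow> \<exists>r\<in>rational_complex. cmod (r - c) < e"
proof -
  assume e: "0 < e"
  obtain a where a: "a \<in> \<rat>" "Re c < a" "a < Re c + e / 2"
    using Rats_dense_in_real[of "Re c" "Re c + e / 2"] e by auto
  obtain b where b: "b \<in> \<rat>" "Im c < b" "b < Im c + e / 2"
    using Rats_dense_in_real[of "Im c" "Im c + e / 2"] e by auto
  have "cmod (Complex a b - c) < e" using cmod_le[of "Complex a b - c"] a b by simp
  then show ?thesis using a b by (intro bexI[of _ "Complex a b"]) (auto simp: rational_complex_def)
qed

lemma half_share_less: "0 < e \<Longrightarrow> 0 \<le> n \<Longrightarrow> e / (2 * (n + 1)) * n < e / 2" for e n :: real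
proof -
  assume e: "0 < e" and n: "0 \<le> n"
  have "e / 2 * (n / (n + 1)) < e / 2 * 1" using e n by (intro mult_strict_left_mono) auto
  then show ?thesis by simp
qed

text \<open>The closure of the set of values is a C*-subalgebra: it is stable under all complex scalars because
  the rational ones are dense. So it contains the algebra generated by \<open>x\<close>.\<close>

theorem rational_polynomials_dense:
  fixes x :: "'n \<Rightarrow> 'a::cstar_algebra"
  assumes sa: "\<And>i. star (x i) = x i" and gen: "generates_cstar (range x)" and e: "0 < e"
  shows "\<exists>p\<in>rational_ncpolys. norm (eval_ncpoly p x - a) < e"
proof -
  define D where "D = (\<lambda>p. eval_ncpoly p x) ` rational_ncpolys"
  have add: "a + b \<in> D" if "a \<in> D" "b \<in> D" for a b
    using that by (auto simp: D_def simp flip: eval_add intro: rational_add)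
  have mult: "a * b \<in> D" if "a \<in> D" "b \<in> D" for a b
    using that by (auto simp: D_def simp flip: eval_mult intro: rational_mult)
  have star: "star a \<in> D" if "a \<in> D" for a
    using that by (auto simp: D_def simp flip: eval_star[OF sa] intro: rational_star)
  have monom: "c *\<^sub>C prod_list (map x w) \<in> D" if "c \<in> rational_complex" for c w
    using rational_single[OF that, of w] unfolding D_def by (force simp flip: eval_single)
  have one: "1 \<in> D" using monom[of 1 "[]"] by (simp add: rational_complex_intros)
  have var: "x i \<in> D" for i using monom[of 1 "[i]"] by (simp add: rational_complex_intros)
  have scal: "c *\<^sub>C a \<in> D" if "c \<in> rational_complex" "a \<in> D" for c a
    using mult[OF monom[OF that(1), of "[]"] that(2)] by (simp add: scaleC_mult_left)
  have "unital_cstar_subalgebra (closure D)"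
    unfolding unital_cstar_subalgebra_def
  proof (intro conjI ballI allI)
    show "1 \<in> closure D" using one closure_subset by blast
    fix a b assume a: "a \<in> closure D" and b: "b \<in> closure D"
    obtain f g where f: "\<And>n. f n \<in> D" "f \<longlonglongrightarrow> a" and g: "\<And>n. g n \<in> D" "g \<longlonglongrightarrow> b"
      using a b by (auto simp: closure_sequential)
    show "a + b \<in> closure D" unfolding closure_sequential
      using f g by (intro exI[of _ "\<lambda>n. f n + g n"]) (auto intro: add tendsto_add)
    show "a * b \<in> closure D" unfolding closure_sequential
      using f g by (intro exI[of _ "\<lambda>n. f n * g n"]) (auto intro: mult tendsto_mult)
  next
    fix a assume a: "a \<in> closure D"
    then obtain f where f: "\<And>n. f n \<in> D" "f \<longlonglongrightarrow> a" by (auto simp: closure_sequential)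
    have "(\<lambda>n. star (f n)) \<longlonglongrightarrow> star a"
    proof (rule LIM_zero_cancel, rule tendsto_norm_zero_cancel)
      have "(\<lambda>n. norm (f n - a)) \<longlonglongrightarrow> 0" using f by (simp add: tendsto_norm_zero_iff LIM_zero)
      then show "(\<lambda>n. norm (star (f n) - star a)) \<longlonglongrightarrow> 0" by (simp flip: star_diff)
    qed
    then show "star a \<in> closure D" unfolding closure_sequential
      using f by (intro exI[of _ "\<lambda>n. star (f n)"]) (auto intro: star)
    fix c
    show "c *\<^sub>C a \<in> closure D"
      unfolding closure_approachable
    proof (intro allI impI)
      fix e :: real assume e: "0 < e"
      have "0 < e / (2 * (cmod c + 1))" using e by (simp add: add_nonneg_pos)
      then obtain d where d: "d \<in> D" "norm (d - a) < e / (2 * (cmod c + 1))"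
        using a unfolding closure_approachable dist_norm by blast
      have "0 < e / (2 * (norm d + 1))" using e by (simp add: add_nonneg_pos)
      then obtain r where r: "r \<in> rational_complex" "cmod (r - c) < e / (2 * (norm d + 1))"
        using rational_complex_approx by blast
      have "r *\<^sub>C d - c *\<^sub>C a = (r - c) *\<^sub>C d + c *\<^sub>C (d - a)"
        by (simp add: complex_vs.scale_right_diff_distrib complex_vs.scale_left_diff_distrib)
      then have "norm (r *\<^sub>C d - c *\<^sub>C a) \<le> cmod (r - c) * norm d + cmod c * norm (d - a)"
        by (metis norm_scaleC norm_triangle_ineq)
      also have "cmod (r - c) * norm d \<le> e / (2 * (norm d + 1)) * norm d"
        using r by (intro mult_right_mono) auto
      also have "\<dots> < e / 2" by (rule half_share_less[OF e norm_ge_zero])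
      also have "cmod c * norm (d - a) \<le> cmod c * (e / (2 * (cmod c + 1)))"
        using d by (intro mult_left_mono) auto
      also have "\<dots> \<le> e / 2" using half_share_less[OF e norm_ge_zero[of c]] by (simp add: mult.commute)
      finally show "\<exists>y\<in>D. dist y (c *\<^sub>C a) < e"
        using scal[OF r(1) d(1)] by (auto simp: dist_norm)
    qed
  qed simp
  moreover have "range x \<subseteq> closure D" using var closure_subset by blast
  ultimately have "unital_cstar_subalgebra hull (range x) \<subseteq> closure D" by (intro hull_minimal)
  then have "a \<in> closure D" using gen by (auto simp: generates_cstar_def)
  then show ?thesis using e by (auto simp: closure_approachable dist_norm D_def)
qed

subsection \<open>Evaluation at matrices\<close>

interpretation matrix_scalar: scalar_mult cs
  by standard (simp_all add: cs_add_left cs_mult_left cs_mult_right mult.commute)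

definition word_at :: "nat \<Rightarrow> ('n \<Rightarrow> fmat) \<Rightarrow> 'n list \<Rightarrow> fmat" where
  "word_at k F w = foldr (\<lambda>i M. F i * M) w (idm k)"

definition eval_at :: "nat \<Rightarrow> 'n ncpoly \<Rightarrow> ('n \<Rightarrow> fmat) \<Rightarrow> fmat" where
  "eval_at k p F = word_linear cs (word_at k F) p"

lemma word_at_simps [simp]: "word_at k F [] = idm k" "word_at k F (i # w) = F i * word_at k F w"
  by (simp_all add: word_at_def)

lemma word_at_rect: "(\<And>i. F i \<in> rect k k) \<Longrightarrow> word_at k F w \<in> rect k k"
  by (induction w) (auto intro: rect_times)

lemma word_at_append: "(\<And>i. F i \<in> rect k k) \<Longrightarrow> word_at k F (u @ v) = word_at k F u * word_at k F v"
  by (induction u) (simp_all add: idm_mult[OF word_at_rect] mult.assoc)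

lemma emb_eval_ncpoly_mat:
  assumes A: "\<And>i. A i \<in> carrier_mat k k"
  shows "emb (eval_ncpoly_mat k p A) = eval_at k p (\<lambda>i. emb (A i))"
proof -
  have W: "word_mat k A w \<in> carrier_mat k k \<and> emb (word_mat k A w) = word_at k (\<lambda>i. emb (A i)) w" for w
    by (induction w) (auto simp: word_mat_def emb_mult[OF A] intro!: mult_carrier_mat A)
  have d: "dim_row (word_mat k A w) = k" "dim_col (word_mat k A w) = k" for w using W by auto
  show ?thesis
    unfolding eval_at_def word_linear_def W[THEN conjunct2, symmetric]
    by (intro fmat_eqI) (auto simp: eval_ncpoly_mat_def d intro!: sum.neutral)
qed

lemma eval_at_rect: "(\<And>i. F i \<in> rect k k) \<Longrightarrow> eval_at k p F \<in> rect k k"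
  unfolding eval_at_def word_linear_def by (intro rect_sum rect_cs word_at_rect)

lemmas eval_at_diff = matrix_scalar.word_linear_diff[of "word_at k F" for k F, folded eval_at_def]
  and eval_at_sum = matrix_scalar.word_linear_sum[of "word_at k F" for k F, folded eval_at_def]
  and eval_at_single = matrix_scalar.word_linear_single[of "word_at k F" for k F, folded eval_at_def]

lemma eval_at_mult:
  "(\<And>i. F i \<in> rect k k) \<Longrightarrow> eval_at k (poly_mult p q) F = eval_at k p F * eval_at k q F"
  unfolding eval_at_def by (rule matrix_scalar.word_linear_mult) (rule word_at_append)

lemma word_at_rev:
  assumes F: "\<And>i. F i \<in> rect k k" "\<And>i. adj (F i) = F i"
  shows "word_at k F (rev w) = adj (word_at k F w)"
  by (induction w) (simp_all add: word_at_append[OF F(1)] adj_mult F mult_idm[OF F(1)])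

lemma eval_at_star:
  assumes F: "\<And>i. F i \<in> rect k k" "\<And>i. adj (F i) = F i"
  shows "eval_at k (poly_star p) F = adj (eval_at k p F)"
  unfolding eval_at_def
  by (rule matrix_scalar.word_linear_star) (simp_all add: adj_add adj_cs word_at_rev[OF F])

lemma eval_at_conjugate:
  assumes U: "unitary_in k U" and F: "\<And>i. F i \<in> rect k k"
  shows "eval_at k p (\<lambda>i. U * F i * adj U) = U * eval_at k p F * adj U"
proof -
  have Uk: "U \<in> rect k k" and U': "adj U * U = idm k" "U * adj U = idm k" using U by (auto simp: unitary_in_def)
  have "word_at k (\<lambda>i. U * F i * adj U) w = U * word_at k F w * adj U" for w
  proof (induction w)
    case Nil
    then show ?case using mult_idm[OF Uk] by (simp add: U')
  next
    case (Cons i w)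
    have "word_at k (\<lambda>i. U * F i * adj U) (i # w) = U * F i * (adj U * U) * word_at k F w * adj U"
      using Cons by (simp add: mult.assoc)
    then show ?case by (simp add: U' mult.assoc idm_mult[OF word_at_rect[OF F]])
  qed
  then show ?thesis
    by (simp add: eval_at_def word_linear_def sum_distrib_left sum_distrib_right cs_mult_left cs_mult_right)
qed

lemma norm_conjugate_le: "unitary_in k U \<Longrightarrow> norm (U * A * adj U) \<le> norm A"
  using norm_mult_le[OF norm_mult_le[of U 1 A "norm A"], of "adj U" 1] norm_unitary_le[of k U]
  by simp

lemma norm_conjugate:
  assumes U: "unitary_in k U" and A: "A \<in> rect k k"
  shows "norm (U * A * adj U) = norm A"
proof -
  have U': "adj U * U = idm k" and Ua: "unitary_in k (adj U)" using U by (auto simp: unitary_in_def intro: rect_adj)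
  have "adj U * (U * A * adj U) * adj (adj U) = (adj U * U) * A * (adj U * U)" by (simp add: mult.assoc)
  also have "\<dots> = A" by (simp add: U' idm_mult[OF A] mult_idm[OF A])
  finally have "norm A \<le> norm (U * A * adj U)" using norm_conjugate_le[OF Ua] by metis
  then show ?thesis using norm_conjugate_le[OF U, of A] by simp
qed

text \<open>The constant depends on \<open>p\<close> and \<open>M\<close> only, neither on the size of the matrices nor on \<open>X\<close>.\<close>

lemma commutator_eval_le:
  fixes p :: "'n ncpoly"
  assumes M: "0 \<le> M"
  shows "\<exists>L\<ge>0. \<forall>k F X \<delta>. (\<forall>i. F i \<in> rect k k \<and> norm (F i) \<le> M \<and> norm (X * F i - F i * X) \<le> \<delta>) \<longrightarrow> X \<in> rect k k
    \<longrightarrow> 0 \<le> \<delta> \<longrightarrow> norm (X * eval_at k p F - eval_at k p F * X) \<le> L * \<delta>"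
proof -
  define L where "L w = real (length w) * (M + 1) ^ length w" for w :: "'n list"
  have word: "norm (X * word_at k F w - word_at k F w * X) \<le> L w * \<delta> \<and> norm (word_at k F w) \<le> (M + 1) ^ length w"
    if F: "\<And>i. F i \<in> rect k k" "\<And>i. norm (F i) \<le> M" "\<And>i. norm (X * F i - F i * X) \<le> \<delta>"
      and X: "X \<in> rect k k" and \<delta>: "0 \<le> \<delta>" for k F X \<delta> and w :: "'n list"
  proof (induction w)
    case Nil
    then show ?case using idm_mult[OF X] mult_idm[OF X] norm_idm_le by (simp add: L_def)
  next
    case (Cons i w)
    have n: "norm (word_at k F (i # w)) \<le> (M + 1) * (M + 1) ^ length w"
      using norm_mult_le[of "F i" "M + 1" "word_at k F w"] F(2)[of i] Cons by fastforce
    have "X * word_at k F (i # w) - word_at k F (i # w) * X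
      = (X * F i - F i * X) * word_at k F w + F i * (X * word_at k F w - word_at k F w * X)"
      by (simp add: algebra_simps)
    also have "norm \<dots> \<le> \<delta> * (M + 1) ^ length w + M * (L w * \<delta>)"
      using Cons by (intro norm_triangle_le add_mono norm_mult_le F) auto
    also have "\<dots> \<le> L (i # w) * \<delta>"
    proof -
      have "\<delta> * (M + 1) ^ length w \<le> \<delta> * (M + 1) ^ Suc (length w)"
        using M \<delta> by (intro mult_left_mono power_increasing) auto
      moreover have "M * (L w * \<delta>) \<le> (M + 1) * (L w * \<delta>)"
        using M \<delta> by (intro mult_right_mono) (auto simp: L_def)
      moreover have "L (i # w) * \<delta> = \<delta> * (M + 1) ^ Suc (length w) + (M + 1) * (L w * \<delta>)"
        by (simp add: L_def algebra_simps)
      ultimately show ?thesis by linarith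
    qed
    finally show ?case using n by simp
  qed
  define C where "C = (\<Sum>w\<in>Poly_Mapping.keys p. cmod (Poly_Mapping.lookup p w) * L w)"
  have "norm (X * eval_at k p F - eval_at k p F * X) \<le> C * \<delta>"
    if F: "\<And>i. F i \<in> rect k k" "\<And>i. norm (F i) \<le> M" "\<And>i. norm (X * F i - F i * X) \<le> \<delta>"
      and X: "X \<in> rect k k" and \<delta>: "0 \<le> \<delta>" for k F X \<delta>
  proof -
    have "X * eval_at k p F - eval_at k p F * X = (\<Sum>w\<in>Poly_Mapping.keys p.
        cs (Poly_Mapping.lookup p w) (X * word_at k F w - word_at k F w * X))"
      by (simp add: eval_at_def word_linear_def sum_distrib_left sum_distrib_right cs_mult_left cs_mult_right
          cs_diff_right sum_subtractf)
    also have "norm \<dots> \<le> (\<Sum>w\<in>Poly_Mapping.keys p. cmod (Poly_Mapping.lookup p w) * (L w * \<delta>))"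
      unfolding norm_cs[symmetric]
      by (rule sum_norm_le) (use word[OF F X \<delta>] in \<open>auto simp: norm_cs intro: mult_left_mono\<close>)
    finally show ?thesis by (simp add: C_def sum_distrib_right mult.assoc)
  qed
  moreover have "0 \<le> C" unfolding C_def L_def using M by (intro sum_nonneg) auto
  ultimately show ?thesis by (intro exI[of _ C]) auto
qed

section \<open>Matrix subalgebras of a C*-algebra\<close>

definition mat_iso :: "'a::cstar_algebra set \<Rightarrow> nat \<Rightarrow> ('a \<Rightarrow> fmat) \<Rightarrow> bool" where
  "mat_iso B k \<psi> \<longleftrightarrow> bij_betw \<psi> B (rect k k) \<and>
     (\<forall>x\<in>B. \<forall>y\<in>B. \<psi> (x + y) = \<psi> x + \<psi> y) \<and>
     (\<forall>x\<in>B. \<forall>y\<in>B. \<psi> (x * y) = \<psi> x * \<psi> y) \<and>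
     (\<forall>c. \<forall>x\<in>B. \<psi> (c *\<^sub>C x) = cs c (\<psi> x)) \<and>
     (\<forall>x\<in>B. \<psi> (star x) = adj (\<psi> x))"

lemma star_isomorphic_mat_iso: "star_isomorphic_mat B k \<Longrightarrow> \<exists>\<psi>. mat_iso B k \<psi>"
proof -
  assume "star_isomorphic_mat B k"
  then obtain \<phi> where \<phi>: "bij_betw \<phi> B (carrier_mat k k)"
     "\<And>x y. x \<in> B \<Longrightarrow> y \<in> B \<Longrightarrow> \<phi> (x + y) = \<phi> x + \<phi> y" "\<And>x y. x \<in> B \<Longrightarrow> y \<in> B \<Longrightarrow> \<phi> (x * y) = \<phi> x * \<phi> y"
     "\<And>c x. x \<in> B \<Longrightarrow> \<phi> (c *\<^sub>C x) = c \<cdot>\<^sub>m \<phi> x" "\<And>x. x \<in> B \<Longrightarrow> \<phi> (star x) = mat_adjoint (\<phi> x)"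
    unfolding star_isomorphic_mat_def by blast
  have C: "\<phi> x \<in> carrier_mat k k" if "x \<in> B" for x using bij_betwE[OF \<phi>(1)] that by blast
  have "bij_betw emb (carrier_mat k k) (rect k k)"
    by (rule bij_betw_byWitness[where f' = "tomat k"]) (auto intro: emb_rect)
  from bij_betw_trans[OF \<phi>(1) this] have "bij_betw (\<lambda>x. emb (\<phi> x)) B (rect k k)" by (simp add: comp_def)
  then have "mat_iso B k (\<lambda>x. emb (\<phi> x))"
    unfolding mat_iso_def
    by (auto simp: \<phi> emb_smult emb_adjoint emb_add[OF C C] emb_mult[OF C C])
  then show ?thesis by blast
qed

text \<open>Iterated squares replace powers, because the ring of finitely supported matrices has no unit and
  no powers; they are compared with each other in the proof that matrix isomorphisms are isometric.\<close>

lemma norm_iterated_square: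
  fixes h :: "'a::cstar_algebra"
  shows "star h = h \<Longrightarrow> norm (((\<lambda>h. h * h) ^^ n) h) = norm h ^ (2 ^ n)"
proof (induction n arbitrary: h)
  case (Suc n)
  have "norm (h * h) = (norm h)\<^sup>2" using cstar_identity[of h] Suc.prems by simp
  moreover have "norm (((\<lambda>h. h * h) ^^ n) (h * h)) = norm (h * h) ^ (2 ^ n)"
    using Suc.prems by (intro Suc.IH) (simp add: star_mult)
  ultimately show ?case by (simp only: funpow_Suc_right o_apply power_mult power_Suc)
qed simp

lemma norm_iterated_square_fmat:
  shows "adj h = h \<Longrightarrow> norm (((\<lambda>h. h * h) ^^ n) h) = norm h ^ (2 ^ n)"
proof (induction n arbitrary: h)
  case (Suc n)
  have "norm (h * h) = (norm h)\<^sup>2" using norm_adj_mult_self[of h] Suc.prems by simp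
  moreover have "norm (((\<lambda>h. h * h) ^^ n) (h * h)) = norm (h * h) ^ (2 ^ n)"
    using Suc.prems by (intro Suc.IH) (simp add: adj_mult)
  ultimately show ?case by (simp only: funpow_Suc_right o_apply power_mult power_Suc)
qed simp

locale matrix_subalgebra =
  fixes B :: "'a::cstar_algebra set" and k :: nat and \<psi> :: "'a \<Rightarrow> fmat"
  assumes sub: "unital_cstar_subalgebra B" and iso: "mat_iso B k \<psi>" and k_pos: "1 \<le> k"
begin

lemma one_in: "1 \<in> B" and add_in: "x \<in> B \<Longrightarrow> y \<in> B \<Longrightarrow> x + y \<in> B"
  and mult_in: "x \<in> B \<Longrightarrow> y \<in> B \<Longrightarrow> x * y \<in> B" and scale_in: "x \<in> B \<Longrightarrow> c *\<^sub>C x \<in> B"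
  and star_in: "x \<in> B \<Longrightarrow> star x \<in> B"
  using sub unfolding unital_cstar_subalgebra_def by blast+

lemma zero_in: "0 \<in> B" using scale_in[OF one_in, of 0] by simp
lemma diff_in: "x \<in> B \<Longrightarrow> y \<in> B \<Longrightarrow> x - y \<in> B"
  using add_in[OF _ scale_in[of y "-1"], of x] by simp
lemma sum_in: "(\<And>s. s \<in> S \<Longrightarrow> f s \<in> B) \<Longrightarrow> sum f S \<in> B"
  by (induction S rule: infinite_finite_induct) (simp_all add: zero_in add_in)
lemma prod_list_in: "(\<And>i. y i \<in> B) \<Longrightarrow> prod_list (map y w) \<in> B"
  by (induction w) (simp_all add: one_in mult_in)
lemma eval_in: "(\<And>i. y i \<in> B) \<Longrightarrow> eval_ncpoly p y \<in> B"
  unfolding eval_ncpoly_def by (intro sum_in scale_in prod_list_in)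

lemma \<psi>_add: "x \<in> B \<Longrightarrow> y \<in> B \<Longrightarrow> \<psi> (x + y) = \<psi> x + \<psi> y"
  and \<psi>_mult: "x \<in> B \<Longrightarrow> y \<in> B \<Longrightarrow> \<psi> (x * y) = \<psi> x * \<psi> y"
  and \<psi>_scale: "x \<in> B \<Longrightarrow> \<psi> (c *\<^sub>C x) = cs c (\<psi> x)"
  and \<psi>_star: "x \<in> B \<Longrightarrow> \<psi> (star x) = adj (\<psi> x)"
  and \<psi>_bij: "bij_betw \<psi> B (rect k k)"
  using iso unfolding mat_iso_def by auto

lemma \<psi>_rect: "x \<in> B \<Longrightarrow> \<psi> x \<in> rect k k" using bij_betwE[OF \<psi>_bij] by blast
lemma \<psi>_inj: "x \<in> B \<Longrightarrow> y \<in> B \<Longrightarrow> \<psi> x = \<psi> y \<Longrightarrow> x = y"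
  using bij_betw_imp_inj_on[OF \<psi>_bij] by (auto dest: inj_onD)
lemma \<psi>_surj: "A \<in> rect k k \<Longrightarrow> \<exists>x\<in>B. \<psi> x = A"
  using \<psi>_bij unfolding bij_betw_def by (metis imageE)
lemma \<psi>_zero: "\<psi> 0 = 0" using \<psi>_scale[OF one_in, of 0] by simp
lemma \<psi>_diff: "x \<in> B \<Longrightarrow> y \<in> B \<Longrightarrow> \<psi> (x - y) = \<psi> x - \<psi> y"
  using \<psi>_add[OF diff_in, of x y y] by simp
lemma \<psi>_sum: "(\<And>s. s \<in> S \<Longrightarrow> f s \<in> B) \<Longrightarrow> \<psi> (sum f S) = (\<Sum>s\<in>S. \<psi> (f s))"
  by (induction S rule: infinite_finite_induct) (simp_all add: \<psi>_zero \<psi>_add sum_in)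
lemma \<psi>_one: "\<psi> 1 = idm k"
proof -
  obtain u where u: "u \<in> B" "\<psi> u = idm k" using \<psi>_surj[OF rect_idm] by blast
  have "\<psi> 1 = \<psi> 1 * \<psi> u" using mult_idm[OF \<psi>_rect[OF one_in]] by (simp add: u)
  also have "\<dots> = idm k" using \<psi>_mult[OF one_in u(1)] u by simp
  finally show ?thesis .
qed

lemma \<psi>_eval:
  assumes y: "\<And>i. y i \<in> B"
  shows "\<psi> (eval_ncpoly p y) = eval_at k p (\<lambda>i. \<psi> (y i))"
proof -
  have "\<psi> (prod_list (map y w)) = word_at k (\<lambda>i. \<psi> (y i)) w" for w
    by (induction w) (simp_all add: \<psi>_one \<psi>_mult y prod_list_in)
  then show ?thesis
    by (simp add: eval_ncpoly_def eval_at_def word_linear_def \<psi>_sum scale_in prod_list_in y \<psi>_scale)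
qed

definition e :: "nat \<Rightarrow> nat \<Rightarrow> 'a" where "e a b = the_inv_into B \<psi> (eu a b)"

lemma e_in: "a < k \<Longrightarrow> b < k \<Longrightarrow> e a b \<in> B" and \<psi>_e: "a < k \<Longrightarrow> b < k \<Longrightarrow> \<psi> (e a b) = eu a b"
proof -
  assume "a < k" "b < k"
  then have "eu a b \<in> \<psi> ` B" using \<psi>_bij rect_eu by (auto simp: bij_betw_def)
  then show "e a b \<in> B" "\<psi> (e a b) = eu a b"
    using bij_betw_imp_inj_on[OF \<psi>_bij] by (auto simp: e_def the_inv_into_f_f)
qed

lemma e_mult: "a < k \<Longrightarrow> b < k \<Longrightarrow> c < k \<Longrightarrow> d < k \<Longrightarrow> e a b * e c d = (if b = c then e a d else 0)"
  by (rule \<psi>_inj) (auto simp: mult_in e_in zero_in \<psi>_mult \<psi>_e eu_mult \<psi>_zero)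
lemma e_star: "a < k \<Longrightarrow> b < k \<Longrightarrow> star (e a b) = e b a"
  by (rule \<psi>_inj) (auto simp: star_in e_in \<psi>_star \<psi>_e)
lemma sum_eu: "(\<Sum>a<k. eu a a) = idm k"
  by (rule fmat_eqI) (auto simp: if_distrib[of "\<lambda>x. x = _"] intro!: sum.neutral)
lemma e_sum: "(\<Sum>a<k. e a a) = 1"
proof (rule \<psi>_inj)
  show "(\<Sum>a<k. e a a) \<in> B" by (intro sum_in e_in) auto
  have "\<psi> (\<Sum>a<k. e a a) = (\<Sum>a<k. \<psi> (e a a))" by (intro \<psi>_sum e_in) auto
  then show "\<psi> (\<Sum>a<k. e a a) = \<psi> 1" by (simp add: \<psi>_e sum_eu \<psi>_one)
qed (rule one_in)

lemma matrix_expansion: "A \<in> rect k k \<Longrightarrow> A = (\<Sum>a<k. \<Sum>b<k. cs (ent A a b) (eu a b))"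
proof (rule fmat_eqI)
  fix i j assume A: "A \<in> rect k k"
  have "ent (\<Sum>a<k. \<Sum>b<k. cs (ent A a b) (eu a b)) i j = (\<Sum>a<k. if a = i then (\<Sum>b<k. if b = j then ent A i j else 0) else 0)"
    unfolding ent_sum
  proof (intro sum.cong refl)
    fix a
    show "(\<Sum>b<k. ent (cs (ent A a b) (eu a b)) i j) = (if a = i then (\<Sum>b<k. if b = j then ent A i j else 0) else 0)"
    proof (cases "a = i")
      case True
      then show ?thesis unfolding True by (simp only: if_True) (rule sum.cong, auto)
    qed simp
  qed
  also have "\<dots> = ent A i j" using rectD[OF A, of i j] by (auto simp: not_less)
  finally show "ent A i j = ent (\<Sum>a<k. \<Sum>b<k. cs (ent A a b) (eu a b)) i j" ..
qed

lemma combination_in: "(\<Sum>a<k. \<Sum>b<k. c a b *\<^sub>C e a b) \<in> B"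
  by (intro sum_in scale_in e_in) auto

lemma \<psi>_combination: "\<psi> (\<Sum>a<k. \<Sum>b<k. c a b *\<^sub>C e a b) = (\<Sum>a<k. \<Sum>b<k. cs (c a b) (eu a b))"
proof -
  have "\<psi> (\<Sum>a<k. \<Sum>b<k. c a b *\<^sub>C e a b) = (\<Sum>a<k. \<psi> (\<Sum>b<k. c a b *\<^sub>C e a b))"
    by (intro \<psi>_sum sum_in scale_in e_in) auto
  also have "\<dots> = (\<Sum>a<k. \<Sum>b<k. \<psi> (c a b *\<^sub>C e a b))"
    by (intro sum.cong refl \<psi>_sum scale_in e_in) auto
  also have "\<dots> = (\<Sum>a<k. \<Sum>b<k. cs (c a b) (eu a b))"
    by (intro sum.cong refl) (simp add: \<psi>_scale e_in \<psi>_e)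
  finally show ?thesis .
qed

lemma expansion: "b \<in> B \<Longrightarrow> b = (\<Sum>a<k. \<Sum>c<k. ent (\<psi> b) a c *\<^sub>C e a c)"
  by (rule \<psi>_inj) (simp_all add: combination_in \<psi>_combination flip: matrix_expansion[OF \<psi>_rect])

lemma norm_e: "a < k \<Longrightarrow> b < k \<Longrightarrow> norm (e a b) = 1"
proof -
  assume ab: "a < k" "b < k"
  have "e b b \<noteq> 0"
  proof
    assume "e b b = 0"
    then have "eu b b = 0" using \<psi>_e[OF ab(2,2)] by (simp add: \<psi>_zero)
    then have "ent (eu b b) b b = 0" by simp
    then show False unfolding ent_eu by simp
  qed
  moreover have "(norm (e b b))\<^sup>2 = norm (e b b)"
    using cstar_identity[of "e b b"] ab by (simp add: e_star e_mult)
  ultimately have "norm (e b b) = 1" by (simp add: power2_eq_square)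
  then have "(norm (e a b))\<^sup>2 = 1" using cstar_identity[of "e a b"] ab by (simp add: e_star e_mult)
  then show ?thesis by (simp add: power2_eq_1_iff) (metis norm_ge_zero not_one_le_zero le_minus_iff neg_0_le_iff_le zero_le_one order_trans)
qed

lemma norm_le_\<psi>: "b \<in> B \<Longrightarrow> norm b \<le> (real k)\<^sup>2 * norm (\<psi> b)"
proof -
  assume b: "b \<in> B"
  have "norm b \<le> (\<Sum>a<k. \<Sum>c<k. norm (\<psi> b))"
    by (subst expansion[OF b])
      (intro sum_norm_le, auto simp: norm_scaleC norm_e cmod_ent_le)
  then show ?thesis by (simp add: power2_eq_square)
qed

lemma norm_\<psi>_le: "b \<in> B \<Longrightarrow> norm (\<psi> b) \<le> (real k)\<^sup>2 * norm b"
proof -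
  assume b: "b \<in> B"
  have "cmod (ent (\<psi> b) a c) \<le> norm b" if ac: "a < k" "c < k" for a c
  proof -
    have "ent (\<psi> b) a c *\<^sub>C e a c = e a a * b * e c c"
      using ac b
      by (intro \<psi>_inj) (auto simp: scale_in mult_in e_in \<psi>_scale \<psi>_mult \<psi>_e ent_eu_times ent_times_eu intro!: fmat_eqI)
    then have "cmod (ent (\<psi> b) a c) = norm (e a a * b * e c c)" using ac by (metis mult.right_neutral norm_e norm_scaleC)
    also have "\<dots> \<le> 1 * norm b * 1" by (intro norm_mult_le) (simp_all add: norm_e ac)
    finally show ?thesis by simp
  qed
  then have "norm (\<psi> b) \<le> (\<Sum>a<k. \<Sum>c<k. norm b)"
    using norm_le_sum[OF \<psi>_rect[OF b]] by (meson lessThan_iff order.trans sum_mono)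
  then show ?thesis by (simp add: power2_eq_square)
qed

text \<open>A priori \<open>\<psi>\<close> and its inverse are bounded by \<open>k\<^sup>2\<close>, as the expansion in matrix units shows. Applied to
  the iterated squares of a self-adjoint \<open>h\<close>, whose norms are the \<open>2 ^ n\<close>-th powers of the norm of \<open>h\<close>,
  the constant disappears in the limit. The general case is \<open>h = b\<^sup>* b\<close>.\<close>

theorem isometric:
  assumes b: "b \<in> B"
  shows "norm (\<psi> b) = norm b"
proof -
  define h where "h = star b * b"
  have h: "h \<in> B" "star h = h" using b by (simp_all add: h_def mult_in star_in star_mult star_star)
  have \<psi>h: "adj (\<psi> h) = \<psi> h" using \<psi>_star[OF h(1)] h(2) by simp
  have it: "((\<lambda>h. h * h) ^^ n) h \<in> B \<and> \<psi> (((\<lambda>h. h * h) ^^ n) h) = ((\<lambda>h. h * h) ^^ n) (\<psi> h)" for n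
    by (induction n) (auto simp: h mult_in \<psi>_mult)
  have n2: "n \<le> 2 ^ n" for n :: nat by (rule less_imp_le) simp
  have pos: "0 < norm b \<Longrightarrow> 0 < norm (\<psi> b)"
    using norm_le_\<psi>[OF b] by (metis mult_zero_right norm_ge_zero not_le order_le_less)
  have "norm h = norm (\<psi> h)"
  proof (cases "norm h = 0")
    case True
    then show ?thesis by (simp add: \<psi>_zero)
  next
    case False
    have "norm (\<psi> h) \<noteq> 0" using \<psi>_inj[OF h(1) zero_in] \<psi>_zero False by auto
    have "norm h ^ (2 ^ n) \<le> (real k)\<^sup>2 * norm (\<psi> h) ^ (2 ^ n)" for n
      using norm_le_\<psi>[of "((\<lambda>h. h * h) ^^ n) h"] it[of n]
      by (simp add: norm_iterated_square[OF h(2)] norm_iterated_square_fmat[OF \<psi>h])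
    then have "norm h \<le> norm (\<psi> h)" by (rule le_if_powers_le[OF _ n2]) (use \<open>norm (\<psi> h) \<noteq> 0\<close> in auto)
    have "norm (\<psi> h) ^ (2 ^ n) \<le> (real k)\<^sup>2 * norm h ^ (2 ^ n)" for n
      using norm_\<psi>_le[of "((\<lambda>h. h * h) ^^ n) h"] it[of n]
      by (simp add: norm_iterated_square[OF h(2)] norm_iterated_square_fmat[OF \<psi>h])
    then have "norm (\<psi> h) \<le> norm h" by (rule le_if_powers_le[OF _ n2]) (use False in auto)
    with \<open>norm h \<le> norm (\<psi> h)\<close> show ?thesis by simp
  qed
  then have "(norm (\<psi> b))\<^sup>2 = (norm b)\<^sup>2"
    using cstar_identity[of b] norm_adj_mult_self[of "\<psi> b"] b
    by (simp add: h_def \<psi>_mult \<psi>_star star_in)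
  then show ?thesis by simp
qed

end

lemma embedded_matrix_units:
  assumes "matrix_subalgebra B k \<psi>" "matrix_subalgebra B' k' \<psi>'" "B \<subseteq> B'"
  shows "\<exists>t W. k' = k * t \<and> 1 \<le> t \<and> unitary_in k' W \<and>
    (\<forall>a<k. \<forall>b<k. \<psi>' (matrix_subalgebra.e B \<psi> a b) = W * munit k t a b * adj W)"
proof -
  interpret A: matrix_subalgebra B k \<psi> by fact
  interpret A': matrix_subalgebra B' k' \<psi>' by fact
  have in': "A.e a b \<in> B'" if "a < k" "b < k" for a b using A.e_in[OF that] assms(3) by blast
  have "\<exists>t W. k' = k * t \<and> unitary_in k' W \<and> (\<forall>a<k. \<forall>b<k. \<psi>' (A.e a b) = W * munit k t a b * adj W)"
  proof (rule exact_matrix_units)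
    show "(\<Sum>a<k. \<psi>' (A.e a a)) = idm k'"
      using A'.\<psi>_sum[of "{..<k}" "\<lambda>a. A.e a a"] in' by (simp add: A.e_sum A'.\<psi>_one)
  qed (use in' A.k_pos in \<open>simp_all add: A'.\<psi>_rect A.e_star A.e_mult A'.\<psi>_zero flip: A'.\<psi>_mult A'.\<psi>_star\<close>)
  then show ?thesis using A'.k_pos by (metis mult_is_0 not_one_le_zero le_simps(3) gr0I One_nat_def)
qed

text \<open>The size \<open>k\<close> divides \<open>k'\<close>, so they agree; then the images of the matrix units of \<open>B\<close> are, up to
  conjugation, the standard matrix units and span all matrices.\<close>

lemma matrix_subalgebra_eq:
  assumes "matrix_subalgebra B k \<psi>" "matrix_subalgebra B' k' \<psi>'" "B \<subseteq> B'" "k' \<le> k"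
  shows "B' \<subseteq> B"
proof
  interpret A: matrix_subalgebra B k \<psi> by fact
  interpret A': matrix_subalgebra B' k' \<psi>' by fact
  fix b assume b: "b \<in> B'"
  obtain t W where t: "k' = k * t" "1 \<le> t" and W: "unitary_in k' W"
    and eW: "\<And>a b. a < k \<Longrightarrow> b < k \<Longrightarrow> \<psi>' (A.e a b) = W * munit k t a b * adj W"
    using embedded_matrix_units[OF assms(1-3)] by blast
  have eB': "A.e a c \<in> B'" if "a < k" "c < k" for a c using A.e_in[OF that] assms(3) by blast
  have "t = 1" using t assms(4) A.k_pos by simp
  have kk: "k' = k" using t \<open>t = 1\<close> by simp
  have g: "munit k t a c = eu a c" if "a < k" "c < k" for a c
  proof -
    have bl: "block k t s = eu 0 s" if "s < k" for s
      using that by (intro fmat_eqI) (auto simp: ent_block \<open>t = 1\<close>)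
    show ?thesis using that by (simp add: munit_def bl eu_mult)
  qed
  have Wk: "W \<in> rect k k" and W': "adj W * W = idm k" "W * adj W = idm k"
    using W by (auto simp: unitary_in_def kk)
  have b': "\<psi>' b \<in> rect k k" using A'.\<psi>_rect[OF b] by (simp add: kk)
  define M where "M = adj W * \<psi>' b * W"
  have Mk: "M \<in> rect k k" unfolding M_def by (rule rect_times[OF rect_times[OF rect_adj[OF Wk] b'] Wk])
  have "\<psi>' b = (W * adj W) * \<psi>' b * (W * adj W)" by (simp add: W' idm_mult[OF b'] mult_idm[OF b'])
  also have "\<dots> = W * M * adj W" by (simp add: M_def mult.assoc)
  also have "\<dots> = (\<Sum>a<k. \<Sum>c<k. cs (ent M a c) (\<psi>' (A.e a c)))"
    by (subst A.matrix_expansion[OF Mk])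
      (simp add: sum_distrib_left sum_distrib_right cs_mult_left cs_mult_right eW g)
  also have "\<dots> = \<psi>' (\<Sum>a<k. \<Sum>c<k. ent M a c *\<^sub>C A.e a c)"
  proof -
    have "\<psi>' (\<Sum>a<k. \<Sum>c<k. ent M a c *\<^sub>C A.e a c) = (\<Sum>a<k. \<psi>' (\<Sum>c<k. ent M a c *\<^sub>C A.e a c))"
      by (intro A'.\<psi>_sum A'.sum_in A'.scale_in eB') auto
    also have "\<dots> = (\<Sum>a<k. \<Sum>c<k. \<psi>' (ent M a c *\<^sub>C A.e a c))"
      by (intro sum.cong refl A'.\<psi>_sum A'.scale_in eB') auto
    finally show ?thesis by (simp add: A'.\<psi>_scale eB')
  qed
  finally have "b = (\<Sum>a<k. \<Sum>c<k. ent M a c *\<^sub>C A.e a c)"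
    using b A.combination_in assms(3) by (intro A'.\<psi>_inj) blast+
  also have "\<dots> \<in> B" by (rule A.combination_in)
  finally show "b \<in> B" .
qed

text \<open>The sizes are unbounded: otherwise the chain would be stationary from a member of maximal size on,
  and this member, being closed, would be the whole algebra, which is infinite dimensional.\<close>

theorem uhf_matrix_subalgebras:
  assumes "uhf_algebra TYPE('a::cstar_algebra)"
  shows "\<exists>(B :: nat \<Rightarrow> 'a set) k \<psi>. incseq B \<and> (\<forall>m. matrix_subalgebra (B m) (k m) (\<psi> m))
    \<and> closure (\<Union>m. B m) = UNIV \<and> (\<forall>N m. \<exists>m'\<ge>m. N \<le> k m')"
proof -
  obtain B :: "nat \<Rightarrow> 'a set" where B: "incseq B" "closure (\<Union>m. B m) = UNIV"
    and Bm: "\<forall>m. unital_cstar_subalgebra (B m) \<and> (\<exists>k\<ge>1. star_isomorphic_mat (B m) k)"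
    and inf: "\<not> (\<exists>S :: 'a set. finite S \<and> complex_vs.span S = UNIV)"
    using assms unfolding uhf_algebra_def by blast
  have "\<forall>m. \<exists>k \<psi>. matrix_subalgebra (B m) k \<psi>"
    using Bm star_isomorphic_mat_iso unfolding matrix_subalgebra_def by metis
  then obtain k \<psi> where A: "\<And>m. matrix_subalgebra (B m) (k m) (\<psi> m)" by metis
  have mono: "k m \<le> k m'" if "m \<le> m'" for m m'
  proof -
    have "B m \<subseteq> B m'" using B(1) that by (auto simp: incseq_def)
    from embedded_matrix_units[OF A A this] show ?thesis by auto
  qed
  have unb: "\<exists>m. N \<le> k m" for N
  proof (rule ccontr)
    assume "\<not> (\<exists>m. N \<le> k m)"
    then have "\<forall>m. k m < N" by (auto simp: not_le)
    then obtain m where m: "\<And>m'. k m' \<le> k m"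
      using ex_has_greatest_nat[of "\<lambda>_. True" 0 k N] by auto
    have "B m' \<subseteq> B m" for m'
    proof -
      let ?n = "max m m'"
      have "B m \<subseteq> B ?n" "B m' \<subseteq> B ?n" using B(1) by (auto simp: incseq_def)
      then show ?thesis using matrix_subalgebra_eq[OF A[of m] A[of ?n] _ m] by blast
    qed
    then have "(\<Union>m. B m) = B m" by blast
    then have U: "B m = UNIV" using B(2) Bm by (metis closure_closed unital_cstar_subalgebra_def)
    interpret A: matrix_subalgebra "B m" "k m" "\<psi> m" by (rule A)
    let ?S = "(\<lambda>(a, b). A.e a b) ` ({..<k m} \<times> {..<k m})"
    have "b \<in> complex_vs.span ?S" for b
    proof -
      have bB: "b \<in> B m" by (simp add: U)
      have "(\<Sum>a<k m. \<Sum>c<k m. ent (\<psi> m b) a c *\<^sub>C A.e a c) \<in> complex_vs.span ?S"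
        by (intro complex_vs.span_sum complex_vs.span_scale complex_vs.span_base) auto
      then show ?thesis using A.expansion[OF bB] by simp
    qed
    then have "complex_vs.span ?S = UNIV" by blast
    then have "\<exists>S :: 'a set. finite S \<and> complex_vs.span S = UNIV" by (intro exI[of _ ?S] conjI) simp_all
    with inf show False by (rule notE)
  qed
  have "\<exists>m'\<ge>m. N \<le> k m'" for N m
  proof -
    obtain m0 where "N \<le> k m0" using unb by blast
    then have "N \<le> k (max m m0)" using mono[of m0 "max m m0"] by simp
    then show ?thesis by (intro exI[of _ "max m m0"]) simp
  qed
  with A B show ?thesis by blast
qed

section \<open>The upper bound\<close>

lemma Gamma_topD:
  assumes "A \<in> Gamma_top P x R k \<epsilon> r"
  shows "A i \<in> carrier_mat k k" "emb (A i) \<in> rect k k" "adj (emb (A i)) = emb (A i)" "norm (emb (A i)) \<le> R"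
    and "j \<in> {1..r} \<Longrightarrow> \<bar>norm (eval_at k (P j) (\<lambda>i. emb (A i))) - norm (eval_ncpoly (P j) x)\<bar> \<le> \<epsilon>"
proof -
  have A: "A i \<in> carrier_mat k k" for i using assms by (auto simp: Gamma_top_def sa_mats_def)
  then show "A i \<in> carrier_mat k k" "emb (A i) \<in> rect k k" by (auto intro: emb_rect)
  have "mat_adjoint (A i) = A i" using assms by (auto simp: Gamma_top_def sa_mats_def)
  then show "adj (emb (A i)) = emb (A i)" by (simp flip: emb_adjoint)
  show "norm (emb (A i)) \<le> R" using assms by (auto simp: Gamma_top_def norm_emb)
  show "\<bar>norm (eval_at k (P j) (\<lambda>i. emb (A i))) - norm (eval_ncpoly (P j) x)\<bar> \<le> \<epsilon>" if "j \<in> {1..r}"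
    using assms that by (simp add: Gamma_top_def norm_emb flip: emb_eval_ncpoly_mat[OF A])
qed

lemma finite_polys_enumerated:
  assumes "P ` {1..} = rational_ncpolys" "finite Q" "Q \<subseteq> rational_ncpolys"
  shows "\<exists>r\<ge>1. Q \<subseteq> P ` {1..r::nat}"
  using assms(2,3)
proof (induction Q)
  case empty
  then show ?case by auto
next
  case (insert q Q)
  then obtain r where r: "1 \<le> r" "Q \<subseteq> P ` {1..r}" by auto
  obtain j where j: "1 \<le> j" "q = P j" using insert.prems assms(1) by (metis atLeast_iff imageE insert_subset)
  have "P ` {1..r} \<subseteq> P ` {1..max r j}" "P j \<in> P ` {1..max r j}" using j by auto
  then show ?case using r j by (intro exI[of _ "max r j"]) auto
qed

text \<open>The matrix \<open>c\<close> of size \<open>m\<close> with every entry repeated along a diagonal of length \<open>t\<close>, that is,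
  \<open>c\<close> tensored with the unit of size \<open>t\<close>.\<close>

definition model :: "nat \<Rightarrow> nat \<Rightarrow> (nat \<Rightarrow> nat \<Rightarrow> complex) \<Rightarrow> fmat" where
  "model m t c = (\<Sum>a<m. \<Sum>b<m. cs (c a b) (munit m t a b))"

lemma model_rect: "model m t c \<in> rect (m * t) (m * t)"
  unfolding model_def munit_def
  by (intro rect_sum rect_cs) (rule rect_times[OF rect_adj[OF block_rect] block_rect])

lemma rational_combination_approx:
  assumes "\<And>l. matrix_subalgebra (B l) (k l) (\<psi> l)" "incseq B" "closure (\<Union>l. B l) = UNIV" "0 < \<delta>"
  shows "\<exists>l c. \<forall>i::'n::finite. (\<forall>a b. c i a b \<in> rational_complex) \<and>
    norm (x i - (\<Sum>a<k l. \<Sum>b<k l. c i a b *\<^sub>C matrix_subalgebra.e (B l) (\<psi> l) a b)) < (\<delta>::real)"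
proof -
  have "\<exists>y\<in>(\<Union>l. B l). norm (y - x i) < \<delta> / 2" for i
  proof -
    have "x i \<in> closure (\<Union>l. B l)" using assms(3) by simp
    then show ?thesis unfolding closure_approachable dist_norm using half_gt_zero[OF assms(4)] by blast
  qed
  then have "\<forall>i. \<exists>l y. y \<in> B l \<and> norm (y - x i) < \<delta> / 2" by (meson UN_E)
  then obtain l y where ly: "\<And>i. y i \<in> B (l i)" "\<And>i. norm (y i - x i) < \<delta> / 2" by metis
  define l0 where "l0 = Max (range l)"
  have "l i \<le> l0" for i unfolding l0_def by (rule Max_ge) auto
  then have y: "y i \<in> B l0" for i using ly(1)[of i] assms(2) by (auto simp: incseq_def)
  interpret A: matrix_subalgebra "B l0" "k l0" "\<psi> l0" by (rule assms(1))
  define m where "m = k l0"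
  define \<tau> where "\<tau> = \<delta> / (2 * (real m)\<^sup>2)"
  have m: "1 \<le> m" using A.k_pos by (simp add: m_def)
  then have \<tau>: "0 < \<tau>" using assms(4) by (simp add: \<tau>_def)
  have "\<forall>i a b. \<exists>r. r \<in> rational_complex \<and> cmod (r - ent (\<psi> l0 (y i)) a b) < \<tau>"
    using rational_complex_approx[OF \<tau>] by blast
  then obtain c where c: "\<And>i a b. c i a b \<in> rational_complex" "\<And>i a b. cmod (c i a b - ent (\<psi> l0 (y i)) a b) < \<tau>"
    by metis
  have "norm (x i - (\<Sum>a<m. \<Sum>b<m. c i a b *\<^sub>C A.e a b)) < \<delta>" for i
  proof -
    have "y i - (\<Sum>a<m. \<Sum>b<m. c i a b *\<^sub>C A.e a b) = (\<Sum>a<m. \<Sum>b<m. (ent (\<psi> l0 (y i)) a b - c i a b) *\<^sub>C A.e a b)"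
      using A.expansion[OF y[of i]] by (simp add: m_def sum_subtractf complex_vs.scale_left_diff_distrib)
    also have "norm \<dots> \<le> (\<Sum>a<m. \<Sum>b<m. \<tau>)"
      using c(2) by (intro sum_norm_le) (auto simp: norm_scaleC A.norm_e m_def norm_minus_commute intro: less_imp_le)
    also have "\<dots> = \<delta> / 2" using m by (simp add: \<tau>_def power2_eq_square)
    finally have "norm (y i - (\<Sum>a<m. \<Sum>b<m. c i a b *\<^sub>C A.e a b)) \<le> \<delta> / 2" .
    then show ?thesis
      using ly(2)[of i] norm_triangle_ineq[of "x i - y i" "y i - (\<Sum>a<m. \<Sum>b<m. c i a b *\<^sub>C A.e a b)"]
      by (simp add: norm_minus_commute)
  qed
  then show ?thesis using c(1) unfolding m_def by blast
qed

text \<open>The relations of matrix units, the approximate expansion of each \<open>x i\<close> and the variables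
  themselves are finitely many rational polynomials; a tuple in \<^const>\<open>Gamma_top\<close> that controls their
  norms has approximate matrix units. The bound \<open>M + 1\<close> comes from the variables and holds for
  every \<open>R\<close>, which makes all later estimates independent of \<open>R\<close>.\<close>

theorem approximately_conjugate_to_model:
  fixes x :: "'n::finite \<Rightarrow> 'a::cstar_algebra"
  assumes enum: "P ` {1..} = rational_ncpolys" and uhf: "uhf_algebra TYPE('a)"
    and sa: "\<And>i. star (x i) = x i" and gen: "generates_cstar (range x)"
    and M: "\<And>i. norm (x i) \<le> M" and \<delta>: "0 < \<delta>" "\<delta> \<le> 1 / 2"
  shows "\<exists>\<epsilon>>0. \<exists>r\<ge>1. \<exists>m\<ge>1. \<exists>c. \<forall>R k A. A \<in> Gamma_top P x R k \<epsilon> r \<longrightarrow>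
    (\<forall>i. norm (emb (A i)) \<le> M + 1) \<and>
    (\<exists>t W. k = m * t \<and> near_isometry k \<delta> W \<and> (\<forall>i. norm (emb (A i) - W * model m t (c i) * adj W) \<le> \<delta>))"
proof -
  obtain B :: "nat \<Rightarrow> 'a set" and kk \<psi> where B: "incseq B" "\<And>l. matrix_subalgebra (B l) (kk l) (\<psi> l)"
    "closure (\<Union>l. B l) = UNIV" using uhf_matrix_subalgebras[OF uhf] by blast
  obtain l c where c: "\<And>i a b. c i a b \<in> rational_complex"
    and xc: "\<And>i. norm (x i - (\<Sum>a<kk l. \<Sum>b<kk l. c i a b *\<^sub>C matrix_subalgebra.e (B l) (\<psi> l) a b)) < \<delta> / 4"
  proof -
    have "0 < \<delta> / 4" using \<delta> by simp
    from rational_combination_approx[OF B(2) B(1) B(3) this, where x = x] that show thesis by blast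
  qed
  interpret A: matrix_subalgebra "B l" "kk l" "\<psi> l" by (rule B(2))
  define m where "m = kk l"
  define e where "e = A.e"
  have m: "1 \<le> m" using A.k_pos by (simp add: m_def)
  have e_mult: "e a b * e c' d = (if b = c' then e a d else 0)" if "a < m" "b < m" "c' < m" "d < m" for a b c' d
    using A.e_mult that by (simp add: e_def m_def)
  have e_star: "star (e a b) = e b a" and ne: "norm (e a b) = 1" if "a < m" "b < m" for a b
    using A.e_star A.norm_e that by (simp_all add: e_def m_def)
  have e_sum: "(\<Sum>a<m. e a a) = 1" using A.e_sum by (simp add: e_def m_def)
  define C where "C = 1 + (\<Sum>i\<in>UNIV. \<Sum>a<m. \<Sum>b<m. cmod (c i a b))"
  have C1: "1 \<le> C" unfolding C_def by (simp add: sum_nonneg)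
  have Ci: "(\<Sum>a<m. \<Sum>b<m. cmod (c i a b)) \<le> C" for i
  proof -
    have "(\<Sum>a<m. \<Sum>b<m. cmod (c i a b)) \<le> (\<Sum>i\<in>UNIV. \<Sum>a<m. \<Sum>b<m. cmod (c i a b))"
      by (rule member_le_sum) (auto intro!: sum_nonneg)
    then show ?thesis by (simp add: C_def)
  qed
  \<comment> \<open>\<open>40 m\<^sup>2 \<eta>\<close> is the error in \<open>approximate_matrix_units\<close>; \<open>C\<close> such errors must add up to \<open>\<delta> / 4\<close> at most.\<close>
  define \<eta> where "\<eta> = \<delta> / (160 * (real m)\<^sup>2 * C)"
  have m2: "1 \<le> (real m)\<^sup>2" using m by (auto intro: one_le_power)
  have "0 < (real m)\<^sup>2" "0 < C" using m2 C1 by linarith+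
  then have \<eta>: "0 < \<eta>" using \<delta> by (simp add: \<eta>_def)
  have \<eta>C: "C * (40 * (real m)\<^sup>2 * \<eta>) = \<delta> / 4" using m C1 by (simp add: \<eta>_def)
  have \<eta>m: "40 * (real m)\<^sup>2 * \<eta> \<le> \<delta> / 4"
  proof -
    have "1 * (40 * (real m)\<^sup>2 * \<eta>) \<le> C * (40 * (real m)\<^sup>2 * \<eta>)" using C1 \<eta> by (intro mult_right_mono) auto
    then show ?thesis using \<eta>C by simp
  qed
  have "40 * \<eta> \<le> 40 * (real m)\<^sup>2 * \<eta>" using m2 \<eta> by (intro mult_right_mono) auto
  then have \<eta>\<delta>: "40 * \<eta> \<le> \<delta> / 4" using \<eta>m by (rule order.trans)
  \<comment> \<open>Approximating \<open>e a b\<close> up to \<open>\<kappa>\<close> violates each relation of matrix units by \<open>\<eta> / 2\<close> at most; the tolerance \<open>\<eta> / 2\<close> in \<^const>\<open>Gamma_top\<close> is the other half.\<close>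
  define \<kappa> where "\<kappa> = \<eta> / (8 * real m)"
  have \<kappa>: "0 < \<kappa>" "8 * \<kappa> \<le> \<eta>" "real m * \<kappa> \<le> \<eta> / 2"
  proof -
    show "0 < \<kappa>" using \<eta> m by (simp add: \<kappa>_def)
    have "1 * \<kappa> \<le> real m * \<kappa>" using \<open>0 < \<kappa>\<close> m by (intro mult_right_mono) auto
    moreover have "real m * \<kappa> = \<eta> / 8" using m by (simp add: \<kappa>_def)
    ultimately show "8 * \<kappa> \<le> \<eta>" "real m * \<kappa> \<le> \<eta> / 2" using \<eta> by linarith+
  qed
  have C\<kappa>: "C * \<kappa> \<le> \<delta> / 4"
  proof -
    have "1 * \<eta> \<le> (40 * (real m)\<^sup>2) * \<eta>" using m2 \<eta> by (intro mult_right_mono) auto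
    then have "\<kappa> \<le> 40 * (real m)\<^sup>2 * \<eta>" using \<kappa> by linarith
    then have "C * \<kappa> \<le> C * (40 * (real m)\<^sup>2 * \<eta>)" using C1 by (intro mult_left_mono) auto
    then show ?thesis using \<eta>C by simp
  qed
  have "\<forall>a b. \<exists>p. p \<in> rational_ncpolys \<and> norm (eval_ncpoly p x - e a b) < \<kappa>"
    using rational_polynomials_dense[OF sa gen \<kappa>(1)] by blast
  then obtain p where p: "\<And>a b. p a b \<in> rational_ncpolys" "\<And>a b. norm (eval_ncpoly (p a b) x - e a b) < \<kappa>" by metis
  define E where "E a b = eval_ncpoly (p a b) x" for a b
  have Ee: "norm (E a b - e a b) \<le> \<kappa>" for a b using p(2)[of a b] by (simp add: E_def)
  have nE: "norm (E a b) \<le> 1 + \<kappa>" if "a < m" "b < m" for a b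
    using norm_triangle_ineq[of "E a b - e a b" "e a b"] Ee[of a b] ne[OF that] by simp
  have \<kappa>1: "1 + \<kappa> \<le> 2" using \<kappa> \<eta>\<delta> \<delta> by linarith

  define one where "one = (Poly_Mapping.single [] 1 :: 'n ncpoly)"
  define var where "var i = (Poly_Mapping.single [i] 1 :: 'n ncpoly)" for i
  define qm where "qm a b c' d = poly_mult (p a b) (p c' d) - (if b = c' then p a d else 0)" for a b c' d
  define qs where "qs a b = poly_star (p a b) - p b a" for a b
  define qu where "qu = (\<Sum>a<m. p a a) - one"
  define qx where "qx i = var i - (\<Sum>a<m. \<Sum>b<m. poly_mult (Poly_Mapping.single [] (c i a b)) (p a b))" for i
  define Q where "Q = range var \<union> range qx \<union> {qu} \<union> (\<lambda>(a, b). p a b) ` ({..<m} \<times> {..<m})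
    \<union> (\<lambda>(a, b). qs a b) ` ({..<m} \<times> {..<m}) \<union> (\<lambda>(a, b, c', d). qm a b c' d) ` ({..<m} \<times> {..<m} \<times> {..<m} \<times> {..<m})"
  have rat: "one \<in> rational_ncpolys" "\<And>i. var i \<in> rational_ncpolys" "\<And>a b c' d. qm a b c' d \<in> rational_ncpolys"
    "\<And>a b. qs a b \<in> rational_ncpolys" "qu \<in> rational_ncpolys" "\<And>i. qx i \<in> rational_ncpolys"
    unfolding one_def var_def qm_def qs_def qu_def qx_def
    by (auto intro!: rational_diff rational_single rational_mult rational_star rational_sum p(1) c rational_complex_intros rational_zero)
  have "finite Q" "Q \<subseteq> rational_ncpolys" unfolding Q_def using rat p(1) by auto
  then obtain r where r: "1 \<le> r" "Q \<subseteq> P ` {1..r}" using finite_polys_enumerated[OF enum] by blast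

  have ev: "eval_ncpoly one x = 1" "\<And>i. eval_ncpoly (var i) x = x i"
    "\<And>c. eval_ncpoly (Poly_Mapping.single [] c) x = c *\<^sub>C 1"
    by (simp_all add: one_def var_def eval_single)
  have vm: "norm (eval_ncpoly (qm a b c' d) x) \<le> \<eta> / 2" if "a < m" "b < m" "c' < m" "d < m" for a b c' d
  proof -
    have "eval_ncpoly (qm a b c' d) x = E a b * (E c' d - e c' d) + (E a b - e a b) * e c' d
        + (if b = c' then e a d - E a d else 0)"
      using e_mult[OF that] by (simp add: qm_def eval_diff eval_mult E_def algebra_simps eval_ncpoly_def[of 0])
    also have "norm \<dots> \<le> 2 * \<kappa> + \<kappa> * 1 + \<kappa>"
      using nE[of a b] \<kappa>1 Ee[of a b] Ee[of c' d] Ee[of a d] ne[of c' d] that \<kappa>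
      by (intro norm_triangle_le add_mono norm_mult_le) (auto simp: norm_minus_commute)
    finally show ?thesis using \<kappa> by linarith
  qed
  have vs: "norm (eval_ncpoly (qs a b) x) \<le> \<eta> / 2" if "a < m" "b < m" for a b
  proof -
    have "eval_ncpoly (qs a b) x = star (E a b - e a b) + (e b a - E b a)"
      using e_star[OF that] by (simp add: qs_def eval_diff eval_star[OF sa] E_def star_diff)
    also have "norm \<dots> \<le> \<kappa> + \<kappa>"
      using Ee[of a b] Ee[of b a] by (intro norm_triangle_le add_mono) (auto simp: norm_minus_commute)
    finally show ?thesis using \<kappa> by linarith
  qed
  have vu: "norm (eval_ncpoly qu x) \<le> \<eta> / 2"
  proof -
    have "eval_ncpoly qu x = (\<Sum>a<m. E a a - e a a)"
      by (simp add: qu_def eval_diff eval_sum ev sum_subtractf e_sum E_def)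
    also have "norm \<dots> \<le> real m * \<kappa>" by (rule norm_sum_le_mult) (rule Ee)
    finally show ?thesis using \<kappa> by linarith
  qed
  have vx: "norm (eval_ncpoly (qx i) x) \<le> \<delta> / 2" for i
  proof -
    have "eval_ncpoly (qx i) x = (x i - (\<Sum>a<m. \<Sum>b<m. c i a b *\<^sub>C e a b))
        + (\<Sum>a<m. \<Sum>b<m. c i a b *\<^sub>C (e a b - E a b))"
      by (simp add: qx_def eval_diff eval_sum eval_mult ev E_def scaleC_mult_left sum_subtractf complex_vs.scale_right_diff_distrib)
    also have "norm \<dots> \<le> \<delta> / 4 + (\<Sum>a<m. \<Sum>b<m. cmod (c i a b) * \<kappa>)"
      using xc[of i] Ee
      by (intro norm_triangle_le add_mono sum_norm_le)
        (auto simp: norm_scaleC m_def e_def norm_minus_commute intro!: mult_left_mono)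
    also have "(\<Sum>a<m. \<Sum>b<m. cmod (c i a b) * \<kappa>) \<le> C * \<kappa>"
      using mult_right_mono[OF Ci[of i], of \<kappa>] \<kappa> by (simp add: sum_distrib_right)
    finally show ?thesis using C\<kappa> by simp
  qed

  have main: "(\<forall>i. norm (emb (A i)) \<le> M + 1) \<and> (\<exists>t W. k = m * t \<and> near_isometry k \<delta> W
      \<and> (\<forall>i. norm (emb (A i) - W * model m t (c i) * adj W) \<le> \<delta>))"
    if A: "A \<in> Gamma_top P x R k (\<eta> / 2) r" for R k A
  proof -
    define F where "F i = emb (A i)" for i
    have Fk: "F i \<in> rect k k" and aF: "adj (F i) = F i" for i using Gamma_topD[OF A] by (simp_all add: F_def)
    have close: "norm (eval_at k q F) \<le> norm (eval_ncpoly q x) + \<eta> / 2" if "q \<in> Q" for q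
    proof -
      have "q \<in> P ` {1..r}" using r that by blast
      then obtain j where j: "j \<in> {1..r}" "q = P j" by (rule imageE) blast
      then show ?thesis using Gamma_topD(5)[OF A j(1)] unfolding F_def[abs_def] abs_le_iff j(2) by linarith
    qed
    have evF: "eval_at k one F = idm k" "eval_at k (var i) F = F i" "eval_at k (Poly_Mapping.single [] c) F = cs c (idm k)" for i c
      using mult_idm[OF Fk] by (simp_all add: one_def var_def eval_at_single)
    have nF: "norm (emb (A i)) \<le> M + 1" for i
      using close[of "var i"] M[of i] \<eta>\<delta> \<delta> \<eta> by (simp add: evF ev Q_def F_def)
    define G where "G a b = eval_at k (p a b) F" for a b
    have Gk: "G a b \<in> rect k k" for a b unfolding G_def by (rule eval_at_rect[OF Fk])
    have "\<exists>t W. W \<in> rect k (m * t) \<and> norm (adj W * W - idm (m * t)) \<le> 40 * (real m)\<^sup>2 * \<eta>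
      \<and> norm (W * adj W - idm k) \<le> 40 * (real m)\<^sup>2 * \<eta>
      \<and> (\<forall>a<m. \<forall>b<m. norm (G a b - W * munit m t a b * adj W) \<le> 40 * (real m)\<^sup>2 * \<eta>)"
    proof (rule approximate_matrix_units[OF m])
      show "norm (G a b * G c' d - (if b = c' then G a d else 0)) \<le> \<eta>" if "a < m" "b < m" "c' < m" "d < m" for a b c' d
      proof -
        have "qm a b c' d \<in> Q" unfolding Q_def
          by (rule UnI2, rule image_eqI[of _ _ "(a, b, c', d)"]) (use that in auto)
        moreover have "eval_at k (qm a b c' d) F = G a b * G c' d - (if b = c' then G a d else 0)"
          by (simp add: qm_def eval_at_diff eval_at_mult[OF Fk] G_def eval_at_def[of k 0] word_linear_def)
        ultimately show ?thesis using close[of "qm a b c' d"] vm[OF that] by simp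
      qed
      show "norm (adj (G a b) - G b a) \<le> \<eta>" if "a < m" "b < m" for a b
      proof -
        have "qs a b \<in> Q" unfolding Q_def
          by (rule UnI1, rule UnI2, rule image_eqI[of _ _ "(a, b)"]) (use that in auto)
        moreover have "eval_at k (qs a b) F = adj (G a b) - G b a"
          by (simp add: qs_def eval_at_diff eval_at_star[OF Fk aF] G_def)
        ultimately show ?thesis using close[of "qs a b"] vs[OF that] by simp
      qed
      show "norm ((\<Sum>a<m. G a a) - idm k) \<le> \<eta>"
      proof -
        have "eval_at k qu F = (\<Sum>a<m. G a a) - idm k" by (simp add: qu_def eval_at_diff eval_at_sum evF G_def)
        then show ?thesis using close[of qu] vu by (simp add: Q_def)
      qed
      show "norm (G a b) \<le> 2" if "a < m" "b < m" for a b
      proof -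
        have "p a b \<in> Q" unfolding Q_def
          by (rule UnI1, rule UnI1, rule UnI2, rule image_eqI[of _ _ "(a, b)"]) (use that in auto)
        then show ?thesis using close[of "p a b"] nE[OF that] \<kappa> \<eta>\<delta> \<delta> by (simp add: G_def E_def)
      qed
    qed (use Gk \<eta> in auto)
    then obtain t W where W: "W \<in> rect k (m * t)" and W1: "norm (adj W * W - idm (m * t)) \<le> 40 * (real m)\<^sup>2 * \<eta>"
      and W2: "norm (W * adj W - idm k) \<le> 40 * (real m)\<^sup>2 * \<eta>"
      and WG: "\<And>a b. a < m \<Longrightarrow> b < m \<Longrightarrow> norm (G a b - W * munit m t a b * adj W) \<le> 40 * (real m)\<^sup>2 * \<eta>"
      by blast
    have lt1: "40 * (real m)\<^sup>2 * \<eta> < 1" using \<eta>m \<delta> by linarith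
    have "m * t \<le> k" by (rule near_isometry_rank_le[OF W]) (use W1 lt1 in linarith)
    moreover have "k \<le> m * t" by (rule near_isometry_rank_le[OF rect_adj[OF W]]) (use W2 lt1 in simp)
    ultimately have k: "k = m * t" by simp
    have "near_isometry k \<delta> W" unfolding near_isometry_def using W W1 W2 \<eta>m \<delta> by (simp add: k)
    moreover have "norm (emb (A i) - W * model m t (c i) * adj W) \<le> \<delta>" for i
    proof -
      have "eval_at k (qx i) F = F i - (\<Sum>a<m. \<Sum>b<m. cs (c i a b) (G a b))"
        by (simp add: qx_def eval_at_diff eval_at_sum eval_at_mult[OF Fk] evF cs_mult_left idm_mult[OF eval_at_rect[OF Fk]] G_def)
      moreover have "qx i \<in> Q" by (simp add: Q_def)
      ultimately have 1: "norm (F i - (\<Sum>a<m. \<Sum>b<m. cs (c i a b) (G a b))) \<le> \<delta> / 2 + \<eta> / 2"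
        using close[of "qx i"] vx[of i] by simp
      have "(\<Sum>a<m. \<Sum>b<m. cs (c i a b) (G a b)) - W * model m t (c i) * adj W
        = (\<Sum>a<m. \<Sum>b<m. cs (c i a b) (G a b - W * munit m t a b * adj W))"
        by (simp add: model_def sum_distrib_left sum_distrib_right cs_mult_left cs_mult_right cs_diff_right sum_subtractf)
      also have "norm \<dots> \<le> (\<Sum>a<m. \<Sum>b<m. cmod (c i a b) * (40 * (real m)\<^sup>2 * \<eta>))"
        using WG by (intro sum_norm_le) (auto simp: norm_cs intro!: mult_left_mono)
      also have "\<dots> \<le> C * (40 * (real m)\<^sup>2 * \<eta>)"
        using mult_right_mono[OF Ci[of i], of "40 * (real m)\<^sup>2 * \<eta>"] \<eta> by (simp add: sum_distrib_right)
      finally have 2: "norm ((\<Sum>a<m. \<Sum>b<m. cs (c i a b) (G a b)) - W * model m t (c i) * adj W) \<le> \<delta> / 4"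
        using \<eta>C by simp
      show ?thesis
        using norm_triangle_ineq[of "F i - (\<Sum>a<m. \<Sum>b<m. cs (c i a b) (G a b))"
            "(\<Sum>a<m. \<Sum>b<m. cs (c i a b) (G a b)) - W * model m t (c i) * adj W"] 1 2 \<eta>\<delta> \<eta> \<delta>
        by (simp add: F_def)
    qed
    ultimately show ?thesis using k nF by blast
  qed
  have "0 < \<eta> / 2" using \<eta> by simp
  with r(1) m main show ?thesis by blast
qed

lemma tuple_norm_eq:
  assumes "\<And>i. A i \<in> carrier_mat k k" "\<And>i. B i \<in> carrier_mat k k"
  shows "tuple_norm (\<lambda>i. A i - B i) = Max (range (\<lambda>i::'n::finite. norm (emb (A i) - emb (B i))))"
  unfolding tuple_norm_def by (simp add: emb_diff[OF assms] flip: norm_emb)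

lemma covering_number_le_card:
  assumes "finite C" "C \<subseteq> \<Sigma>" "\<And>A. A \<in> \<Sigma> \<Longrightarrow> \<exists>B\<in>C. tuple_norm (\<lambda>i. A i - B i) < \<omega>"
  shows "covering_number \<Sigma> \<omega> \<le> enat (card C)"
  unfolding covering_number_def by (rule INF_lower) (use assms in blast)

text \<open>Tuples \<open>W Z W\<^sup>*\<close> that are \<open>\<omega>\<close> apart come from matrices \<open>W\<close> that are \<open>s\<close> apart, where \<open>s\<close> is proportional
  to \<open>\<omega>\<close>. A maximal \<open>\<omega>\<close>-separated set of tuples is a cover by balls with centers in the set.\<close>

theorem covering_number_upper:
  fixes x :: "'n::finite \<Rightarrow> 'a::cstar_algebra"
  assumes enum: "P ` {1..} = rational_ncpolys" and uhf: "uhf_algebra TYPE('a)"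
    and sa: "\<And>i. star (x i) = x i" and gen: "generates_cstar (range x)"
    and M: "\<And>i. norm (x i) \<le> M" "0 \<le> M" and \<omega>: "0 < \<omega>" "\<omega> < 1"
  shows "\<exists>\<epsilon>>0. \<exists>r\<ge>1. \<forall>R k. \<exists>n. covering_number (Gamma_top P x R k \<epsilon> r) \<omega> \<le> enat n
    \<and> real n \<le> (2 ^ 18 * (10 * (M + 1)) / \<omega>) ^ (k\<^sup>2)"
proof -
  define s \<delta> where "s = \<omega> / (10 * (M + 1))" and "\<delta> = \<omega> / (1600 * (M + 1))"
  have s: "0 < s" "s \<le> 1" and \<delta>: "0 < \<delta>" "\<delta> \<le> 1 / 100" "\<delta> \<le> s / 16" "\<delta> \<le> \<omega> / 8"
    using \<omega> M(2) unfolding s_def \<delta>_def by (auto simp: divide_simps)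
  obtain \<epsilon> r m c where \<epsilon>: "0 < \<epsilon>" "1 \<le> r" "1 \<le> m"
    and approx: "\<And>R k A. A \<in> Gamma_top P x R k \<epsilon> r \<Longrightarrow> (\<forall>i. norm (emb (A i)) \<le> M + 1) \<and>
    (\<exists>t W. k = m * t \<and> near_isometry k \<delta> W \<and> (\<forall>i. norm (emb (A i) - W * model m t (c i) * adj W) \<le> \<delta>))"
  proof -
    have "\<delta> \<le> 1 / 2" using \<delta>(2) by simp
    from approximately_conjugate_to_model[OF enum uhf sa gen M(1) \<delta>(1) this] that show thesis by blast
  qed
  have "\<exists>n. covering_number (Gamma_top P x R k \<epsilon> r) \<omega> \<le> enat n \<and> real n \<le> (2 ^ 18 * (10 * (M + 1)) / \<omega>) ^ (k\<^sup>2)" for R k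
  proof -
    let ?G = "Gamma_top P x R k \<epsilon> r"
    define t where "t = k div m"
    define Z where "Z i = model m t (c i)" for i
    have "\<forall>A\<in>?G. \<exists>W. near_isometry k \<delta> W \<and> (\<forall>i. norm (emb (A i) - W * Z i * adj W) \<le> \<delta>)"
    proof
      fix A assume "A \<in> ?G"
      with approx obtain t' W where "k = m * t'" "near_isometry k \<delta> W" "\<forall>i. norm (emb (A i) - W * model m t' (c i) * adj W) \<le> \<delta>"
        by blast
      moreover from this have "t' = t" using \<epsilon>(3) by (simp add: t_def)
      ultimately show "\<exists>W. near_isometry k \<delta> W \<and> (\<forall>i. norm (emb (A i) - W * Z i * adj W) \<le> \<delta>)"
        unfolding Z_def by blast
    qed
    then obtain W where W: "\<And>A. A \<in> ?G \<Longrightarrow> near_isometry k \<delta> (W A)"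
      and WZ: "\<And>A i. A \<in> ?G \<Longrightarrow> norm (emb (A i) - W A * Z i * adj (W A)) \<le> \<delta>" by metis
    have nW: "norm (W A) \<le> 101 / 100" if "A \<in> ?G" for A
      using W[OF that] near_isometry_norm[OF _ \<delta>(2)] by (auto simp: near_isometry_def)
    have Zk: "Z i \<in> rect k k" if "A \<in> ?G" for A i
    proof -
      from approx[OF that] obtain t' where "k = m * t'" by blast
      then have "k = m * t" using \<epsilon>(3) by (simp add: t_def)
      then show ?thesis using model_rect unfolding Z_def by metis
    qed
    have nZ: "norm (Z i) \<le> 2 * (M + 1)" if A: "A \<in> ?G" for A i
    proof -
      define V F where "V = W A" and "F = emb (A i)"
      have nV: "norm V \<le> 101 / 100" "norm (adj V) \<le> 101 / 100" using nW[OF A] by (simp_all add: V_def)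
      have V: "norm (adj V * V - idm k) \<le> \<delta>" using W[OF A] by (simp add: V_def near_isometry_def)
      have nF: "norm F \<le> M + 1" using approx[OF A] by (simp add: F_def)
      have FZ: "norm (V * Z i * adj V - F) \<le> \<delta>" using WZ[OF A, of i] by (simp add: V_def F_def norm_minus_commute)
      have "Z i = adj V * (V * Z i * adj V - F) * V + adj V * F * V
         - ((adj V * V - idm k) * Z i + (adj V * V) * Z i * (adj V * V - idm k))"
        using mult_idm[OF Zk[OF A]] idm_mult[OF Zk[OF A]] by (simp add: algebra_simps)
      then have "norm (Z i) \<le> norm (adj V * (V * Z i * adj V - F) * V + adj V * F * V)
         + norm ((adj V * V - idm k) * Z i + (adj V * V) * Z i * (adj V * V - idm k))"
        by (metis norm_triangle_ineq4)
      also have "\<dots> \<le> (101 / 100 * \<delta> * (101 / 100) + 101 / 100 * (M + 1) * (101 / 100))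
         + (\<delta> * norm (Z i) + 101 / 100 * (101 / 100) * norm (Z i) * \<delta>)"
        by (intro add_mono norm_triangle_le norm_mult_le nV FZ nF V order_refl)
      also have "\<dots> \<le> (11 / 10 * (1 / 100) + 11 / 10 * (M + 1)) + norm (Z i) * (3 / 100)"
      proof -
        define w where "w = norm (Z i) * \<delta>"
        have "w \<le> norm (Z i) * (1 / 100)" unfolding w_def using \<delta> by (intro mult_left_mono) auto
        then have le: "10201 / 10000 * \<delta> + 10201 / 10000 * (M + 1) + 20201 / 10000 * w
          \<le> (11 / 10 * (1 / 100) + 11 / 10 * (M + 1)) + norm (Z i) * (3 / 100)"
          using \<delta>(1,2) M(2) norm_ge_zero[of "Z i"] unfolding distrib_left by linarith
        have eq: "(101 / 100 * \<delta> * (101 / 100) + 101 / 100 * (M + 1) * (101 / 100))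
            + (\<delta> * norm (Z i) + 101 / 100 * (101 / 100) * norm (Z i) * \<delta>)
          = 10201 / 10000 * \<delta> + 10201 / 10000 * (M + 1) + 20201 / 10000 * w"
          by (simp add: w_def field_simps)
        show ?thesis unfolding eq by (rule le)
      qed
      finally show ?thesis using M(2) unfolding distrib_left by linarith
    qed
    have gap: "s \<le> norm (W A - W A')" if A: "A \<in> ?G" "A' \<in> ?G" and far: "\<omega> \<le> tuple_norm (\<lambda>i. A i - A' i)" for A A'
    proof -
      have "tuple_norm (\<lambda>i. A i - A' i) = Max (range (\<lambda>i. norm (emb (A i) - emb (A' i))))"
        by (rule tuple_norm_eq) (rule Gamma_topD(1)[OF A(1)], rule Gamma_topD(1)[OF A(2)])
      moreover have "\<dots> \<in> range (\<lambda>i. norm (emb (A i) - emb (A' i)))" by (rule Max_in) auto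
      ultimately have "tuple_norm (\<lambda>i. A i - A' i) \<in> range (\<lambda>i. norm (emb (A i) - emb (A' i)))" by (simp only:)
      then obtain i where "tuple_norm (\<lambda>i. A i - A' i) = norm (emb (A i) - emb (A' i))" by (rule imageE)
      with far have i: "\<omega> \<le> norm (emb (A i) - emb (A' i))" by simp
      define V V' where "V = W A" and "V' = W A'"
      have nV: "norm V \<le> 101 / 100" "norm V' \<le> 101 / 100" "norm (adj V) \<le> 101 / 100"
        using nW A by (simp_all add: V_def V'_def)
      have "emb (A i) - emb (A' i) = (emb (A i) - V * Z i * adj V) + (V' * Z i * adj V' - emb (A' i))
        + ((V - V') * Z i * adj V + V' * Z i * adj (V - V'))"
        by (simp add: algebra_simps adj_diff)
      also have "norm \<dots> \<le> (\<delta> + \<delta>) + (norm (V - V') * (2 * (M + 1)) * (101 / 100) + 101 / 100 * (2 * (M + 1)) * norm (V - V'))"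
        using WZ[OF A(1), of i] WZ[OF A(2), of i] nZ[OF A(1), of i]
        by (intro norm_triangle_le add_mono norm_mult_le nV) (auto simp: V_def V'_def norm_minus_commute)
      also have "\<dots> = 2 * \<delta> + 101 / 25 * ((M + 1) * norm (V - V'))"
        by (simp add: field_simps)
      also have "\<dots> \<le> 2 * \<delta> + 5 * ((M + 1) * norm (V - V'))"
        using M(2) by (intro add_left_mono mult_right_mono) auto
      finally have "\<omega> \<le> 2 * \<delta> + 5 * ((M + 1) * norm (V - V'))" using i by linarith
      then have "\<omega> / 2 \<le> 5 * ((M + 1) * norm (V - V'))" using \<delta>(4) \<omega> by linarith
      then have "\<omega> \<le> norm (V - V') * (10 * (M + 1))" by (simp add: algebra_simps)
      then show ?thesis using M(2) by (simp add: s_def V_def V'_def pos_divide_le_eq)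
    qed
    have bound: "real (card T) \<le> (2 ^ 18 * (10 * (M + 1)) / \<omega>) ^ (k\<^sup>2)"
      if T: "finite T" "T \<subseteq> ?G" "separated (\<lambda>A B. tuple_norm (\<lambda>i. A i - B i)) \<omega> T" for T
    proof -
      have gT: "s \<le> norm (W A - W A')" if "A \<in> T" "A' \<in> T" "A \<noteq> A'" for A A'
        using that T separatedD[OF T(3) that] by (intro gap) auto
      have inj: "inj_on W T" by (rule inj_onI) (use gT s in fastforce)
      have "real (card (W ` T)) \<le> (2 ^ 18 / s) ^ (k\<^sup>2)"
      proof (rule near_isometries_separated_card_le)
        show "nsep s (W ` T)" unfolding separated_def by (blast intro: gT)
      qed (use T W s \<delta> in auto)
      then show ?thesis by (simp add: card_image[OF inj] s_def)
    qed
    have "\<exists>C. finite C \<and> C \<subseteq> ?G \<and> separated (\<lambda>A B. tuple_norm (\<lambda>i. A i - B i)) \<omega> C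
      \<and> (\<forall>A\<in>?G. \<exists>B\<in>C. tuple_norm (\<lambda>i. A i - B i) < \<omega>)"
    proof (rule maximal_separated_set[where n = "nat \<lfloor>(2 ^ 18 * (10 * (M + 1)) / \<omega>) ^ (k\<^sup>2)\<rfloor>"])
      show "card T \<le> nat \<lfloor>(2 ^ 18 * (10 * (M + 1)) / \<omega>) ^ (k\<^sup>2)\<rfloor>"
        if "finite T" "T \<subseteq> ?G" "separated (\<lambda>A B. tuple_norm (\<lambda>i. A i - B i)) \<omega> T" for T
        using bound[OF that] by (simp add: le_nat_floor)
      show "tuple_norm (\<lambda>i. A i - B i) = tuple_norm (\<lambda>i. B i - A i)" if "A \<in> ?G" "B \<in> ?G" for A B
        using tuple_norm_eq[of A k B] tuple_norm_eq[of B k A] Gamma_topD(1)[OF that(1)] Gamma_topD(1)[OF that(2)]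
        by (simp add: norm_minus_commute)
      show "tuple_norm (\<lambda>i. A i - A i) < \<omega>" if "A \<in> ?G" for A
        using tuple_norm_eq[of A k A] Gamma_topD(1)[OF that] \<omega> by simp
    qed
    then obtain C where C: "finite C" "C \<subseteq> ?G" "separated (\<lambda>A B. tuple_norm (\<lambda>i. A i - B i)) \<omega> C"
      "\<And>A. A \<in> ?G \<Longrightarrow> \<exists>B\<in>C. tuple_norm (\<lambda>i. A i - B i) < \<omega>" by blast
    show ?thesis using covering_number_le_card[OF C(1,2,4)] bound[OF C(1-3)] by blast
  qed
  then show ?thesis using \<epsilon> by blast
qed

section \<open>The lower bound\<close>

lemma self_adjoint_approximants:
  fixes x :: "'n::finite \<Rightarrow> 'a::cstar_algebra"
  assumes sub: "\<And>l. matrix_subalgebra (B l) (k l) (\<psi> l)" and B: "incseq B" "closure (\<Union>l. B l) = UNIV"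
    and sa: "\<And>i. star (x i) = x i"
  shows "\<exists>y :: nat \<Rightarrow> 'n \<Rightarrow> 'a. (\<forall>j. \<exists>l. \<forall>i. y j i \<in> B l) \<and> (\<forall>j i. star (y j i) = y j i)
    \<and> (\<forall>i. (\<lambda>j. y j i) \<longlonglongrightarrow> x i)"
proof -
  have "\<exists>b\<in>(\<Union>l. B l). norm (b - x i) < 1 / real (Suc j)" for i j
  proof -
    have "x i \<in> closure (\<Union>l. B l)" using B by simp
    then show ?thesis unfolding closure_approachable dist_norm by (meson of_nat_0_less_iff zero_less_Suc zero_less_divide_1_iff)
  qed
  then have "\<forall>j i. \<exists>l b. b \<in> B l \<and> norm (b - x i) < 1 / real (Suc j)" by (meson UN_E)
  then obtain l b where b: "\<And>j i. b j i \<in> B (l j i)" "\<And>j i. norm (b j i - x i) < 1 / real (Suc j)" by metis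
  define y where "y j i = (1 / 2 :: complex) *\<^sub>C (b j i + star (b j i))" for j i
  have "y j i \<in> B (Max (range (l j)))" for j i
  proof -
    have "l j i \<le> Max (range (l j))" by (rule Max_ge) auto
    then have "B (l j i) \<subseteq> B (Max (range (l j)))" using B(1) unfolding incseq_def by blast
    then have "b j i \<in> B (Max (range (l j)))" using b(1)[of j i] by blast
    interpret A: matrix_subalgebra "B (Max (range (l j)))" "k (Max (range (l j)))" "\<psi> (Max (range (l j)))" by (rule sub)
    show ?thesis unfolding y_def
      by (intro A.scale_in A.add_in A.star_in) (rule \<open>b j i \<in> B (Max (range (l j)))\<close>)+
  qed
  moreover have "star (y j i) = y j i" for j i
    by (simp add: y_def star_scaleC star_add star_star add.commute)
  moreover have "(\<lambda>j. y j i) \<longlonglongrightarrow> x i" for i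
  proof -
    have "norm (y j i - x i) \<le> 1 / real (Suc j)" for j
    proof -
      have "x i = (1 / 2 :: complex) *\<^sub>C (x i + star (x i))"
        using sa[of i] by (simp add: complex_vs.scale_right_distrib flip: complex_vs.scale_left_distrib)
      then have "y j i - x i = (1 / 2 :: complex) *\<^sub>C ((b j i - x i) + star (b j i - x i))"
        by (metis (no_types, lifting) add_diff_add complex_vs.scale_right_diff_distrib star_diff y_def)
      then have "norm (y j i - x i) \<le> 1 / 2 * (norm (b j i - x i) + norm (b j i - x i))"
        using norm_triangle_ineq[of "b j i - x i" "star (b j i - x i)"] by (simp add: norm_scaleC norm_divide)
      then show ?thesis using b(2)[of j i] by simp
    qed
    then have "\<forall>\<^sub>F j in sequentially. norm (y j i - x i) \<le> 1 / real (Suc j)" by (rule always_eventually[OF allI])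
    moreover have "(\<lambda>j. 1 / real (Suc j)) \<longlonglongrightarrow> 0" using LIMSEQ_inverse_real_of_nat by (simp only: inverse_eq_divide)
    ultimately have "(\<lambda>j. y j i - x i) \<longlonglongrightarrow> 0" by (rule Lim_null_comparison)
    then show ?thesis by (rule LIM_zero_cancel)
  qed
  ultimately show ?thesis by blast
qed

text \<open>Conjugation by a unitary matrix commutes with the evaluation of polynomials and preserves norms.\<close>

lemma conjugate_in_Gamma_top:
  assumes Z: "\<And>i. Z i \<in> rect k k" "\<And>i. adj (Z i) = Z i" "\<And>i. norm (Z i) \<le> R"
    and ev: "\<And>j. j \<in> {1..r} \<Longrightarrow> \<bar>norm (eval_at k (P j) Z) - norm (eval_ncpoly (P j) x)\<bar> \<le> \<epsilon>"
    and U: "unitary_in k U"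
  shows "(\<lambda>i. tomat k (U * Z i * adj U)) \<in> Gamma_top P x R k \<epsilon> r"
proof -
  have Uk: "U \<in> rect k k" using U by (simp add: unitary_in_def)
  have UZ: "U * Z i * adj U \<in> rect k k" for i by (rule rect_times[OF rect_times[OF Uk Z(1)] rect_adj[OF Uk]])
  have "mat_adjoint (tomat k (U * Z i * adj U)) = tomat k (U * Z i * adj U)" for i
  proof (rule emb_inj[of _ k])
    show "mat_adjoint (tomat k (U * Z i * adj U)) \<in> carrier_mat k k"
      by (intro carrier_matI) (simp_all add: tomat_def)
    show "emb (mat_adjoint (tomat k (U * Z i * adj U))) = emb (tomat k (U * Z i * adj U))"
      unfolding emb_adjoint emb_tomat[OF UZ] by (simp add: adj_mult Z mult.assoc)
  qed simp
  moreover have "op_norm (tomat k (U * Z i * adj U)) \<le> R" for i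
    using norm_conjugate[OF U Z(1)] Z(3) by (simp add: UZ flip: norm_emb)
  moreover have "op_norm (eval_ncpoly_mat k p (\<lambda>i. tomat k (U * Z i * adj U))) = norm (eval_at k p Z)" for p
    using norm_conjugate[OF U eval_at_rect[OF Z(1)]]
    by (simp add: emb_eval_ncpoly_mat UZ eval_at_conjugate[OF U Z(1)] flip: norm_emb)
  ultimately show ?thesis using ev unfolding Gamma_top_def sa_mats_def by auto
qed

text \<open>Matrix units \<open>E\<close> of a fixed size \<open>K\<close> confine what almost commutes with them to a space of
  relative dimension \<open>1/K\<^sup>2\<close>: the compression by \<open>E 0 0\<close> almost determines it.\<close>

lemma compression_bounds_norm:
  assumes E: "\<And>a b c d. a < K \<Longrightarrow> b < K \<Longrightarrow> c < K \<Longrightarrow> d < K \<Longrightarrow> E a b * E c d = (if b = c then E a d else 0)"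
    and sum: "(\<Sum>a<K. E a a) = idm k" and nE: "\<And>a b. a < K \<Longrightarrow> b < K \<Longrightarrow> norm (E a b) \<le> 1"
    and d: "d \<in> rect k k" and K: "0 < K"
    and com: "\<And>a b. a < K \<Longrightarrow> b < K \<Longrightarrow> norm (E a b * d - d * E a b) \<le> \<tau>"
  shows "norm d \<le> real K * \<tau> + real K * norm (E 0 0 * d * E 0 0)"
proof -
  have "d = (\<Sum>a<K. E a 0 * E 0 a * d)"
  proof -
    have "(\<Sum>a<K. E a 0 * E 0 a * d) = (\<Sum>a<K. E a a) * d"
      unfolding sum_distrib_right by (rule sum.cong) (simp_all add: E K)
    then show ?thesis by (simp add: sum idm_mult[OF d])
  qed
  also have "\<dots> = (\<Sum>a<K. E a 0 * (E 0 a * d - d * E 0 a)) + (\<Sum>a<K. E a 0 * (E 0 0 * d * E 0 0) * E 0 a)"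
  proof -
    have "E a 0 * (E 0 0 * d * E 0 0) * E 0 a = E a 0 * d * E 0 a" if "a < K" for a
    proof -
      have "E a 0 * (E 0 0 * d * E 0 0) * E 0 a = (E a 0 * E 0 0) * d * (E 0 0 * E 0 a)" by (simp add: mult.assoc)
      then show ?thesis using that K by (simp add: E)
    qed
    then show ?thesis by (simp add: sum.distrib[symmetric] right_diff_distrib mult.assoc)
  qed
  also have "norm \<dots> \<le> real K * (1 * \<tau>) + real K * (1 * norm (E 0 0 * d * E 0 0) * 1)"
    using K by (intro norm_triangle_le add_mono norm_sum_le_mult norm_mult_le nE com order_refl)
  finally show ?thesis by simp
qed

text \<open>Unitaries \<open>U\<close> from a large separated set are sorted by the center of a ball that contains the
  conjugate \<open>U Z U\<^sup>*\<close>. Within one class the quotients \<open>U\<^sub>0\<^sup>* U\<close> commute with \<open>Z\<close> up to \<open>2 \<omega>\<close>, and thus are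
  separated by their compressions to a corner of size \<open>t = k / K\<close>.

  The constant \<open>L\<close> must not depend on \<open>\<omega>\<close>. The matrix units of size \<open>K\<close> are therefore approximated
  by polynomials only up to an error \<open>1 / (16 K)\<close> independent of \<open>\<omega>\<close>; in the commutator with the
  difference \<open>d\<close> of two quotients this error is multiplied by the norm of \<open>d\<close>, so that it can be absorbed.\<close>

theorem covering_number_lower:
  fixes x :: "'n::finite \<Rightarrow> 'a::cstar_algebra" and B :: "nat \<Rightarrow> 'a set"
  assumes sub: "\<And>l. matrix_subalgebra (B l) (kk l) (\<psi> l)" and B: "incseq B" "closure (\<Union>l. B l) = UNIV"
    and unb: "\<And>N l. \<exists>l'\<ge>l. N \<le> kk l'"
    and sa: "\<And>i. star (x i) = x i" and gen: "generates_cstar (range x)"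
    and M: "\<And>i. norm (x i) \<le> M" "0 \<le> M" and K: "K = kk l0"
  shows "\<exists>L\<ge>1. \<forall>\<omega> \<epsilon> r N. 0 < \<omega> \<longrightarrow> 32 * real K * L * \<omega> \<le> 1 \<longrightarrow> 0 < \<epsilon> \<longrightarrow>
    (\<exists>k\<ge>N. \<exists>t. 1 \<le> k \<and> k = K * t \<and> (\<forall>C. finite C \<longrightarrow> C \<subseteq> Gamma_top P x (M + 1) k \<epsilon> r \<longrightarrow>
      (\<forall>A\<in>Gamma_top P x (M + 1) k \<epsilon> r. \<exists>B\<in>C. tuple_norm (\<lambda>i. A i - B i) < \<omega>) \<longrightarrow>
      (1 / (32 * real K * L * \<omega>)) ^ (k\<^sup>2) \<le> real (card C) * (1 / (L * \<omega>)) ^ (2 * t\<^sup>2)))"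
proof -
  interpret A0: matrix_subalgebra "B l0" "kk l0" "\<psi> l0" by (rule sub)
  have K1: "1 \<le> K" using A0.k_pos by (simp add: K)
  have \<kappa>: "0 < 1 / (32 * real K)" using K1 by simp
  have "\<forall>a b. \<exists>q. q \<in> rational_ncpolys \<and> norm (eval_ncpoly q x - A0.e a b) < 1 / (32 * real K)"
    using rational_polynomials_dense[OF sa gen \<kappa>] by blast
  then obtain q where q: "\<And>a b. norm (eval_ncpoly (q a b) x - A0.e a b) < 1 / (32 * real K)" by metis
  have "\<forall>a b. \<exists>L\<ge>0. \<forall>k F X \<delta>. (\<forall>i. F i \<in> rect k k \<and> norm (F i) \<le> M + 1 \<and> norm (X * F i - F i * X) \<le> \<delta>) \<longrightarrow>
      X \<in> rect k k \<longrightarrow> 0 \<le> \<delta> \<longrightarrow> norm (X * eval_at k (q a b) F - eval_at k (q a b) F * X) \<le> L * \<delta>"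
    by (intro allI commutator_eval_le) (use M(2) in simp)
  then obtain L' where L': "\<And>a b. 0 \<le> L' a b"
    "\<And>a b k F X \<delta>. (\<And>i. F i \<in> rect k k \<and> norm (F i) \<le> M + 1 \<and> norm (X * F i - F i * X) \<le> \<delta>) \<Longrightarrow>
      X \<in> rect k k \<Longrightarrow> 0 \<le> \<delta> \<Longrightarrow> norm (X * eval_at k (q a b) F - eval_at k (q a b) F * X) \<le> L' a b * \<delta>"
    by metis
  define L where "L = 1 + (\<Sum>a<K. \<Sum>b<K. L' a b)"
  have L1: "1 \<le> L" unfolding L_def using L'(1) by (simp add: sum_nonneg)
  have L'L: "L' a b \<le> L" if "a < K" "b < K" for a b
  proof -
    have "L' a b \<le> (\<Sum>b<K. L' a b)" by (rule member_le_sum) (use that L'(1) in auto)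
    also have "\<dots> \<le> (\<Sum>a<K. \<Sum>b<K. L' a b)"
      using that L'(1) by (intro member_le_sum[of a "{..<K}" "\<lambda>a. \<Sum>b<K. L' a b"]) (auto intro!: sum_nonneg)
    finally show ?thesis by (simp add: L_def)
  qed
  obtain y :: "nat \<Rightarrow> 'n \<Rightarrow> 'a" where y: "\<And>j. \<exists>l. \<forall>i. y j i \<in> B l" "\<And>j i. star (y j i) = y j i"
    "\<And>i. (\<lambda>j. y j i) \<longlonglongrightarrow> x i"
    using self_adjoint_approximants[where x = x and B = B, OF sub B sa] by blast
  have ey: "(\<lambda>j. eval_ncpoly p (y j)) \<longlonglongrightarrow> eval_ncpoly p x" for p
    by (rule tendsto_eval) (rule y(3))
  have main: "\<exists>k\<ge>N. \<exists>t. 1 \<le> k \<and> k = K * t \<and> (\<forall>C. finite C \<longrightarrow> C \<subseteq> Gamma_top P x (M + 1) k \<epsilon> r \<longrightarrow>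
      (\<forall>A\<in>Gamma_top P x (M + 1) k \<epsilon> r. \<exists>B\<in>C. tuple_norm (\<lambda>i. A i - B i) < \<omega>) \<longrightarrow>
      (1 / (32 * real K * L * \<omega>)) ^ (k\<^sup>2) \<le> real (card C) * (1 / (L * \<omega>)) ^ (2 * t\<^sup>2))"
    if \<omega>: "0 < \<omega>" "32 * real K * L * \<omega> \<le> 1" and \<epsilon>: "0 < \<epsilon>" for \<omega> \<epsilon> r N
  proof -
    have Mlt: "norm (x i) < M + 1" for i using M(1)[of i] by simp
    have "\<forall>\<^sub>F j in sequentially. \<forall>i\<in>UNIV. norm (y j i) < M + 1"
      by (intro eventually_ball_finite ballI finite order_tendstoD(2)[OF tendsto_norm[OF y(3)]])
        (simp_all add: Mlt)
    moreover have "\<forall>\<^sub>F j in sequentially. \<forall>p\<in>{1..r}. \<bar>norm (eval_ncpoly (P p) (y j)) - norm (eval_ncpoly (P p) x)\<bar> < \<epsilon>"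
    proof (intro eventually_ball_finite ballI)
      fix p
      have "(\<lambda>j. norm (eval_ncpoly (P p) (y j))) \<longlonglongrightarrow> norm (eval_ncpoly (P p) x)" by (rule tendsto_norm[OF ey])
      then show "\<forall>\<^sub>F j in sequentially. \<bar>norm (eval_ncpoly (P p) (y j)) - norm (eval_ncpoly (P p) x)\<bar> < \<epsilon>"
        using \<epsilon> unfolding tendsto_iff dist_real_def by blast
    qed simp
    moreover have "\<forall>\<^sub>F j in sequentially. \<forall>ab\<in>{..<K} \<times> {..<K}. norm (eval_ncpoly (q (fst ab) (snd ab)) (y j)
        - eval_ncpoly (q (fst ab) (snd ab)) x) < 1 / (32 * real K)"
      using ey \<kappa> unfolding tendsto_iff dist_norm by (intro eventually_ball_finite ballI) auto
    ultimately have "\<forall>\<^sub>F j in sequentially. (\<forall>i\<in>UNIV. norm (y j i) < M + 1) \<and>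
       (\<forall>p\<in>{1..r}. \<bar>norm (eval_ncpoly (P p) (y j)) - norm (eval_ncpoly (P p) x)\<bar> < \<epsilon>) \<and>
       (\<forall>ab\<in>{..<K} \<times> {..<K}. norm (eval_ncpoly (q (fst ab) (snd ab)) (y j)
        - eval_ncpoly (q (fst ab) (snd ab)) x) < 1 / (32 * real K))" by (simp only: eventually_conj_iff)
    then obtain j where j: "\<And>i. norm (y j i) < M + 1"
        "\<And>p. p \<in> {1..r} \<Longrightarrow> \<bar>norm (eval_ncpoly (P p) (y j)) - norm (eval_ncpoly (P p) x)\<bar> < \<epsilon>"
        "\<And>a b. a < K \<Longrightarrow> b < K \<Longrightarrow> norm (eval_ncpoly (q a b) (y j) - eval_ncpoly (q a b) x) < 1 / (32 * real K)"
      using eventually_happens'[OF sequentially_bot] by fastforce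
    obtain l1 where l1: "\<And>i. y j i \<in> B l1" using y(1) by blast
    obtain l where l: "max l0 l1 \<le> l" "max N 1 \<le> kk l" using unb by blast
    have Bl: "B l0 \<subseteq> B l" "B l1 \<subseteq> B l" using B(1) l(1) by (auto simp: incseq_def)
    interpret A: matrix_subalgebra "B l" "kk l" "\<psi> l" by (rule sub)
    define k where "k = kk l"
    have yl: "y j i \<in> B l" for i using l1 Bl by blast
    define Z where "Z i = \<psi> l (y j i)" for i
    have Zk: "Z i \<in> rect k k" and aZ: "adj (Z i) = Z i" and nZ: "norm (Z i) \<le> M + 1" for i
      using A.\<psi>_rect[OF yl] A.\<psi>_star[OF yl] y(2) A.isometric[OF yl] j(1)[of i] by (auto simp: Z_def k_def less_imp_le)
    have evZ: "eval_at k p Z = \<psi> l (eval_ncpoly p (y j))" for p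
      using A.\<psi>_eval[of "y j" p] yl by (simp add: Z_def[abs_def] k_def)
    obtain t W where t: "k = K * t" "1 \<le> t" and W: "unitary_in k W"
      and EW: "\<And>a b. a < K \<Longrightarrow> b < K \<Longrightarrow> \<psi> l (A0.e a b) = W * munit K t a b * adj W"
      using embedded_matrix_units[OF sub sub Bl(1)] unfolding k_def K by blast
    define E where "E a b = \<psi> l (A0.e a b)" for a b
    have eB: "A0.e a b \<in> B l" if "a < K" "b < K" for a b using A0.e_in that Bl by (auto simp: K)
    have Emult: "E a b * E c d = (if b = c then E a d else 0)" if "a < K" "b < K" "c < K" "d < K" for a b c d
      using A.\<psi>_mult[OF eB eB, of a b c d] that A0.e_mult[of a b c d]
      by (cases "b = c") (simp_all add: E_def K A.\<psi>_zero)
    have Esum: "(\<Sum>a<K. E a a) = idm k"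
      using A.\<psi>_sum[of "{..<K}" "\<lambda>a. A0.e a a"] eB A0.e_sum by (simp add: E_def K A.\<psi>_one k_def)
    have nE: "norm (E a b) \<le> 1" if "a < K" "b < K" for a b
      using A.isometric[OF eB[OF that]] A0.norm_e that by (simp add: E_def K)
    have fE: "norm (eval_at k (q a b) Z - E a b) \<le> 1 / (16 * real K)" if ab: "a < K" "b < K" for a b
    proof -
      have "eval_at k (q a b) Z - E a b = \<psi> l (eval_ncpoly (q a b) (y j) - A0.e a b)"
        by (simp add: evZ E_def A.\<psi>_diff A.eval_in yl eB ab)
      then have "norm (eval_at k (q a b) Z - E a b) = norm (eval_ncpoly (q a b) (y j) - A0.e a b)"
        using A.isometric A.diff_in A.eval_in yl eB ab by metis
      also have "\<dots> \<le> 1 / (32 * real K) + 1 / (32 * real K)"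
        using norm_triangle_ineq[of "eval_ncpoly (q a b) (y j) - eval_ncpoly (q a b) x" "eval_ncpoly (q a b) x - A0.e a b"]
          j(3)[OF ab] q[of a b] by simp
      finally show ?thesis by simp
    qed
    \<comment> \<open>Commutators cost \<open>4 K L \<omega> = s / 4\<close> below, a fraction of the separation \<open>s\<close>.\<close>
    define s where "s = 16 * real K * L * \<omega>"
    have s: "0 < s" "2 * s \<le> 1" using \<omega> K1 L1 by (simp_all add: s_def)
    obtain T where T: "finite T" "\<And>U. U \<in> T \<Longrightarrow> unitary_in k U" "nsep s T" "(1 / (2 * s)) ^ (k\<^sup>2) \<le> real (card T)"
      using separated_unitaries[OF s, of k] by blast
    define orb where "orb U i = tomat k (U * Z i * adj U)" for U i
    have orb: "orb U \<in> Gamma_top P x (M + 1) k \<epsilon> r" if "unitary_in k U" for U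
      unfolding orb_def
    proof (rule conjugate_in_Gamma_top[OF Zk aZ nZ _ that])
      fix p assume "p \<in> {1..r}"
      then show "\<bar>norm (eval_at k (P p) Z) - norm (eval_ncpoly (P p) x)\<bar> \<le> \<epsilon>"
        using j(2)[of p] A.isometric[OF A.eval_in, of "y j" "P p"] yl by (simp add: evZ)
    qed
    have "(1 / (32 * real K * L * \<omega>)) ^ (k\<^sup>2) \<le> real (card C) * (1 / (L * \<omega>)) ^ (2 * t\<^sup>2)"
      if C: "finite C" "C \<subseteq> Gamma_top P x (M + 1) k \<epsilon> r"
        "\<And>A. A \<in> Gamma_top P x (M + 1) k \<epsilon> r \<Longrightarrow> \<exists>B\<in>C. tuple_norm (\<lambda>i. A i - B i) < \<omega>" for C
    proof -
      have "\<forall>U\<in>T. \<exists>B\<in>C. tuple_norm (\<lambda>i. orb U i - B i) < \<omega>" using C(3) orb T(2) by blast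
      then obtain c where c: "\<And>U. U \<in> T \<Longrightarrow> c U \<in> C" "\<And>U. U \<in> T \<Longrightarrow> tuple_norm (\<lambda>i. orb U i - c U i) < \<omega>" by metis
      have near: "norm (U * Z i * adj U - emb (c U i)) < \<omega>" if U: "U \<in> T" for U i
      proof -
        have Uk: "U \<in> rect k k" using T(2)[OF U] by (simp add: unitary_in_def)
        have e: "emb (orb U i) = U * Z i * adj U" for i
          unfolding orb_def by (rule emb_tomat[OF rect_times[OF rect_times[OF Uk Zk] rect_adj[OF Uk]]])
        have "norm (emb (orb U i) - emb (c U i)) \<le> Max (range (\<lambda>i. norm (emb (orb U i) - emb (c U i))))"
          by (rule Max_ge) auto
        also have "\<dots> = tuple_norm (\<lambda>i. orb U i - c U i)"
          using c(1)[OF U] C(2) by (intro tuple_norm_eq[symmetric, of _ k]) (auto intro: Gamma_topD(1) simp: orb_def)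
        finally show ?thesis using c(2)[OF U] by (simp add: e)
      qed
      have fiber: "real (card {U \<in> T. c U = A}) \<le> (1 / (L * \<omega>)) ^ (2 * t\<^sup>2)" if "A \<in> C" for A
      proof (cases "{U \<in> T. c U = A} = {}")
        case True
        show ?thesis unfolding True using L1 \<omega> by simp
      next
        case False
        define Fi where "Fi = {U \<in> T. c U = A}"
        obtain U0 where U0: "U0 \<in> T" "c U0 = A" using False by blast
        have U0k: "U0 \<in> rect k k" and U0': "adj U0 * U0 = idm k" "U0 * adj U0 = idm k" and nU0: "norm U0 \<le> 1"
          using T(2)[OF U0(1)] norm_unitary_le by (auto simp: unitary_in_def)
        have com: "norm ((adj U0 * U) * eval_at k (q a b) Z - eval_at k (q a b) Z * (adj U0 * U)) \<le> L * (2 * \<omega>)"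
          if U: "U \<in> Fi" and ab: "a < K" "b < K" for U a b
        proof -
          have UT: "U \<in> T" "c U = A" using U by (auto simp: Fi_def)
          have Uk: "U \<in> rect k k" and U': "adj U * U = idm k" and nU: "norm U \<le> 1"
            using T(2)[OF UT(1)] norm_unitary_le by (auto simp: unitary_in_def)
          have "norm ((adj U0 * U) * Z i - Z i * (adj U0 * U)) \<le> 2 * \<omega>" for i
          proof -
            have "(adj U0 * U) * Z i - Z i * (adj U0 * U)
              = adj U0 * U * Z i * (adj U * U) - (adj U0 * U0) * Z i * (adj U0 * U)"
              using mult_idm[OF Zk] idm_mult[OF Zk] by (simp add: U' U0' mult.assoc)
            also have "\<dots> = adj U0 * ((U * Z i * adj U - emb (A i)) + (emb (A i) - U0 * Z i * adj U0)) * U"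
              by (simp add: algebra_simps)
            also have "norm \<dots> \<le> 1 * (\<omega> + \<omega>) * 1"
              using near[OF UT(1), of i] near[OF U0(1), of i] nU0
              by (intro norm_mult_le norm_triangle_le add_mono nU) (auto simp: UT U0 norm_minus_commute)
            finally show ?thesis by simp
          qed
          then have "norm ((adj U0 * U) * eval_at k (q a b) Z - eval_at k (q a b) Z * (adj U0 * U)) \<le> L' a b * (2 * \<omega>)"
            using Zk nZ \<omega> by (intro L'(2)) (auto intro: rect_times rect_adj U0k Uk)
          also have "\<dots> \<le> L * (2 * \<omega>)" using L'L[OF ab] \<omega> by (intro mult_right_mono) auto
          finally show ?thesis .
        qed
        define b0 where "b0 = block K t 0"
        have b0: "b0 * adj b0 = idm t" using block_mult_adj[of 0 K 0 t] K1 by (simp add: b0_def)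
        have b0k: "b0 \<in> rect t k" by (simp add: b0_def t)
        have "(norm b0)\<^sup>2 \<le> 1\<^sup>2" using norm_mult_adj_self[of b0] b0 norm_idm_le[of t] by simp
        then have nb: "norm b0 \<le> 1" by (rule power2_le_imp_le) simp
        have Wk: "W \<in> rect k k" and nW: "norm W \<le> 1" using W norm_unitary_le by (auto simp: unitary_in_def)
        define g where "g U = b0 * adj W * (adj U0 * U) * W * adj b0" for U
        have E00: "E 0 0 = W * adj b0 * b0 * adj W" using EW[of 0 0] K1 by (simp add: E_def munit_def b0_def mult.assoc)
        have gap: "s / (2 * real K) \<le> norm (g U - g U')" if U: "U \<in> Fi" "U' \<in> Fi" "U \<noteq> U'" for U U'
        proof -
          define d where "d = adj U0 * U - adj U0 * U'"
          have Uk: "U \<in> rect k k" "U' \<in> rect k k" using U T(2) by (auto simp: Fi_def unitary_in_def)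
          have dk: "d \<in> rect k k" unfolding d_def
            by (rule rect_diff[OF rect_times[OF rect_adj[OF U0k] Uk(1)] rect_times[OF rect_adj[OF U0k] Uk(2)]])
          have "s \<le> norm (U - U')" using separatedD[OF T(3)] U by (auto simp: Fi_def)
          also have "U - U' = U0 * d"
            using idm_mult[OF Uk(1)] idm_mult[OF Uk(2)] by (simp add: d_def right_diff_distrib U0' flip: mult.assoc)
          also have "norm \<dots> \<le> 1 * norm d" using nU0 by (intro norm_mult_le order_refl)
          finally have sd: "s \<le> norm d" by simp
          have cE: "norm (E a b * d - d * E a b) \<le> 4 * L * \<omega> + norm d / (8 * real K)" if ab: "a < K" "b < K" for a b
          proof -
            define f where "f = eval_at k (q a b) Z"
            have "E a b * d - d * E a b = (((adj U0 * U') * f - f * (adj U0 * U')) + (f * (adj U0 * U) - (adj U0 * U) * f))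
              + ((E a b - f) * d + d * (f - E a b))"
              by (simp add: d_def algebra_simps)
            also have "norm \<dots> \<le> (L * (2 * \<omega>) + L * (2 * \<omega>)) + (1 / (16 * real K) * norm d + norm d * (1 / (16 * real K)))"
              using com[OF U(1) ab] com[OF U(2) ab] fE[OF ab] unfolding f_def
              by (intro norm_triangle_le add_mono norm_mult_le) (auto simp: norm_minus_commute)
            finally show ?thesis by simp
          qed
          have "E 0 0 * d * E 0 0 = W * adj b0 * (g U - g U') * b0 * adj W"
            by (simp add: E00 g_def d_def algebra_simps)
          also have "norm \<dots> \<le> 1 * 1 * norm (g U - g U') * 1 * 1"
            using nW nb by (intro norm_mult_le order_refl) auto
          finally have n00: "norm (E 0 0 * d * E 0 0) \<le> norm (g U - g U')" by simp
          have "norm d \<le> real K * (4 * L * \<omega> + norm d / (8 * real K)) + real K * norm (E 0 0 * d * E 0 0)"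
            using K1 by (intro compression_bounds_norm[OF Emult Esum nE dk _ cE]) auto
          also have "\<dots> \<le> real K * (4 * L * \<omega> + norm d / (8 * real K)) + real K * norm (g U - g U')"
            using n00 by (intro add_left_mono mult_left_mono) auto
          also have "real K * (4 * L * \<omega> + norm d / (8 * real K)) = s / 4 + norm d / 8"
            using K1 by (simp add: s_def field_simps)
          finally have "s / 2 \<le> real K * norm (g U - g U')" using sd s by linarith
          then show ?thesis using K1 by (simp add: field_simps)
        qed
        have s0: "0 < s / (2 * real K)" using s K1 by simp
        have inj: "inj_on g Fi" by (rule inj_onI) (use gap s0 in fastforce)
        have "real (card (g ` Fi)) \<le> (8 * 1 / (s / (2 * real K))) ^ (2 * t\<^sup>2)"
        proof (rule matrix_separated_card_le)
          show "finite (g ` Fi)" using T(1) by (simp add: Fi_def)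
          show "nsep (s / (2 * real K)) (g ` Fi)" unfolding separated_def by (blast intro: gap)
          show "s / (2 * real K) \<le> 1" using s K1 by (simp add: divide_simps)
          fix X assume "X \<in> g ` Fi"
          then obtain U where U: "U \<in> T" "X = g U" by (auto simp: Fi_def)
          have nU: "norm U \<le> 1" using norm_unitary_le[OF T(2)[OF U(1)]] .
          have "norm X \<le> 1 * 1 * (1 * 1) * 1 * 1"
            unfolding U g_def using nU nU0 nW nb by (intro norm_mult_le) auto
          moreover have "X \<in> rect t t"
          proof -
            have Uk: "U \<in> rect k k" using T(2)[OF U(1)] by (simp add: unitary_in_def)
            show ?thesis unfolding U g_def
              by (rule rect_times[OF rect_times[OF rect_times[OF rect_times[OF b0k rect_adj[OF Wk]]
                rect_times[OF rect_adj[OF U0k] Uk]] Wk] rect_adj[OF b0k]])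
          qed
          ultimately show "X \<in> rect t t \<and> norm X \<le> 1" by simp
        qed (rule s0)
        also have "8 * 1 / (s / (2 * real K)) = 1 / (L * \<omega>)" using K1 \<omega> L1 by (simp add: s_def field_simps)
        finally show ?thesis by (simp add: card_image[OF inj] flip: Fi_def)
      qed
      have T_eq: "T = (\<Union>A\<in>C. {U \<in> T. c U = A})" using c(1) by auto
      have "card T \<le> (\<Sum>A\<in>C. card {U \<in> T. c U = A})" by (subst T_eq) (rule card_UN_le[OF C(1)])
      then have "real (card T) \<le> (\<Sum>A\<in>C. real (card {U \<in> T. c U = A}))" by (simp flip: of_nat_sum)
      also have "\<dots> \<le> real (card C) * (1 / (L * \<omega>)) ^ (2 * t\<^sup>2)" using sum_mono[OF fiber] by simp
      finally have le: "real (card T) \<le> real (card C) * (1 / (L * \<omega>)) ^ (2 * t\<^sup>2)" .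
      have s2: "2 * s = 32 * real K * L * \<omega>" by (simp add: s_def)
      show ?thesis using T(4)[unfolded s2] le by (rule order.trans)
    qed
    then show ?thesis using l(2) t by (intro exI[of _ k] conjI exI[of _ t]) (auto simp: k_def)
  qed
  show ?thesis using L1 main by blast
qed

section \<open>The dimension of a UHF algebra\<close>

lemma log_enat_le:
  assumes "m \<le> enat n" "real n \<le> X" "1 \<le> X"
  shows "log_enat m \<le> ereal (ln X)"
proof (cases m)
  case (enat j)
  then have "real j \<le> X" using assms by simp
  then show ?thesis using assms(3) by (auto simp: log_enat_def enat)
qed (use assms in simp)

lemma ereal_divide_le: "y \<le> ereal a \<Longrightarrow> 0 < b \<Longrightarrow> y / ereal b \<le> ereal (a / b)"
  by (cases y) (auto simp: divide_right_mono)

lemma le_ereal_divide: "ereal a \<le> y \<Longrightarrow> 0 < b \<Longrightarrow> ereal (a / b) \<le> y / ereal b"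
  by (cases y) (auto simp: divide_right_mono)

lemma log_covering_number_ge:
  assumes "\<And>C. finite C \<Longrightarrow> C \<subseteq> \<Sigma> \<Longrightarrow> (\<forall>A\<in>\<Sigma>. \<exists>B\<in>C. tuple_norm (\<lambda>i. A i - B i) < \<omega>) \<Longrightarrow>
      0 < card C \<and> a \<le> ln (real (card C))"
  shows "ereal a \<le> log_enat (covering_number \<Sigma> \<omega>)"
proof -
  let ?S = "{C. finite C \<and> C \<subseteq> \<Sigma> \<and> (\<forall>A\<in>\<Sigma>. \<exists>B\<in>C. tuple_norm (\<lambda>i. A i - B i) < \<omega>)}"
  show ?thesis
  proof (cases "?S = {}")
    case True
    then have "covering_number \<Sigma> \<omega> = \<infinity>" unfolding covering_number_def by (simp only: image_empty Inf_empty top_enat_def)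
    then show ?thesis by (simp add: log_enat_def)
  next
    case False
    then have "(\<lambda>C. enat (card C)) ` ?S \<noteq> {}" by simp
    then have "covering_number \<Sigma> \<omega> \<in> (\<lambda>C. enat (card C)) ` ?S"
      unfolding covering_number_def by (metis (no_types, lifting) ex_in_conv wellorder_InfI)
    then obtain C where C: "C \<in> ?S" "covering_number \<Sigma> \<omega> = enat (card C)" by (rule imageE)
    then have "0 < card C \<and> a \<le> ln (real (card C))" by (intro assms) auto
    then show ?thesis by (simp add: C(2) log_enat_def)
  qed
qed

lemma le_limsup_if_frequently: "(\<And>N. \<exists>k\<ge>N. c \<le> f k) \<Longrightarrow> c \<le> limsup (f :: nat \<Rightarrow> ereal)"
  unfolding limsup_INF_SUP by (intro INF_greatest) (meson SUP_upper2 atLeast_iff)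

lemma tendsto_log_correction:
  fixes a b :: real
  shows "((\<lambda>\<omega>. ereal (a + b / (- ln \<omega>))) \<longlongrightarrow> ereal a) (at_right 0)"
proof -
  have "filterlim (\<lambda>\<omega>::real. - ln \<omega>) at_top (at_right 0)"
    using ln_at_0 by (simp add: filterlim_uminus_at_bot)
  then have "((\<lambda>\<omega>. b / (- ln \<omega>)) \<longlongrightarrow> 0) (at_right 0)"
    by (intro tendsto_divide_0[OF tendsto_const] filterlim_at_top_imp_at_infinity)
  then have "((\<lambda>\<omega>. a + b / (- ln \<omega>)) \<longlongrightarrow> a + 0) (at_right 0)" by (intro tendsto_add tendsto_const)
  then show ?thesis by (intro tendsto_ereal) simp
qed

theorem theorem5p4:
  fixes P :: "nat \<Rightarrow> 'n::finite ncpoly"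
    and x :: "'n \<Rightarrow> 'a::cstar_algebra"
  assumes enumeration: "P ` {1..} = rational_ncpolys"
    and uhf: "uhf_algebra TYPE('a)"
    and self_adjoint: "\<And>i. star (x i) = x i"
    and generates: "generates_cstar (range x)"
  shows "delta_top P x = 1"
proof -
  define M where "M = (\<Sum>i\<in>UNIV. norm (x i))"
  have M: "norm (x i) \<le> M" "0 \<le> M" for i
    unfolding M_def by (auto intro: sum_nonneg member_le_sum)
  define f where "f R \<epsilon> r \<omega> k = log_enat (covering_number (Gamma_top P x R k \<epsilon> r) \<omega>) / ereal (- ((real k)\<^sup>2 * ln \<omega>))"
    for R \<epsilon> r \<omega> k
  define F where "F \<omega> = (SUP R\<in>{0<..}. INF (\<epsilon>, r)\<in>{0<..} \<times> {1..}. limsup (f R \<epsilon> r \<omega>))" for \<omega>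
  have dF: "delta_top P x = Limsup (at_right 0) F"
    unfolding delta_top_def F_def f_def ..
  have small: "\<forall>\<^sub>F \<omega> in at_right (0::real). 0 < \<omega> \<and> \<omega> < b" if "0 < b" for b
    using eventually_at_right_real[OF that] by (auto elim: eventually_mono)

  have upper: "F \<omega> \<le> ereal (1 + ln (2 ^ 18 * (10 * (M + 1))) / (- ln \<omega>))" if \<omega>: "0 < \<omega>" "\<omega> < 1" for \<omega>
  proof -
    define D where "D = 2 ^ 18 * (10 * (M + 1))"
    have D: "1 \<le> D" using M(2) by (simp add: D_def)
    have l: "0 < - ln \<omega>" using \<omega> by simp
    obtain \<epsilon> r where \<epsilon>: "0 < \<epsilon>" "1 \<le> r"
      and cov: "\<And>R k. \<exists>n. covering_number (Gamma_top P x R k \<epsilon> r) \<omega> \<le> enat n \<and> real n \<le> (D / \<omega>) ^ (k\<^sup>2)"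
      using covering_number_upper[OF enumeration uhf self_adjoint generates M \<omega>] unfolding D_def by blast
    have "limsup (f R \<epsilon> r \<omega>) \<le> ereal (1 + ln D / (- ln \<omega>))" for R
    proof (rule Limsup_bounded, rule eventually_sequentiallyI[of 1])
      fix k :: nat assume k: "1 \<le> k"
      have D\<omega>: "1 \<le> D / \<omega>" using D \<omega> by (simp add: divide_simps)
      have "log_enat (covering_number (Gamma_top P x R k \<epsilon> r) \<omega>) \<le> ereal (ln ((D / \<omega>) ^ (k\<^sup>2)))"
        using cov[of R k] log_enat_le one_le_power[OF D\<omega>] by blast
      then have "f R \<epsilon> r \<omega> k \<le> ereal (ln ((D / \<omega>) ^ (k\<^sup>2)) / (- ((real k)\<^sup>2 * ln \<omega>)))"
        unfolding f_def using k l by (intro ereal_divide_le) (auto simp: mult_pos_neg)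
      also have "ln ((D / \<omega>) ^ (k\<^sup>2)) / (- ((real k)\<^sup>2 * ln \<omega>)) = 1 + ln D / (- ln \<omega>)"
        using D \<omega> k l by (simp add: ln_realpow ln_div field_simps)
      finally show "f R \<epsilon> r \<omega> k \<le> ereal (1 + ln D / (- ln \<omega>))" .
    qed
    then show ?thesis
      unfolding F_def D_def[symmetric] using \<epsilon>
      by (intro SUP_least INF_lower2[of "(\<epsilon>, r)"]) auto
  qed

  have le: "Limsup (at_right 0) F \<le> 1"
  proof -
    have "Limsup (at_right 0) F \<le> Limsup (at_right 0) (\<lambda>\<omega>. ereal (1 + ln (2 ^ 18 * (10 * (M + 1))) / (- ln \<omega>)))"
      by (rule Limsup_mono) (use small[of 1] upper in \<open>auto elim: eventually_mono\<close>)
    also have "\<dots> = ereal 1"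
      by (rule lim_imp_Limsup[OF trivial_limit_at_right_real tendsto_log_correction])
    finally show ?thesis unfolding one_ereal_def .
  qed

  obtain B :: "nat \<Rightarrow> 'a set" and kk \<psi> where B: "incseq B" "\<And>l. matrix_subalgebra (B l) (kk l) (\<psi> l)"
    "closure (\<Union>l. B l) = UNIV" "\<And>N l. \<exists>l'\<ge>l. N \<le> kk l'" using uhf_matrix_subalgebras[OF uhf] by blast
  have lower: "ereal (1 - 2 / (real (kk l0))\<^sup>2) \<le> Limsup (at_right 0) F" for l0
  proof -
    define K where "K = kk l0"
    have K1: "1 \<le> K" using matrix_subalgebra.k_pos[OF B(2)] by (simp add: K_def)
    obtain L where L: "1 \<le> L" and cov: "\<And>\<omega> \<epsilon> r N. 0 < \<omega> \<Longrightarrow> 32 * real K * L * \<omega> \<le> 1 \<Longrightarrow> 0 < \<epsilon> \<Longrightarrow>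
      (\<exists>k\<ge>N. \<exists>t. 1 \<le> k \<and> k = K * t \<and> (\<forall>C. finite C \<longrightarrow> C \<subseteq> Gamma_top P x (M + 1) k \<epsilon> r \<longrightarrow>
      (\<forall>A\<in>Gamma_top P x (M + 1) k \<epsilon> r. \<exists>B\<in>C. tuple_norm (\<lambda>i. A i - B i) < \<omega>) \<longrightarrow>
      (1 / (32 * real K * L * \<omega>)) ^ (k\<^sup>2) \<le> real (card C) * (1 / (L * \<omega>)) ^ (2 * t\<^sup>2)))"
      using covering_number_lower[OF B(2) B(1) B(3) B(4) self_adjoint generates M K_def, of P] by blast
    define b where "b = 1 / (32 * real K * L)"
    have KL: "32 \<le> 32 * real K * L" using mult_mono[of 1 "real K" 1 L] K1 L by simp
    then have b: "0 < b" "b < 1" unfolding b_def by (simp_all only: zero_less_divide_1_iff divide_less_eq_1) linarith+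
    have "ereal (1 - 2 / (real K)\<^sup>2 + (- ln (32 * real K * L)) / (- ln \<omega>)) \<le> F \<omega>" if \<omega>: "0 < \<omega>" "\<omega> < b" for \<omega>
    proof -
      have \<omega>': "32 * real K * L * \<omega> \<le> 1" using \<omega> KL unfolding b_def by (simp add: pos_less_divide_eq mult.commute)
      have l: "0 < - ln \<omega>" using \<omega> b by simp
      have "ereal (1 - 2 / (real K)\<^sup>2 + (- ln (32 * real K * L)) / (- ln \<omega>)) \<le> limsup (f (M + 1) \<epsilon> r \<omega>)"
        if \<epsilon>: "0 < \<epsilon>" for \<epsilon> r
      proof (rule le_limsup_if_frequently)
        fix N
        obtain k t where k: "N \<le> k" "1 \<le> k" "k = K * t"
          and C: "\<And>C. finite C \<Longrightarrow> C \<subseteq> Gamma_top P x (M + 1) k \<epsilon> r \<Longrightarrow>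
            (\<forall>A\<in>Gamma_top P x (M + 1) k \<epsilon> r. \<exists>B\<in>C. tuple_norm (\<lambda>i. A i - B i) < \<omega>) \<Longrightarrow>
            (1 / (32 * real K * L * \<omega>)) ^ (k\<^sup>2) \<le> real (card C) * (1 / (L * \<omega>)) ^ (2 * t\<^sup>2)"
          using cov[OF \<omega>(1) \<omega>' \<epsilon>, of N r] by blast
        define v where "v = (real k)\<^sup>2 * ((1 - 2 / (real K)\<^sup>2) * (- ln \<omega>) - ln (32 * real K * L))"
        have "ereal v \<le> log_enat (covering_number (Gamma_top P x (M + 1) k \<epsilon> r) \<omega>)"
        proof (rule log_covering_number_ge)
          fix C assume a: "finite C" "C \<subseteq> Gamma_top P x (M + 1) k \<epsilon> r"
            "\<forall>A\<in>Gamma_top P x (M + 1) k \<epsilon> r. \<exists>B\<in>C. tuple_norm (\<lambda>i. A i - B i) < \<omega>"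
          have X: "0 < 1 / (32 * real K * L * \<omega>)" "0 < 1 / (L * \<omega>)" using K1 L \<omega> by simp_all
          have pos: "0 < card C"
          proof (rule ccontr)
            assume "\<not> 0 < card C"
            then have "(1 / (32 * real K * L * \<omega>)) ^ (k\<^sup>2) \<le> 0" using C[OF a] by simp
            with zero_less_power[OF X(1), of "k\<^sup>2"] show False by linarith
          qed
          have "ln ((1 / (32 * real K * L * \<omega>)) ^ (k\<^sup>2)) \<le> ln (real (card C) * (1 / (L * \<omega>)) ^ (2 * t\<^sup>2))"
            by (rule ln_mono[OF C[OF a] zero_less_power[OF X(1)]])
          then have 1: "(real k)\<^sup>2 * ln (1 / (32 * real K * L * \<omega>))
              \<le> ln (real (card C)) + 2 * (real t)\<^sup>2 * ln (1 / (L * \<omega>))"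
          proof -
            have "ln (real (card C) * (1 / (L * \<omega>)) ^ (2 * t\<^sup>2)) = ln (real (card C)) + ln ((1 / (L * \<omega>)) ^ (2 * t\<^sup>2))"
              by (rule ln_mult_pos) (use pos zero_less_power[OF X(2)] in simp_all)
            also have "ln ((1 / (L * \<omega>)) ^ (2 * t\<^sup>2)) = real (2 * t\<^sup>2) * ln (1 / (L * \<omega>))"
              by (rule ln_realpow)
            finally show ?thesis
              using \<open>ln (_ ^ (k\<^sup>2)) \<le> _\<close> ln_realpow[of "1 / (32 * real K * L * \<omega>)" "k\<^sup>2"] by simp
          qed
          have 2: "ln (1 / (32 * real K * L * \<omega>)) = - ln (32 * real K * L) - ln \<omega>"
            using K1 L \<omega> by (simp add: ln_div ln_mult)
          have 3: "ln (1 / (L * \<omega>)) \<le> - ln \<omega>" using L \<omega> by (simp add: ln_div ln_mult)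
          have 4: "2 * (real t)\<^sup>2 * ln (1 / (L * \<omega>)) \<le> 2 * (real t)\<^sup>2 * (- ln \<omega>)"
            by (rule mult_left_mono[OF 3]) simp
          have 5: "(real t)\<^sup>2 = (real k)\<^sup>2 / (real K)\<^sup>2" using k K1 by (simp add: power_mult_distrib)
          have "v = (real k)\<^sup>2 * (- ln (32 * real K * L) - ln \<omega>) - 2 * ((real k)\<^sup>2 / (real K)\<^sup>2) * (- ln \<omega>)"
            by (simp add: v_def algebra_simps)
          also have "\<dots> \<le> ln (real (card C))" using 1 4 unfolding 2 5 by linarith
          finally show "0 < card C \<and> v \<le> ln (real (card C))" using pos by simp
        qed
        then have "ereal (v / (- ((real k)\<^sup>2 * ln \<omega>))) \<le> f (M + 1) \<epsilon> r \<omega> k"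
          unfolding f_def using k(2) l by (intro le_ereal_divide) (auto simp: mult_pos_neg)
        moreover have "v / (- ((real k)\<^sup>2 * ln \<omega>)) = 1 - 2 / (real K)\<^sup>2 + (- ln (32 * real K * L)) / (- ln \<omega>)"
        proof -
          have "v / (- ((real k)\<^sup>2 * ln \<omega>)) = ((1 - 2 / (real K)\<^sup>2) * (- ln \<omega>) - ln (32 * real K * L)) / (- ln \<omega>)"
            using k(2) by (simp add: v_def)
          also have "\<dots> = 1 - 2 / (real K)\<^sup>2 + (- ln (32 * real K * L)) / (- ln \<omega>)"
            using l by (simp add: diff_divide_distrib)
          finally show ?thesis .
        qed
        ultimately show "\<exists>k\<ge>N. ereal (1 - 2 / (real K)\<^sup>2 + (- ln (32 * real K * L)) / (- ln \<omega>)) \<le> f (M + 1) \<epsilon> r \<omega> k"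
          using k(1) by (intro exI[of _ k]) simp
      qed
      then show ?thesis
        unfolding F_def using M(2) by (intro SUP_upper2[of "M + 1"] INF_greatest) auto
    qed
    then have "Limsup (at_right 0) (\<lambda>\<omega>. ereal (1 - 2 / (real K)\<^sup>2 + (- ln (32 * real K * L)) / (- ln \<omega>))) \<le> Limsup (at_right 0) F"
      by (intro Limsup_mono) (use small[OF b(1)] in \<open>auto elim: eventually_mono\<close>)
    moreover have "Limsup (at_right 0) (\<lambda>\<omega>. ereal (1 - 2 / (real K)\<^sup>2 + (- ln (32 * real K * L)) / (- ln \<omega>)))
        = ereal (1 - 2 / (real K)\<^sup>2)"
      by (rule lim_imp_Limsup[OF trivial_limit_at_right_real tendsto_log_correction])
    ultimately show ?thesis by (simp add: K_def)
  qed

  have "1 \<le> Limsup (at_right 0) F"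
  proof (rule ereal_le_epsilon2)
    fix e :: real assume e: "0 < e"
    obtain N :: nat where N: "2 / e < real N" using reals_Archimedean2 by blast
    obtain l where l: "max N 1 \<le> kk l" using B(4) by blast
    have "2 / e < (real (kk l))\<^sup>2"
    proof -
      have "real (kk l) \<le> (real (kk l))\<^sup>2" using l by (intro self_le_power) auto
      then show ?thesis using N l by linarith
    qed
    then have "2 / (real (kk l))\<^sup>2 \<le> e" using e l by (simp add: field_simps)
    then have "1 \<le> ereal (1 - 2 / (real (kk l))\<^sup>2) + ereal e" by simp
    also have "\<dots> \<le> Limsup (at_right 0) F + ereal e" by (rule add_right_mono[OF lower])
    finally show "1 \<le> Limsup (at_right 0) F + ereal e" .
  qed
  with le show ?thesis unfolding dF by (rule antisym)
qed

end
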